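(* Let $\mathcal G$ be an ample groupoid. Then $\mathcal G$ is AF if and only if $\mathcal G$ has homological dimension $0$.
   Context: Quasi-compact means every open cover has a finite subcover; compact means quasi-compact and Hausdorff. An ample groupoid is a topological groupoid $\mathcal G$ (source map $s$, range map $r$, product $gh$ defined when $s(g)=r(h)$) such that the unit space $\mathcal G^0$ is locally compact, Hausdorff and totally disconnected and $s\colon\mathcal G\to\mathcal G^0$ is a local homeomorphism. $\mathcal G$ is not assumed Hausdorff. A subgroupoid need not contain all units of $\mathcal G$. A groupoid is principal if every $g$ with $s(g)=r(g)$ is a unit. An ample groupoid is AF if it is a directed union of compact open principal subgroupoids. For a space $X$ with a basis of compact open sets, $\mathbb ZX$ is the additive subgroup of $\mathbb Z^X$ generated by the characteristic functions $1_U$ of compact open subsets $U\subseteq X$. $\mathbb Z\mathcal G$ is a (not necessarily unital) ring under convolution $(f\ast h)(g)=\sum_{r(a)=r(g)}f(a)h(a^{-1}g)$. A left module $M$ over $\mathbb Z\mathcal G$ is unitary if $\mathbb Z\mathcal G\cdot M=M$, and dually for right modules. The trivial right module is $\mathbb Z\mathcal G^0$ with $(hf)(x)=\sum_{s(g)=x}h(r(g))f(g)$ for $h\in\mathbb Z\mathcal G^0$, $f\in\mathbb Z\mathcal G$. For a unitary left $\mathbb Z\mathcal G$-module $M$, $H_n(\mathcal G,M)=\operatorname{Tor}_n^{\mathbb Z\mathcal G}(\mathbb Z\mathcal G^0,M)$, where Tor is computed in the category of unitary modules (which is abelian with enough projectives). The homological dimension of $\mathcal G$ is $\sup\{n\mid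 H_n(\mathcal G,-)\neq 0\}$; it is $0$ exactly when $H_n(\mathcal G,M)=0$ for all $n\geq 1$ and all unitary left $\mathbb Z\mathcal G$-modules $M$. *)

theory Defs
  imports
    "HOL-Analysis.Analysis"
    "HOL-Algebra.Free_Abelian_Groups"
    "HOL-Algebra.Module"
    "HOL-Library.Extended_Nat"
begin

section \<open>Topology\<close>

definition totally_disconnected_space :: "'a topology \<Rightarrow> bool" where
  "totally_disconnected_space X \<longleftrightarrow>
     (\<forall>S. connectedin X S \<longrightarrow> (\<forall>x\<in>S. \<forall>y\<in>S. x = y))"

definition local_homeomorphic_map :: "'a topology \<Rightarrow> 'b topology \<Rightarrow> ('a \<Rightarrow> 'b) \<Rightarrow> bool" where
  "local_homeomorphic_map X Y f \<longleftrightarrow>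
     (\<forall>x\<in>topspace X. \<exists>U. openin X U \<and> x \<in> U \<and> openin Y (f ` U) \<and>
        homeomorphic_map (subtopology X U) (subtopology Y (f ` U)) f)"

text \<open>Spaces need not be Hausdorff, and \<open>compactin\<close> is quasi-compactness; a compact set is
  in addition Hausdorff in its subspace topology.\<close>

definition compact_open :: "'a topology \<Rightarrow> 'a set \<Rightarrow> bool" where
  "compact_open X U \<longleftrightarrow>
     openin X U \<and> compactin X U \<and> Hausdorff_space (subtopology X U)"


section \<open>Ample groupoids\<close>

text \<open>The arrows are the points of the topology, the units are particular arrows, and
  \<open>gcomp G g h\<close> is meaningful only for \<open>src G g = rng G h\<close>.\<close>

record 'g groupoid =
  arr_top :: "'g topology"
  src :: "'g \<Rightarrow> 'g"
  rng :: "'g \<Rightarrow> 'g"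
  gcomp :: "'g \<Rightarrow> 'g \<Rightarrow> 'g"
  ginv :: "'g \<Rightarrow> 'g"

definition arrows :: "'g groupoid \<Rightarrow> 'g set" where
  "arrows G = topspace (arr_top G)"

definition units :: "'g groupoid \<Rightarrow> 'g set" where
  "units G = {g \<in> arrows G. src G g = g}"

definition unit_space :: "'g groupoid \<Rightarrow> 'g topology" where
  "unit_space G = subtopology (arr_top G) (units G)"

locale topological_groupoid =
  fixes G :: "'g groupoid"
  assumes src_unit: "g \<in> arrows G \<Longrightarrow> src G g \<in> units G"
    and rng_unit: "g \<in> arrows G \<Longrightarrow> rng G g \<in> units G"
    and rng_of_unit: "u \<in> units G \<Longrightarrow> rng G u = u"
    and comp_closed:
      "\<lbrakk>g \<in> arrows G; h \<in> arrows G; src G g = rng G h\<rbrakk> \<Longrightarrow> gcomp G g h \<in> arrows G"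
    and src_comp:
      "\<lbrakk>g \<in> arrows G; h \<in> arrows G; src G g = rng G h\<rbrakk> \<Longrightarrow> src G (gcomp G g h) = src G h"
    and rng_comp:
      "\<lbrakk>g \<in> arrows G; h \<in> arrows G; src G g = rng G h\<rbrakk> \<Longrightarrow> rng G (gcomp G g h) = rng G g"
    and comp_assoc:
      "\<lbrakk>g \<in> arrows G; h \<in> arrows G; k \<in> arrows G; src G g = rng G h; src G h = rng G k\<rbrakk>
       \<Longrightarrow> gcomp G (gcomp G g h) k = gcomp G g (gcomp G h k)"
    and comp_src: "g \<in> arrows G \<Longrightarrow> gcomp G g (src G g) = g"
    and comp_rng: "g \<in> arrows G \<Longrightarrow> gcomp G (rng G g) g = g"
    and ginv_closed: "g \<in> arrows G \<Longrightarrow> ginv G g \<in> arrows G"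
    and src_ginv: "g \<in> arrows G \<Longrightarrow> src G (ginv G g) = rng G g"
    and rng_ginv: "g \<in> arrows G \<Longrightarrow> rng G (ginv G g) = src G g"
    and ginv_comp: "g \<in> arrows G \<Longrightarrow> gcomp G (ginv G g) g = src G g"
    and comp_ginv: "g \<in> arrows G \<Longrightarrow> gcomp G g (ginv G g) = rng G g"
    and continuous_comp:
      "continuous_map
         (subtopology (prod_topology (arr_top G) (arr_top G)) {(g, h). src G g = rng G h})
         (arr_top G) (\<lambda>(g, h). gcomp G g h)"
    and continuous_ginv: "continuous_map (arr_top G) (arr_top G) (ginv G)"

locale ample_groupoid = topological_groupoid G for G :: "'g groupoid" +
  assumes locally_compact_units: "locally_compact_space (unit_space G)"
    and Hausdorff_units: "Hausdorff_space (unit_space G)"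
    and totally_disconnected_units: "totally_disconnected_space (unit_space G)"
    and local_homeo_src: "local_homeomorphic_map (arr_top G) (unit_space G) (src G)"

text \<open>A subgroupoid contains the source and range of each of its arrows (being closed under
  inverses and products), but not necessarily all units of \<open>G\<close>.\<close>

definition subgroupoid :: "'g groupoid \<Rightarrow> 'g set \<Rightarrow> bool" where
  "subgroupoid G H \<longleftrightarrow>
     H \<subseteq> arrows G \<and>
     (\<forall>g\<in>H. ginv G g \<in> H) \<and>
     (\<forall>g\<in>H. \<forall>h\<in>H. src G g = rng G h \<longrightarrow> gcomp G g h \<in> H)"

definition principal :: "'g groupoid \<Rightarrow> 'g set \<Rightarrow> bool" where
  "principal G H \<longleftrightarrow> (\<forall>g\<in>H. src G g = rng G g \<longrightarrow> g \<in> units G)"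

definition AF_groupoid :: "'g groupoid \<Rightarrow> bool" where
  "AF_groupoid G \<longleftrightarrow>
     (\<exists>\<H>. \<H> \<noteq> {} \<and>
        (\<forall>H\<in>\<H>. subgroupoid G H \<and> principal G H \<and> compact_open (arr_top G) H) \<and>
        (\<forall>H\<in>\<H>. \<forall>K\<in>\<H>. \<exists>L\<in>\<H>. H \<subseteq> L \<and> K \<subseteq> L) \<and>
        \<Union>\<H> = arrows G)"


section \<open>The ring of an ample groupoid and its trivial module\<close>

text \<open>Functions on a space are total functions on the ambient type that vanish outside the
  space.\<close>

definition int_fun_group :: "('a \<Rightarrow> int) monoid" where
  "int_fun_group = \<lparr>carrier = UNIV, monoid.mult = (\<lambda>f g x. f x + g x), one = (\<lambda>_. 0)\<rparr>"

definition compact_open_functions :: "'a topology \<Rightarrow> ('a \<Rightarrow> int) set" where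
  "compact_open_functions X = generate int_fun_group {indicator U |U. compact_open X U}"

text \<open>For \<open>f\<close> in the groupoid ring the index sets of the two sums below are finite; the
  condition \<open>f a \<noteq> 0\<close> only removes vanishing terms.\<close>

definition convolution :: "'g groupoid \<Rightarrow> ('g \<Rightarrow> int) \<Rightarrow> ('g \<Rightarrow> int) \<Rightarrow> 'g \<Rightarrow> int" where
  "convolution G f h g =
     (if g \<in> arrows G
      then \<Sum>a | a \<in> arrows G \<and> rng G a = rng G g \<and> f a \<noteq> 0. f a * h (gcomp G (ginv G a) g)
      else 0)"

definition trivial_action :: "'g groupoid \<Rightarrow> ('g \<Rightarrow> int) \<Rightarrow> ('g \<Rightarrow> int) \<Rightarrow> 'g \<Rightarrow> int" where
  "trivial_action G f h x =
     (if x \<in> units G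
      then \<Sum>g | g \<in> arrows G \<and> src G g = x \<and> f g \<noteq> 0. h (rng G g) * f g
      else 0)"

text \<open>The ring need not be unital; the field \<open>one\<close> of the record is never used. Likewise
  a module uses only the additive part of its \<open>ring\<close> record and \<open>smult\<close>.\<close>

definition groupoid_ring :: "'g groupoid \<Rightarrow> ('g \<Rightarrow> int) ring" where
  "groupoid_ring G =
     \<lparr>carrier = compact_open_functions (arr_top G), monoid.mult = convolution G,
      one = undefined, zero = (\<lambda>_. 0), add = (\<lambda>f g x. f x + g x)\<rparr>"

text \<open>For a right module \<open>N\<close>, \<open>r \<odot>\<^bsub>N\<^esub> x\<close> stands for \<open>x\<close> acted on by \<open>r\<close> from the right.\<close>

definition trivial_right_module :: "'g groupoid \<Rightarrow> ('g \<Rightarrow> int, 'g \<Rightarrow> int) module" where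
  "trivial_right_module G =
     \<lparr>carrier = compact_open_functions (unit_space G), monoid.mult = undefined,
      one = undefined, zero = (\<lambda>_. 0), add = (\<lambda>f g x. f x + g x),
      smult = trivial_action G\<rparr>"


section \<open>Unitary modules over a ring without unit\<close>

locale unitary_left_module = abelian_group M
  for R :: "('r, 'a) ring_scheme" and M :: "('r, 'm) module" +
  assumes smult_closed:
      "\<lbrakk>r \<in> carrier R; x \<in> carrier M\<rbrakk> \<Longrightarrow> r \<odot>\<^bsub>M\<^esub> x \<in> carrier M"
    and smult_l_distr:
      "\<lbrakk>r \<in> carrier R; s \<in> carrier R; x \<in> carrier M\<rbrakk>
       \<Longrightarrow> (r \<oplus>\<^bsub>R\<^esub> s) \<odot>\<^bsub>M\<^esub> x = r \<odot>\<^bsub>M\<^esub> x \<oplus>\<^bsub>M\<^esub> s \<odot>\<^bsub>M\<^esub> x"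
    and smult_r_distr:
      "\<lbrakk>r \<in> carrier R; x \<in> carrier M; y \<in> carrier M\<rbrakk>
       \<Longrightarrow> r \<odot>\<^bsub>M\<^esub> (x \<oplus>\<^bsub>M\<^esub> y) = r \<odot>\<^bsub>M\<^esub> x \<oplus>\<^bsub>M\<^esub> r \<odot>\<^bsub>M\<^esub> y"
    and smult_assoc:
      "\<lbrakk>r \<in> carrier R; s \<in> carrier R; x \<in> carrier M\<rbrakk>
       \<Longrightarrow> (r \<otimes>\<^bsub>R\<^esub> s) \<odot>\<^bsub>M\<^esub> x = r \<odot>\<^bsub>M\<^esub> (s \<odot>\<^bsub>M\<^esub> x)"
    and unitary:
      "generate (add_monoid M) {r \<odot>\<^bsub>M\<^esub> x |r x. r \<in> carrier R \<and> x \<in> carrier M} = carrier M"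

definition module_hom ::
    "('r, 'a) ring_scheme \<Rightarrow> ('r, 'm) module \<Rightarrow> ('r, 'n) module \<Rightarrow> ('m \<Rightarrow> 'n) set" where
  "module_hom R M N =
     {f \<in> hom (add_monoid M) (add_monoid N).
        \<forall>r\<in>carrier R. \<forall>x\<in>carrier M. f (r \<odot>\<^bsub>M\<^esub> x) = r \<odot>\<^bsub>N\<^esub> f x}"

text \<open>All left modules under consideration have their elements in one type \<open>'m\<close>, which plays
  the role of a universe.\<close>

definition projective_module :: "('r, 'a) ring_scheme \<Rightarrow> ('r, 'm) module \<Rightarrow> bool" where
  "projective_module R P \<longleftrightarrow>
     unitary_left_module R P \<and>
     (\<forall>(A :: ('r, 'm) module) (B :: ('r, 'm) module) p f.
        unitary_left_module R A \<and> unitary_left_module R B \<and>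
        p \<in> module_hom R A B \<and> p ` carrier A = carrier B \<and> f \<in> module_hom R P B \<longrightarrow>
        (\<exists>h \<in> module_hom R P A. \<forall>x\<in>carrier P. p (h x) = f x))"

text \<open>An exact sequence \<open>\<dots> \<rightarrow> P 2 \<rightarrow> P 1 \<rightarrow> P 0 \<rightarrow> M \<rightarrow> 0\<close> with maps
  \<open>d n : P (n + 1) \<rightarrow> P n\<close> and \<open>e : P 0 \<rightarrow> M\<close>.\<close>

definition projective_resolution ::
    "('r, 'a) ring_scheme \<Rightarrow> ('r, 'm) module \<Rightarrow>
     (nat \<Rightarrow> ('r, 'm) module) \<Rightarrow> (nat \<Rightarrow> 'm \<Rightarrow> 'm) \<Rightarrow> ('m \<Rightarrow> 'm) \<Rightarrow> bool" where
  "projective_resolution R M P d e \<longleftrightarrow>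
     (\<forall>n. projective_module R (P n)) \<and>
     (\<forall>n. d n \<in> module_hom R (P (Suc n)) (P n)) \<and>
     e \<in> module_hom R (P 0) M \<and>
     e ` carrier (P 0) = carrier M \<and>
     d 0 ` carrier (P 1) = kernel (add_monoid (P 0)) (add_monoid M) e \<and>
     (\<forall>n. d (Suc n) ` carrier (P (Suc (Suc n))) =
            kernel (add_monoid (P (Suc n))) (add_monoid (P n)) (d n))"


section \<open>Tensor products, homology and Tor\<close>

definition tensor_relations ::
    "('r, 'a) ring_scheme \<Rightarrow> ('r, 'n) module \<Rightarrow> ('r, 'm) module \<Rightarrow> ('n \<times> 'm \<Rightarrow>\<^sub>0 int) set" where
  "tensor_relations R N M =
     generate (free_Abelian_group (carrier N \<times> carrier M))
       ({frag_of (x \<oplus>\<^bsub>N\<^esub> y, m) - frag_of (x, m) - frag_of (y, m) |x y m.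
           x \<in> carrier N \<and> y \<in> carrier N \<and> m \<in> carrier M} \<union>
        {frag_of (x, m \<oplus>\<^bsub>M\<^esub> k) - frag_of (x, m) - frag_of (x, k) |x m k.
           x \<in> carrier N \<and> m \<in> carrier M \<and> k \<in> carrier M} \<union>
        {frag_of (r \<odot>\<^bsub>N\<^esub> x, m) - frag_of (x, r \<odot>\<^bsub>M\<^esub> m) |r x m.
           r \<in> carrier R \<and> x \<in> carrier N \<and> m \<in> carrier M})"

definition tensor ::
    "('r, 'a) ring_scheme \<Rightarrow> ('r, 'n) module \<Rightarrow> ('r, 'm) module \<Rightarrow>
     ('n \<times> 'm \<Rightarrow>\<^sub>0 int) set monoid" where
  "tensor R N M =
     free_Abelian_group (carrier N \<times> carrier M) Mod tensor_relations R N M"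

text \<open>The map \<open>id \<otimes> f\<close> from \<open>tensor R N M\<close> to \<open>tensor R N M'\<close>: the image of a coset lies in
  a single coset, which is recovered by adding the relations.\<close>

definition tensor_map ::
    "('r, 'a) ring_scheme \<Rightarrow> ('r, 'n) module \<Rightarrow> ('r, 'm) module \<Rightarrow> ('m \<Rightarrow> 'm) \<Rightarrow>
     ('n \<times> 'm \<Rightarrow>\<^sub>0 int) set \<Rightarrow> ('n \<times> 'm \<Rightarrow>\<^sub>0 int) set" where
  "tensor_map R N M' f C =
     frag_extend (\<lambda>(x, m). frag_of (x, f m)) ` C
       <#>\<^bsub>free_Abelian_group (carrier N \<times> carrier M')\<^esub> tensor_relations R N M'"

text \<open>Here \<open>d n : C (n + 1) \<rightarrow> C n\<close>, and the complex is extended by zero in negative degrees.\<close>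

definition chain_cycles :: "(nat \<Rightarrow> 'c monoid) \<Rightarrow> (nat \<Rightarrow> 'c \<Rightarrow> 'c) \<Rightarrow> nat \<Rightarrow> 'c set" where
  "chain_cycles C d n =
     (case n of 0 \<Rightarrow> carrier (C 0) | Suc k \<Rightarrow> kernel (C (Suc k)) (C k) (d k))"

definition chain_homology ::
    "(nat \<Rightarrow> 'c monoid) \<Rightarrow> (nat \<Rightarrow> 'c \<Rightarrow> 'c) \<Rightarrow> nat \<Rightarrow> 'c set monoid" where
  "chain_homology C d n =
     (C n)\<lparr>carrier := chain_cycles C d n\<rparr> Mod (d n ` carrier (C (Suc n)))"

text \<open>\<open>Tor\<close> is the left derived functor of \<open>N \<otimes> _\<close> on unitary left modules. It is computed from
  a chosen projective resolution, and is independent of the choice up to isomorphism.\<close>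

definition Tor ::
    "('r, 'a) ring_scheme \<Rightarrow> nat \<Rightarrow> ('r, 'n) module \<Rightarrow> ('r, 'm) module \<Rightarrow>
     ('n \<times> 'm \<Rightarrow>\<^sub>0 int) set set monoid" where
  "Tor R n N M =
     (let (P, d, e) = (SOME (P, d, e). projective_resolution R M P d e)
      in chain_homology (\<lambda>i. tensor R N (P i)) (\<lambda>i. tensor_map R N (P i) (d i)) n)"


section \<open>Groupoid homology and homological dimension\<close>

definition groupoid_homology ::
    "'g groupoid \<Rightarrow> nat \<Rightarrow> ('g \<Rightarrow> int, 'm) module \<Rightarrow>
     (('g \<Rightarrow> int) \<times> 'm \<Rightarrow>\<^sub>0 int) set set monoid" where
  "groupoid_homology G n M = Tor (groupoid_ring G) n (trivial_right_module G) M"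

text \<open>The supremum ranges over the modules with elements in \<open>'m\<close>. As soon as \<open>'m\<close> is at least
  as large as the groupoid ring there are enough projectives among these modules, and the
  result does not depend on \<open>'m\<close>: every module is the directed union of its finitely generated
  unitary submodules, which are that small, and Tor commutes with directed colimits. In the
  complete lattice \<open>enat\<close> the supremum of the empty set is 0.\<close>

definition homological_dimension :: "'m itself \<Rightarrow> 'g groupoid \<Rightarrow> enat" where
  "homological_dimension _ G =
     Sup {enat n |n. \<exists>M :: ('g \<Rightarrow> int, 'm) module.
            unitary_left_module (groupoid_ring G) M \<and> \<not> trivial_group (groupoid_homology G n M)}"

end

theory Submission
  imports Defs
begin

text \<open>
  Let \<open>R\<close> be the ring of \<open>G\<close> and \<open>N\<close> the trivial right module. Homological dimension 0 means that
  the functor \<open>N \<otimes> _\<close> is exact, and both directions come down to one kind of function on \<open>G\<close>: an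
  \<open>F\<close> in \<open>R\<close> that is invariant under right translation by a subgroupoid \<open>H\<close> and whose values sum
  to 1 over each source fibre above the units of \<open>H\<close>.

  If \<open>G\<close> is AF and \<open>H\<close> is one of its compact open principal subgroupoids, then \<open>H\<close> has a compact
  open transversal \<open>T\<close>, a set of units that meets each orbit of \<open>H\<close> exactly once
  (\<open>exists_transversal\<close>), and the indicator \<open>F\<close> of the arrows of \<open>H\<close> with range in \<open>T\<close> is such a
  function. The map \<open>n \<mapsto> F n\<close> from \<open>N\<close> to \<open>R\<close> is a section of the action on \<open>1\<^sub>T\<close> and is linear over
  the functions that live on \<open>H\<close> (\<open>local_retract_if_AF\<close>). Only finitely many elements of \<open>R\<close> and
  \<open>N\<close> are involved when an element of a tensor product vanishes, and all of them live on one \<open>H\<close>.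
  Hence a cycle of \<open>N \<otimes> P\<close> can be moved into the exact complex \<open>P\<close>, lifted there to a boundary, and
  moved back (\<open>Tor_trivial_of_local_retract\<close>).

  Conversely, take finitely many compact open bisections \<open>C\<close>, closed under inversion, let \<open>U\<close> be the
  union of their sources and let \<open>L\<close> be the sum of the differences \<open>1\<^bsub>s(C)\<^esub> - 1\<^sub>C\<close>. This is a graph
  Laplacian: \<open>F L = 0\<close> says that \<open>F\<close> is harmonic on the graph whose edges are right multiplications
  by arrows of the bisections. In \<open>N\<close> one has \<open>1\<^sub>U L = 0\<close>. If \<open>Tor\<^sub>1\<close> vanishes on the module
  \<open>R e / R L\<close> with \<open>e = 1\<^sub>U\<close>, then this relation has a reason inside \<open>R\<close>: \<open>1\<^sub>U\<close> is a sum of elements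
  \<open>n k\<close> with \<open>k L = 0\<close> (\<open>annihilated_mem_span_if_Tor_trivial\<close>, the equational criterion for
  flatness). So there is a harmonic \<open>F\<close> whose values sum to 1 over each source fibre above \<open>U\<close>. Since
  \<open>F\<close> has finite support on each range fibre, the maximum principle makes it invariant under the
  subgroupoid \<open>H\<close> generated by the bisections. The isotropy group of \<open>H\<close> at a unit acts freely on the
  support of \<open>F\<close> above this unit, so its order divides 1, and \<open>H\<close> is principal. The range fibres
  of \<open>H\<close> embed into the support of \<open>F\<close>, so that they have bounded size, and \<open>H\<close> is a union of finitely
  many products of bisections. Therefore \<open>H\<close> is compact and open (\<open>generated_AF\<close>), and these
  subgroupoids exhaust \<open>G\<close>.

  Since \<open>Tor\<close> is computed from an arbitrarily chosen resolution, one needs that projective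
  resolutions exist among the modules with elements in the given type
  (\<open>exists_projective_resolution\<close>).
\<close>

section \<open>Rings with local units and unitary modules\<close>

lemma (in abelian_group) generate_add_induct [consumes 2, case_names zero incl minus plus]:
  assumes "x \<in> generate (add_monoid G) X" and X: "X \<subseteq> carrier G"
    and "P \<zero>" and "\<And>x. x \<in> X \<Longrightarrow> P x"
    and minus: "\<And>x. x \<in> X \<Longrightarrow> P x \<Longrightarrow> P (\<ominus> x)"
    and plus: "\<And>x y. \<lbrakk>x \<in> carrier G; y \<in> carrier G; P x; P y\<rbrakk> \<Longrightarrow> P (x \<oplus> y)"
  shows "P x"
proof -
  have "x \<in> carrier G \<and> P x"
    using assms(1)
  proof induction
    case (inv h)
    then show ?case
      using assms(4)[of h] minus[of h] X by (auto simp: a_inv_def)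
  qed (use assms in auto)
  then show ?thesis ..
qed

text \<open>The ring of a groupoid has no unit unless the unit space is compact, but any finite set of elements
  has a common idempotent left unit. This is all that replaces the unit below.\<close>

locale local_unit_ring = abelian_group R for R (structure) +
  assumes m_closed [simp]: "\<lbrakk>a \<in> carrier R; b \<in> carrier R\<rbrakk> \<Longrightarrow> a \<otimes> b \<in> carrier R"
    and m_assoc: "\<lbrakk>a \<in> carrier R; b \<in> carrier R; c \<in> carrier R\<rbrakk> \<Longrightarrow> (a \<otimes> b) \<otimes> c = a \<otimes> (b \<otimes> c)"
    and l_distr: "\<lbrakk>a \<in> carrier R; b \<in> carrier R; c \<in> carrier R\<rbrakk> \<Longrightarrow> (a \<oplus> b) \<otimes> c = a \<otimes> c \<oplus> b \<otimes> c"
    and r_distr: "\<lbrakk>a \<in> carrier R; b \<in> carrier R; c \<in> carrier R\<rbrakk> \<Longrightarrow> c \<otimes> (a \<oplus> b) = c \<otimes> a \<oplus> c \<otimes> b"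
    and local_units:
      "\<lbrakk>finite A; A \<subseteq> carrier R\<rbrakk> \<Longrightarrow> \<exists>e\<in>carrier R. e \<otimes> e = e \<and> (\<forall>a\<in>A. e \<otimes> a = a)"
begin

lemma r_null [simp]:
  assumes "a \<in> carrier R" shows "a \<otimes> \<zero> = \<zero>"
  using r_distr[of \<zero> \<zero> a] assms by (metis add.r_cancel_one l_zero m_closed zero_closed)

lemma l_null [simp]:
  assumes "a \<in> carrier R" shows "\<zero> \<otimes> a = \<zero>"
  using l_distr[of \<zero> \<zero> a] assms by (metis add.r_cancel_one l_zero m_closed zero_closed)

lemma l_minus:
  assumes "a \<in> carrier R" "b \<in> carrier R" shows "(\<ominus> a) \<otimes> b = \<ominus> (a \<otimes> b)"
  using l_distr[of "\<ominus> a" a b] assms by (simp add: minus_equality l_neg)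

lemma unitary_left_moduleI:
  assumes "abelian_group M"
    and "\<And>r x. \<lbrakk>r \<in> carrier R; x \<in> carrier M\<rbrakk> \<Longrightarrow> r \<odot>\<^bsub>M\<^esub> x \<in> carrier M"
    and "\<And>r s x. \<lbrakk>r \<in> carrier R; s \<in> carrier R; x \<in> carrier M\<rbrakk>
       \<Longrightarrow> (r \<oplus> s) \<odot>\<^bsub>M\<^esub> x = r \<odot>\<^bsub>M\<^esub> x \<oplus>\<^bsub>M\<^esub> s \<odot>\<^bsub>M\<^esub> x"
    and "\<And>r x y. \<lbrakk>r \<in> carrier R; x \<in> carrier M; y \<in> carrier M\<rbrakk>
       \<Longrightarrow> r \<odot>\<^bsub>M\<^esub> (x \<oplus>\<^bsub>M\<^esub> y) = r \<odot>\<^bsub>M\<^esub> x \<oplus>\<^bsub>M\<^esub> r \<odot>\<^bsub>M\<^esub> y"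
    and "\<And>r s x. \<lbrakk>r \<in> carrier R; s \<in> carrier R; x \<in> carrier M\<rbrakk>
       \<Longrightarrow> (r \<otimes> s) \<odot>\<^bsub>M\<^esub> x = r \<odot>\<^bsub>M\<^esub> (s \<odot>\<^bsub>M\<^esub> x)"
    and unit: "\<And>x. x \<in> carrier M \<Longrightarrow> \<exists>e\<in>carrier R. e \<odot>\<^bsub>M\<^esub> x = x"
  shows "unitary_left_module R M"
proof -
  interpret M: abelian_group M by fact
  let ?X = "{r \<odot>\<^bsub>M\<^esub> x |r x. r \<in> carrier R \<and> x \<in> carrier M}"
  have "generate (add_monoid M) ?X \<subseteq> carrier M"
    using M.add.generate_incl[of ?X] assms(2) by auto
  moreover have "x \<in> generate (add_monoid M) ?X" if "x \<in> carrier M" for x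
    by (rule generate.incl) (use unit[OF that] that in force)
  ultimately show ?thesis
    by (intro unitary_left_module.intro unitary_left_module_axioms.intro) (use assms in auto)
qed

end

text \<open>Over such a ring a module is unitary exactly if each of its elements is fixed by an idempotent of the
  ring. Submodules and homomorphic images of unitary modules are therefore unitary.\<close>

locale module_local_units = R: local_unit_ring R + unitary_left_module R M
  for R (structure) and M (structure)
begin

lemma smult_zero [simp]:
  assumes "r \<in> carrier R" shows "r \<odot>\<^bsub>M\<^esub> \<zero>\<^bsub>M\<^esub> = \<zero>\<^bsub>M\<^esub>"
  using smult_r_distr[of r "\<zero>\<^bsub>M\<^esub>" "\<zero>\<^bsub>M\<^esub>"] assms
  by (metis add.r_cancel_one l_zero smult_closed zero_closed)

lemma zero_smult [simp]:
  assumes "x \<in> carrier M" shows "\<zero>\<^bsub>R\<^esub> \<odot>\<^bsub>M\<^esub> x = \<zero>\<^bsub>M\<^esub>"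
  using smult_l_distr[of "\<zero>\<^bsub>R\<^esub>" "\<zero>\<^bsub>R\<^esub>" x] assms
  by (metis add.r_cancel_one R.l_zero smult_closed R.zero_closed)

lemma smult_minus:
  assumes "r \<in> carrier R" "x \<in> carrier M" shows "r \<odot>\<^bsub>M\<^esub> (\<ominus>\<^bsub>M\<^esub> x) = \<ominus>\<^bsub>M\<^esub> (r \<odot>\<^bsub>M\<^esub> x)"
  using smult_r_distr[of r "\<ominus>\<^bsub>M\<^esub> x" x] assms
  by (simp add: smult_closed minus_equality l_neg)

lemma exists_local_unit:
  assumes "x \<in> carrier M"
  shows "\<exists>e\<in>carrier R. e \<otimes>\<^bsub>R\<^esub> e = e \<and> e \<odot>\<^bsub>M\<^esub> x = x"
proof -
  let ?X = "{r \<odot>\<^bsub>M\<^esub> x |r x. r \<in> carrier R \<and> x \<in> carrier M}"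
  have X: "?X \<subseteq> carrier M"
    using smult_closed by auto
  have "x \<in> generate (add_monoid M) ?X"
    using assms unitary by simp
  then show ?thesis
    using X
  proof (induction rule: generate_add_induct)
    case zero
    then show ?case
      using R.local_units[of "{}"] by auto
  next
    case (incl x)
    then obtain r y where "r \<in> carrier R" "y \<in> carrier M" "x = r \<odot>\<^bsub>M\<^esub> y"
      by auto
    then show ?case
      using R.local_units[of "{r}"] smult_assoc by fastforce
  next
    case (minus x)
    then show ?case
      using X smult_minus by force
  next
    case (plus x y)
    then obtain e f where e: "e \<in> carrier R" "e \<odot>\<^bsub>M\<^esub> x = x" and f: "f \<in> carrier R" "f \<odot>\<^bsub>M\<^esub> y = y"
      by auto
    obtain u where u: "u \<in> carrier R" "u \<otimes>\<^bsub>R\<^esub> u = u" "u \<otimes>\<^bsub>R\<^esub> e = e" "u \<otimes>\<^bsub>R\<^esub> f = f"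
      using R.local_units[of "{e, f}"] e f by auto
    have "u \<odot>\<^bsub>M\<^esub> x = x" "u \<odot>\<^bsub>M\<^esub> y = y"
      using smult_assoc[of u e x] smult_assoc[of u f y] u e f plus by auto
    then show ?case
      using u plus smult_r_distr by auto
  qed
qed

lemma submodule:
  assumes "subgroup K (add_monoid M)"
    and "\<And>r x. r \<in> carrier R \<Longrightarrow> x \<in> K \<Longrightarrow> r \<odot>\<^bsub>M\<^esub> x \<in> K"
  shows "unitary_left_module R (M\<lparr>carrier := K\<rparr>)"
proof -
  interpret K: subgroup K "add_monoid M" by fact
  have K: "x \<in> carrier M" if "x \<in> K" for x
    using K.subset that by auto
  show ?thesis
  proof (rule R.unitary_left_moduleI)
    show "abelian_group (M\<lparr>carrier := K\<rparr>)"
    proof (rule abelian_groupI)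
      fix x assume "x \<in> carrier (M\<lparr>carrier := K\<rparr>)"
      then have "\<ominus>\<^bsub>M\<^esub> x \<in> K" "\<ominus>\<^bsub>M\<^esub> x \<oplus>\<^bsub>M\<^esub> x = \<zero>\<^bsub>M\<^esub>"
        using K.m_inv_closed[of x] K[of x] l_neg[of x] by (auto simp: a_inv_def)
      then show "\<exists>y\<in>carrier (M\<lparr>carrier := K\<rparr>). y \<oplus>\<^bsub>M\<lparr>carrier := K\<rparr>\<^esub> x = \<zero>\<^bsub>M\<lparr>carrier := K\<rparr>\<^esub>"
        by auto
    qed (use K K.m_closed K.one_closed in \<open>auto simp: a_ac\<close>)
    show "\<exists>e\<in>carrier R. e \<odot>\<^bsub>M\<lparr>carrier := K\<rparr>\<^esub> x = x" if "x \<in> carrier (M\<lparr>carrier := K\<rparr>)" for x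
      using exists_local_unit[OF K[of x]] that by auto
  qed (use K assms smult_l_distr smult_r_distr smult_assoc in auto)
qed

end

lemma module_homD:
  assumes "f \<in> module_hom R M N"
  shows "x \<in> carrier M \<Longrightarrow> f x \<in> carrier N"
    and "x \<in> carrier M \<Longrightarrow> y \<in> carrier M \<Longrightarrow> f (x \<oplus>\<^bsub>M\<^esub> y) = f x \<oplus>\<^bsub>N\<^esub> f y"
    and "r \<in> carrier R \<Longrightarrow> x \<in> carrier M \<Longrightarrow> f (r \<odot>\<^bsub>M\<^esub> x) = r \<odot>\<^bsub>N\<^esub> f x"
  using assms by (auto simp: module_hom_def hom_def)

lemma module_homI:
  assumes "\<And>x. x \<in> carrier M \<Longrightarrow> f x \<in> carrier N"
    and "\<And>x y. x \<in> carrier M \<Longrightarrow> y \<in> carrier M \<Longrightarrow> f (x \<oplus>\<^bsub>M\<^esub> y) = f x \<oplus>\<^bsub>N\<^esub> f y"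
    and "\<And>r x. r \<in> carrier R \<Longrightarrow> x \<in> carrier M \<Longrightarrow> f (r \<odot>\<^bsub>M\<^esub> x) = r \<odot>\<^bsub>N\<^esub> f x"
  shows "f \<in> module_hom R M N"
  using assms by (auto simp: module_hom_def hom_def)

lemma module_hom_comp:
  assumes "f \<in> module_hom R L M" "g \<in> module_hom R M N"
  shows "(\<lambda>x. g (f x)) \<in> module_hom R L N"
  using module_homD[OF assms(1)] module_homD[OF assms(2)] by (intro module_homI) auto

lemma module_hom_zero:
  assumes "f \<in> module_hom R M N" "unitary_left_module R M" "unitary_left_module R N"
  shows "f \<zero>\<^bsub>M\<^esub> = \<zero>\<^bsub>N\<^esub>"
proof -
  interpret M: abelian_group M using assms(2) unitary_left_module.axioms(1) by blast
  interpret N: abelian_group N using assms(3) unitary_left_module.axioms(1) by blast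
  show ?thesis
    using module_homD[OF assms(1)]
    by (metis M.l_zero M.zero_closed N.add.l_cancel_one)
qed

lemma module_hom_minus:
  assumes "f \<in> module_hom R M N" "unitary_left_module R M" "unitary_left_module R N" "x \<in> carrier M"
  shows "f (\<ominus>\<^bsub>M\<^esub> x) = \<ominus>\<^bsub>N\<^esub> f x"
proof -
  interpret M: abelian_group M using assms(2) unitary_left_module.axioms(1) by blast
  interpret N: abelian_group N using assms(3) unitary_left_module.axioms(1) by blast
  show ?thesis
    using module_homD[OF assms(1)] module_hom_zero[OF assms(1-3)] assms(4)
    by (metis M.a_inv_closed M.l_neg N.minus_equality)
qed

lemma (in local_unit_ring) kernel_submodule:
  assumes f: "f \<in> module_hom R M N" and M: "unitary_left_module R M" and N: "unitary_left_module R N"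
  shows "unitary_left_module R (M\<lparr>carrier := kernel (add_monoid M) (add_monoid N) f\<rparr>)"
proof -
  interpret M: module_local_units R M
    by (rule module_local_units.intro[OF local_unit_ring_axioms M])
  interpret N: module_local_units R N
    by (rule module_local_units.intro[OF local_unit_ring_axioms N])
  show ?thesis
  proof (rule M.submodule)
    have "group_hom (add_monoid M) (add_monoid N) f"
      using f by (auto simp: group_hom_def group_hom_axioms_def module_hom_def
          M.a_group N.a_group)
    then show "subgroup (kernel (add_monoid M) (add_monoid N) f) (add_monoid M)"
      by (rule group_hom.subgroup_kernel)
  qed (use module_homD[OF f] M.smult_closed in \<open>auto simp: kernel_def\<close>)
qed

section \<open>Quotients and transport of modules\<close>

text \<open>The set of values of \<open>\<pi>\<close> becomes a module whenever equality of values is a congruence of \<open>M\<close>. With an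
  injective \<open>\<pi>\<close> this transports \<open>M\<close> to another type; otherwise it is a quotient of \<open>M\<close> whose elements
  live in a prescribed type instead of being cosets.\<close>

definition image_module :: "('a \<Rightarrow> 'b) \<Rightarrow> ('r, 'a) module \<Rightarrow> ('r, 'b) module" where
  "image_module \<pi> M =
     \<lparr>carrier = \<pi> ` carrier M, monoid.mult = undefined, one = undefined, zero = \<pi> \<zero>\<^bsub>M\<^esub>,
      add = (\<lambda>u v. \<pi> (inv_into (carrier M) \<pi> u \<oplus>\<^bsub>M\<^esub> inv_into (carrier M) \<pi> v)),
      smult = (\<lambda>r u. \<pi> (r \<odot>\<^bsub>M\<^esub> inv_into (carrier M) \<pi> u))\<rparr>"

lemma (in local_unit_ring) image_module:
  assumes M: "unitary_left_module R M"
    and cadd: "\<And>x x' y y'. \<lbrakk>x \<in> carrier M; x' \<in> carrier M; y \<in> carrier M; y' \<in> carrier M; \<pi> x = \<pi> x'; \<pi> y = \<pi> y'\<rbrakk>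
      \<Longrightarrow> \<pi> (x \<oplus>\<^bsub>M\<^esub> y) = \<pi> (x' \<oplus>\<^bsub>M\<^esub> y')"
    and csmult: "\<And>r x x'. \<lbrakk>r \<in> carrier R; x \<in> carrier M; x' \<in> carrier M; \<pi> x = \<pi> x'\<rbrakk>
      \<Longrightarrow> \<pi> (r \<odot>\<^bsub>M\<^esub> x) = \<pi> (r \<odot>\<^bsub>M\<^esub> x')"
  shows "unitary_left_module R (image_module \<pi> M)" and "\<pi> \<in> module_hom R M (image_module \<pi> M)"
proof -
  interpret M: module_local_units R M
    by (rule module_local_units.intro[OF local_unit_ring_axioms M])
  let ?N = "image_module \<pi> M"
  have inv: "inv_into (carrier M) \<pi> (\<pi> x) \<in> carrier M" "\<pi> (inv_into (carrier M) \<pi> (\<pi> x)) = \<pi> x"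
    if "x \<in> carrier M" for x
    using that by (auto simp: inv_into_into f_inv_into_f)
  have add: "\<pi> x \<oplus>\<^bsub>?N\<^esub> \<pi> y = \<pi> (x \<oplus>\<^bsub>M\<^esub> y)" if "x \<in> carrier M" "y \<in> carrier M" for x y
    unfolding image_module_def using that inv by (auto intro!: cadd)
  have smult: "r \<odot>\<^bsub>?N\<^esub> \<pi> x = \<pi> (r \<odot>\<^bsub>M\<^esub> x)" if "r \<in> carrier R" "x \<in> carrier M" for r x
    unfolding image_module_def using that inv by (auto intro!: csmult)
  have car: "carrier ?N = \<pi> ` carrier M" and zero: "\<zero>\<^bsub>?N\<^esub> = \<pi> \<zero>\<^bsub>M\<^esub>"
    by (simp_all add: image_module_def)
  show "unitary_left_module R ?N"
  proof (rule unitary_left_moduleI)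
    show "abelian_group ?N"
    proof (rule abelian_groupI)
      fix x assume "x \<in> carrier ?N"
      then obtain a where a: "a \<in> carrier M" "x = \<pi> a" by (auto simp: car)
      then have "\<pi> (\<ominus>\<^bsub>M\<^esub> a) \<oplus>\<^bsub>?N\<^esub> x = \<zero>\<^bsub>?N\<^esub>" by (simp add: add zero M.l_neg)
      then show "\<exists>y\<in>carrier ?N. y \<oplus>\<^bsub>?N\<^esub> x = \<zero>\<^bsub>?N\<^esub>"
        using a by (auto simp: car)
    qed (auto simp: car add zero M.a_ac)
    show "\<exists>e\<in>carrier R. e \<odot>\<^bsub>?N\<^esub> x = x" if "x \<in> carrier ?N" for x
      proof -
      from that obtain a where a: "a \<in> carrier M" "x = \<pi> a" by (auto simp: car)
      then show ?thesis using M.exists_local_unit[OF a(1)] smult[OF _ a(1)] by metis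
    qed
  qed (auto simp: car add smult M.smult_closed M.smult_l_distr M.smult_r_distr M.smult_assoc)
  show "\<pi> \<in> module_hom R M ?N"
    by (rule module_homI) (auto simp: car add smult)
qed

lemma (in local_unit_ring) image_module_inj:
  assumes M: "unitary_left_module R M" and j: "inj_on j (carrier M)"
  shows "unitary_left_module R (image_module j M)" and "j \<in> module_hom R M (image_module j M)"
    and "inv_into (carrier M) j \<in> module_hom R (image_module j M) M"
proof -
  have eq: "j x = j x' \<longleftrightarrow> x = x'" if "x \<in> carrier M" "x' \<in> carrier M" for x x'
    using j that by (auto simp: inj_on_def)
  show 1: "unitary_left_module R (image_module j M)" and 2: "j \<in> module_hom R M (image_module j M)"
    by (rule image_module[OF M]; simp add: eq)+
  interpret M: unitary_left_module R M by fact
  show "inv_into (carrier M) j \<in> module_hom R (image_module j M) M"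
    by (rule module_homI) (auto simp: image_module_def j M.smult_closed)
qed

section \<open>Free modules\<close>

text \<open>The direct sum of the left ideals \<open>R u\<^sub>i\<close> for idempotents \<open>u\<^sub>i\<close>. A ring without unit need not be
  projective over itself, but these summands are.\<close>

definition free_module :: "('r, 'a) ring_scheme \<Rightarrow> 'i set \<Rightarrow> ('i \<Rightarrow> 'r) \<Rightarrow> ('r, 'i \<Rightarrow> 'r) module" where
  "free_module R I u =
     \<lparr>carrier = {\<phi>. (\<forall>i. i \<notin> I \<longrightarrow> \<phi> i = \<zero>\<^bsub>R\<^esub>) \<and> (\<forall>i\<in>I. \<phi> i \<in> carrier R \<and> \<phi> i \<otimes>\<^bsub>R\<^esub> u i = \<phi> i)
        \<and> finite {i. \<phi> i \<noteq> \<zero>\<^bsub>R\<^esub>}},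
      monoid.mult = undefined, one = undefined, zero = (\<lambda>_. \<zero>\<^bsub>R\<^esub>),
      add = (\<lambda>\<phi> \<psi> i. \<phi> i \<oplus>\<^bsub>R\<^esub> \<psi> i), smult = (\<lambda>r \<phi> i. r \<otimes>\<^bsub>R\<^esub> \<phi> i)\<rparr>"

locale free_module_basis = local_unit_ring R for R :: "('r, 'a) ring_scheme" (structure) +
  fixes I :: "'i set" and u :: "'i \<Rightarrow> 'r"
  assumes u_closed: "i \<in> I \<Longrightarrow> u i \<in> carrier R" and u_idem: "i \<in> I \<Longrightarrow> u i \<otimes> u i = u i"
begin

abbreviation "F \<equiv> free_module R I u"

definition basis :: "'i \<Rightarrow> 'i \<Rightarrow> 'r" where
  "basis i = (\<lambda>k. if k = i then u i else \<zero>)"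

lemma mem_carrier_iff:
  "\<phi> \<in> carrier F \<longleftrightarrow> (\<forall>i. i \<notin> I \<longrightarrow> \<phi> i = \<zero>) \<and> (\<forall>i\<in>I. \<phi> i \<in> carrier R \<and> \<phi> i \<otimes> u i = \<phi> i)
     \<and> finite {i. \<phi> i \<noteq> \<zero>}"
  by (simp add: free_module_def)

lemma carrierD:
  assumes "\<phi> \<in> carrier F"
  shows "\<phi> i \<in> carrier R" "finite {i. \<phi> i \<noteq> \<zero>}" "{i. \<phi> i \<noteq> \<zero>} \<subseteq> I"
    "i \<in> I \<Longrightarrow> \<phi> i \<otimes> u i = \<phi> i"
  using assms by (cases "i \<in> I"; auto simp: mem_carrier_iff)+

lemma ops: "(\<phi> \<oplus>\<^bsub>F\<^esub> \<psi>) = (\<lambda>i. \<phi> i \<oplus> \<psi> i)" "r \<odot>\<^bsub>F\<^esub> \<phi> = (\<lambda>i. r \<otimes> \<phi> i)" "\<zero>\<^bsub>F\<^esub> = (\<lambda>_. \<zero>)"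
  by (simp_all add: free_module_def)

lemma basis_closed: "i \<in> I \<Longrightarrow> basis i \<in> carrier F"
proof -
  assume "i \<in> I"
  moreover have "finite {k. basis i k \<noteq> \<zero>}"
    by (rule finite_subset[of _ "{i}"]) (auto simp: basis_def)
  ultimately show ?thesis
    by (auto simp: mem_carrier_iff basis_def u_closed u_idem)
qed

lemma unitary: "unitary_left_module R F"
proof (rule unitary_left_moduleI)
  have add: "\<phi> \<oplus>\<^bsub>F\<^esub> \<psi> \<in> carrier F" if "\<phi> \<in> carrier F" "\<psi> \<in> carrier F" for \<phi> \<psi>
  proof -
    have "finite {i. \<phi> i \<oplus> \<psi> i \<noteq> \<zero>}"
      by (rule finite_subset[of _ "{i. \<phi> i \<noteq> \<zero>} \<union> {i. \<psi> i \<noteq> \<zero>}"])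
        (use that carrierD(2) in auto)
    then show ?thesis
      using that by (auto simp: mem_carrier_iff ops l_distr u_closed)
  qed
  show "abelian_group F"
  proof (rule abelian_groupI)
    show "\<zero>\<^bsub>F\<^esub> \<in> carrier F" by (auto simp: mem_carrier_iff ops u_closed)
    fix \<phi> assume \<phi>: "\<phi> \<in> carrier F"
    note [simp] = carrierD(1)[OF \<phi>]
    show "\<zero>\<^bsub>F\<^esub> \<oplus>\<^bsub>F\<^esub> \<phi> = \<phi>" by (simp add: ops)
    have "finite {i. \<ominus> \<phi> i \<noteq> \<zero>}"
      by (rule finite_subset[OF _ carrierD(2)[OF \<phi>]]) auto
    then have "(\<lambda>i. \<ominus> \<phi> i) \<in> carrier F"
      using \<phi> by (auto simp: mem_carrier_iff u_closed l_minus)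
    then show "\<exists>\<psi>\<in>carrier F. \<psi> \<oplus>\<^bsub>F\<^esub> \<phi> = \<zero>\<^bsub>F\<^esub>"
      by (rule rev_bexI) (simp add: ops l_neg)
  qed (use add in \<open>auto simp: ops carrierD(1) a_ac\<close>)
  fix r \<phi> assume r: "r \<in> carrier R" and \<phi>: "\<phi> \<in> carrier F"
  have "finite {i. r \<otimes> \<phi> i \<noteq> \<zero>}"
    by (rule finite_subset[OF _ carrierD(2)[OF \<phi>]]) (use r in auto)
  then show "r \<odot>\<^bsub>F\<^esub> \<phi> \<in> carrier F"
    using r \<phi> by (auto simp: mem_carrier_iff ops m_assoc u_closed)
next
  fix \<phi> assume \<phi>: "\<phi> \<in> carrier F"
  obtain e where e: "e \<in> carrier R" "\<forall>a\<in>\<phi> ` {i. \<phi> i \<noteq> \<zero>}. e \<otimes> a = a"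
    using local_units[of "\<phi> ` {i. \<phi> i \<noteq> \<zero>}"] carrierD[OF \<phi>] by auto
  have "e \<otimes> \<phi> i = \<phi> i" for i
    using e by (cases "\<phi> i = \<zero>") auto
  then show "\<exists>e\<in>carrier R. e \<odot>\<^bsub>F\<^esub> \<phi> = \<phi>"
    using e(1) by (auto simp: ops)
qed (auto simp: ops carrierD(1) l_distr r_distr m_assoc)

text \<open>Together with the next lemma this is the universal property of the direct sum: a homomorphism is
  given by arbitrary images \<open>a\<^sub>i\<close> with \<open>u\<^sub>i a\<^sub>i = a\<^sub>i\<close>. Uniqueness is shown by splitting off one
  coordinate after the other, so that no sums over the support have to be formed in the target.\<close>

lemma hom_eqI:
  assumes f: "f \<in> module_hom R F B" and g: "g \<in> module_hom R F B" and B: "unitary_left_module R B"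
    and eq: "\<And>i. i \<in> I \<Longrightarrow> f (basis i) = g (basis i)" and "\<phi> \<in> carrier F"
  shows "f \<phi> = g \<phi>"
proof -
  have "f \<phi> = g \<phi>" if "finite S" "\<phi> \<in> carrier F" "{i. \<phi> i \<noteq> \<zero>} \<subseteq> S" for S \<phi>
    using that
  proof (induction S arbitrary: \<phi>)
    case empty
    then have "\<phi> = \<zero>\<^bsub>F\<^esub>" by (auto simp: ops)
    then show ?case
      using module_hom_zero[OF f unitary B] module_hom_zero[OF g unitary B] by simp
  next
    case (insert i S)
    show ?case
    proof (cases "i \<in> I")
      case False
      then have "\<phi> i = \<zero>" using insert.prems by (auto simp: mem_carrier_iff)
      then have "{i. \<phi> i \<noteq> \<zero>} \<subseteq> S" using insert.prems by auto
      then show ?thesis using insert by blast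
    next
      case True
      let ?\<psi> = "\<phi>(i := \<zero>)"
      have c: "\<phi> i \<in> carrier R" "\<phi> i \<otimes> u i = \<phi> i" using insert.prems carrierD True by auto
      have fin: "finite {k. ?\<psi> k \<noteq> \<zero>}"
        by (rule finite_subset[OF _ carrierD(2)[OF insert.prems(1)]]) auto
      have \<psi>: "?\<psi> \<in> carrier F"
        using insert.prems(1) fin by (auto simp: mem_carrier_iff u_closed)
      have s: "\<phi> i \<odot>\<^bsub>F\<^esub> basis i \<in> carrier F"
        by (rule unitary_left_module.smult_closed[OF unitary c(1) basis_closed[OF True]])
      have dec: "\<phi> = \<phi> i \<odot>\<^bsub>F\<^esub> basis i \<oplus>\<^bsub>F\<^esub> ?\<psi>"
        unfolding ops
      proof
        fix k show "\<phi> k = \<phi> i \<otimes> basis i k \<oplus> ?\<psi> k"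
          using c carrierD(1)[OF insert.prems(1), of k] by (cases "k = i") (simp_all add: basis_def)
      qed
      have "f ?\<psi> = g ?\<psi>"
        by (rule insert.IH[OF \<psi>]) (use insert.prems in auto)
      then have "f (\<phi> i \<odot>\<^bsub>F\<^esub> basis i \<oplus>\<^bsub>F\<^esub> ?\<psi>) = g (\<phi> i \<odot>\<^bsub>F\<^esub> basis i \<oplus>\<^bsub>F\<^esub> ?\<psi>)"
        using module_homD(2)[OF f s \<psi>] module_homD(2)[OF g s \<psi>] eq[OF True]
          module_homD(3)[OF f c(1) basis_closed[OF True]] module_homD(3)[OF g c(1) basis_closed[OF True]]
        by simp
      then show ?thesis
        unfolding dec[symmetric] .
    qed
  qed
  then show ?thesis
    using carrierD(2)[OF assms(5)] assms(5) by blast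
qed

lemma exists_hom:
  assumes A: "unitary_left_module R A" and a: "\<And>i. i \<in> I \<Longrightarrow> a i \<in> carrier A"
    and ua: "\<And>i. i \<in> I \<Longrightarrow> u i \<odot>\<^bsub>A\<^esub> a i = a i"
  shows "\<exists>h\<in>module_hom R F A. \<forall>i\<in>I. h (basis i) = a i"
proof -
  interpret A: module_local_units R A
    by (rule module_local_units.intro[OF local_unit_ring_axioms A])
  define h where "h \<phi> = finsum A (\<lambda>i. \<phi> i \<odot>\<^bsub>A\<^esub> a i) {i. \<phi> i \<noteq> \<zero>}" for \<phi>
  have h: "h \<phi> = finsum A (\<lambda>i. \<phi> i \<odot>\<^bsub>A\<^esub> a i) S"
    if "\<phi> \<in> carrier F" "finite S" "{i. \<phi> i \<noteq> \<zero>} \<subseteq> S" "S \<subseteq> I" for \<phi> S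
    unfolding h_def
    by (rule A.add.finprod_mono_neutral_cong_left)
      (use that carrierD a A.smult_closed in \<open>auto simp: subset_iff\<close>)
  have hom: "h \<in> module_hom R F A"
  proof (rule module_homI)
    fix \<phi> assume \<phi>: "\<phi> \<in> carrier F"
    let ?S = "{i. \<phi> i \<noteq> \<zero>}"
    have fin: "finite ?S" "?S \<subseteq> I" using carrierD[OF \<phi>] by auto
    show "h \<phi> \<in> carrier A"
      unfolding h_def using fin a carrierD(1)[OF \<phi>] A.smult_closed by (auto intro!: A.finsum_closed)
    show "h (r \<odot>\<^bsub>F\<^esub> \<phi>) = r \<odot>\<^bsub>A\<^esub> h \<phi>" if r: "r \<in> carrier R" for r
    proof -
      have "r \<odot>\<^bsub>A\<^esub> finsum A (\<lambda>i. \<phi> i \<odot>\<^bsub>A\<^esub> a i) S = finsum A (\<lambda>i. r \<odot>\<^bsub>A\<^esub> (\<phi> i \<odot>\<^bsub>A\<^esub> a i)) S"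
        if "finite S" "S \<subseteq> I" for S
        using that
      proof (induction S)
        case (insert i S)
        have "(\<lambda>i. \<phi> i \<odot>\<^bsub>A\<^esub> a i) \<in> S \<rightarrow> carrier A" "\<phi> i \<odot>\<^bsub>A\<^esub> a i \<in> carrier A"
          "(\<lambda>i. r \<odot>\<^bsub>A\<^esub> (\<phi> i \<odot>\<^bsub>A\<^esub> a i)) \<in> S \<rightarrow> carrier A"
          using insert.prems a carrierD(1)[OF \<phi>] A.smult_closed r by auto
        then show ?case
          using insert r A.smult_r_distr A.smult_closed by (simp add: A.finsum_closed)
      qed (use r in simp)
      note 1 = this[OF fin]
      have "h (r \<odot>\<^bsub>F\<^esub> \<phi>) = finsum A (\<lambda>i. (r \<odot>\<^bsub>F\<^esub> \<phi>) i \<odot>\<^bsub>A\<^esub> a i) ?S"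
        by (rule h) (use fin r \<phi> unitary unitary_left_module.smult_closed in \<open>auto simp: ops\<close>, fastforce simp: ops)
      also have "\<dots> = finsum A (\<lambda>i. r \<odot>\<^bsub>A\<^esub> (\<phi> i \<odot>\<^bsub>A\<^esub> a i)) ?S"
        by (rule A.finsum_cong')
          (use fin r a carrierD(1)[OF \<phi>] A.smult_closed A.smult_assoc in \<open>auto simp: ops\<close>)
      finally show ?thesis using 1 h_def by simp
    qed
    fix \<psi> assume \<psi>: "\<psi> \<in> carrier F"
    let ?T = "?S \<union> {i. \<psi> i \<noteq> \<zero>}"
    have T: "finite ?T" "?T \<subseteq> I" using carrierD[OF \<phi>] carrierD[OF \<psi>] by auto
    have "h (\<phi> \<oplus>\<^bsub>F\<^esub> \<psi>) = finsum A (\<lambda>i. (\<phi> \<oplus>\<^bsub>F\<^esub> \<psi>) i \<odot>\<^bsub>A\<^esub> a i) ?T"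
    proof (rule h)
      show "\<phi> \<oplus>\<^bsub>F\<^esub> \<psi> \<in> carrier F"
        using \<phi> \<psi> unitary[THEN unitary_left_module.axioms(1)]
        by (simp add: abelian_groupE)
    qed (use T in \<open>auto simp: ops\<close>)
    also have "\<dots> = finsum A (\<lambda>i. \<phi> i \<odot>\<^bsub>A\<^esub> a i \<oplus>\<^bsub>A\<^esub> \<psi> i \<odot>\<^bsub>A\<^esub> a i) ?T"
      by (rule A.finsum_cong')
        (use T a carrierD(1)[OF \<phi>] carrierD(1)[OF \<psi>] A.smult_closed A.smult_l_distr in \<open>auto simp: ops\<close>)
    also have "\<dots> = finsum A (\<lambda>i. \<phi> i \<odot>\<^bsub>A\<^esub> a i) ?T \<oplus>\<^bsub>A\<^esub> finsum A (\<lambda>i. \<psi> i \<odot>\<^bsub>A\<^esub> a i) ?T"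
      by (rule A.finsum_addf)
        (use T a carrierD(1)[OF \<phi>] carrierD(1)[OF \<psi>] A.smult_closed in auto)
    also have "\<dots> = h \<phi> \<oplus>\<^bsub>A\<^esub> h \<psi>"
      using h[of \<phi> ?T] h[of \<psi> ?T] T \<phi> \<psi> by auto
    finally show "h (\<phi> \<oplus>\<^bsub>F\<^esub> \<psi>) = h \<phi> \<oplus>\<^bsub>A\<^esub> h \<psi>" .
  qed
  moreover have "h (basis i) = a i" if "i \<in> I" for i
  proof -
    have "h (basis i) = finsum A (\<lambda>k. basis i k \<odot>\<^bsub>A\<^esub> a k) {i}"
      by (rule h) (use that basis_closed in \<open>auto simp: basis_def\<close>)
    then show ?thesis
      using that a ua by (simp add: basis_def)
  qed
  ultimately show ?thesis by blast
qed

text \<open>A preimage \<open>b\<close> of the image of a basis element is replaced by \<open>u\<^sub>i b\<close>, which is still a preimage and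
  satisfies the condition of the universal property.\<close>

lemma lifting:
  assumes A: "unitary_left_module R A" and B: "unitary_left_module R B"
    and p: "p \<in> module_hom R A B" and surj: "p ` carrier A = carrier B"
    and f: "f \<in> module_hom R F B"
  shows "\<exists>h\<in>module_hom R F A. \<forall>x\<in>carrier F. p (h x) = f x"
proof -
  have "\<exists>b\<in>carrier A. u i \<odot>\<^bsub>A\<^esub> b = b \<and> p b = f (basis i)" if i: "i \<in> I" for i
  proof -
    have "f (basis i) \<in> carrier B" using module_homD(1)[OF f] basis_closed i by blast
    then obtain b where b: "b \<in> carrier A" "p b = f (basis i)" using surj by (metis imageE)
    have "u i \<odot>\<^bsub>F\<^esub> basis i = basis i"
      using i u_idem u_closed by (auto simp: ops basis_def)
    then have "p (u i \<odot>\<^bsub>A\<^esub> b) = f (basis i)"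
      using module_homD(3)[OF p] module_homD(3)[OF f] b u_closed i basis_closed by metis
    then show ?thesis
      using b u_closed[OF i] u_idem[OF i] unitary_left_module.smult_assoc[OF A, of "u i" "u i" b]
        unitary_left_module.smult_closed[OF A] by metis
  qed
  then obtain b where b: "\<And>i. i \<in> I \<Longrightarrow> b i \<in> carrier A \<and> u i \<odot>\<^bsub>A\<^esub> b i = b i \<and> p (b i) = f (basis i)"
    by metis
  obtain h where h: "h \<in> module_hom R F A" "\<forall>i\<in>I. h (basis i) = b i"
    using exists_hom[OF A, of b] b by auto
  have "p (h x) = f x" if "x \<in> carrier F" for x
    by (rule hom_eqI[OF module_hom_comp[OF h(1) p] f B _ that]) (use h b in auto)
  then show ?thesis using h by auto
qed

text \<open>An element is determined by the finite graph of its restriction to its support, and an infinite set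
  has as many finite subsets as elements.\<close>

lemma carrier_lepoll:
  assumes I: "I \<lesssim> (UNIV :: 'm set)" and R: "carrier R \<lesssim> (UNIV :: 'm set)"
    and size: "infinite (UNIV :: 'm set) \<or> carrier R = {\<zero>}"
  shows "carrier F \<lesssim> (UNIV :: 'm set)"
  using size
proof
  assume inf: "infinite (UNIV :: 'm set)"
  have "carrier F \<lesssim> Fpow (I \<times> carrier R)"
    unfolding lepoll_def
  proof (intro exI conjI)
    show "inj_on (\<lambda>\<phi>. (\<lambda>i. (i, \<phi> i)) ` {i. \<phi> i \<noteq> \<zero>}) (carrier F)"
    proof (rule inj_onI, rule ext)
      fix \<phi> \<psi> i
      assume eq: "(\<lambda>i. (i, \<phi> i)) ` {i. \<phi> i \<noteq> \<zero>} = (\<lambda>i. (i, \<psi> i)) ` {i. \<psi> i \<noteq> \<zero>}"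
      have "(i, c) \<in> (\<lambda>i. (i, \<phi> i)) ` {i. \<phi> i \<noteq> \<zero>} \<longleftrightarrow> c = \<phi> i \<and> c \<noteq> \<zero>"
        "(i, c) \<in> (\<lambda>i. (i, \<psi> i)) ` {i. \<psi> i \<noteq> \<zero>} \<longleftrightarrow> c = \<psi> i \<and> c \<noteq> \<zero>" for c
        by auto
      then show "\<phi> i = \<psi> i" unfolding eq by metis
    qed
    show "(\<lambda>\<phi>. (\<lambda>i. (i, \<phi> i)) ` {i. \<phi> i \<noteq> \<zero>}) ` carrier F \<subseteq> Fpow (I \<times> carrier R)"
      using carrierD(1) by (auto simp: Fpow_def) (auto simp: mem_carrier_iff)
  qed
  also have "Fpow (I \<times> carrier R) \<lesssim> Fpow ((UNIV :: 'm set) \<times> (UNIV :: 'm set))"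
  proof -
    obtain f :: "'i \<Rightarrow> 'm" and g :: "'r \<Rightarrow> 'm" where "inj_on f I" "inj_on g (carrier R)"
      using I R by (auto simp: lepoll_def)
    then have "inj_on (map_prod f g) (I \<times> carrier R)"
      by (rule map_prod_inj_on)
    from inj_on_image_Fpow[OF this] show ?thesis
      unfolding lepoll_def by (intro exI[of _ "image (map_prod f g)"]) (auto simp: Fpow_def)
  qed
  also have "\<dots> \<approx> (UNIV :: 'm set) \<times> (UNIV :: 'm set)"
    using inf by (intro eqpoll_Fpow) (simp add: finite_prod)
  also have "\<dots> \<approx> (UNIV :: 'm set)"
    using card_of_Times_same_infinite[OF inf] by (simp add: eqpoll_iff_card_of_ordIso)
  finally show ?thesis .
next
  assume "carrier R = {\<zero>}"
  then have "\<phi> = (\<lambda>_. \<zero>)" if "\<phi> \<in> carrier F" for \<phi>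
    using carrierD(1)[OF that] by auto
  then have "inj_on (\<lambda>_. undefined :: 'm) (carrier F)"
    by (intro inj_onI) blast
  then show ?thesis unfolding lepoll_def by blast
qed

end

section \<open>Projective resolutions\<close>

text \<open>For each element \<open>x\<close> of \<open>M\<close> one summand \<open>R u\<close> is taken, where \<open>u\<close> is an idempotent that fixes
  \<open>x\<close>.\<close>

lemma (in local_unit_ring) exists_projective_cover:
  fixes M :: "('a, 'm) module"
  assumes M: "unitary_left_module R M" and R: "carrier R \<lesssim> (UNIV :: 'm set)"
    and size: "infinite (UNIV :: 'm set) \<or> carrier R = {\<zero>}"
  shows "\<exists>(P :: ('a, 'm) module) p. projective_module R P \<and> p \<in> module_hom R P M \<and> p ` carrier P = carrier M"
proof -
  interpret M: module_local_units R M
    by (rule module_local_units.intro[OF local_unit_ring_axioms M])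
  obtain u where u: "\<And>x. x \<in> carrier M \<Longrightarrow> u x \<in> carrier R \<and> u x \<otimes> u x = u x \<and> u x \<odot>\<^bsub>M\<^esub> x = x"
    using M.exists_local_unit by metis
  interpret F: free_module_basis R "carrier M" u
    by unfold_locales (use u in auto)
  let ?F = "free_module R (carrier M) u"
  obtain j :: "('m \<Rightarrow> 'a) \<Rightarrow> 'm" where j: "inj_on j (carrier ?F)"
    using F.carrier_lepoll[OF _ R size] unfolding lepoll_def by (metis inj_on_id subset_UNIV)
  let ?P = "image_module j ?F" and ?i = "inv_into (carrier ?F) j"
  note P = image_module_inj[OF F.unitary j]
  have "projective_module R ?P"
    unfolding projective_module_def
  proof (intro conjI P(1) allI impI, elim conjE)
    fix A B :: "('a, 'm) module" and p f
    assume *: "unitary_left_module R A" "unitary_left_module R B" "p \<in> module_hom R A B"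
      "p ` carrier A = carrier B" "f \<in> module_hom R ?P B"
    obtain h where h: "h \<in> module_hom R ?F A" "\<forall>x\<in>carrier ?F. p (h x) = f (j x)"
      using F.lifting[OF *(1-4) module_hom_comp[OF P(2) *(5)]] by auto
    have "(\<lambda>x. h (?i x)) \<in> module_hom R ?P A"
      by (rule module_hom_comp[OF P(3) h(1)])
    moreover have "p (h (?i x)) = f x" if "x \<in> carrier ?P" for x
      using that h by (auto simp: image_module_def j)
    ultimately show "\<exists>h\<in>module_hom R ?P A. \<forall>x\<in>carrier ?P. p (h x) = f x"
      by (intro bexI[of _ "\<lambda>x. h (?i x)"]) auto
  qed
  moreover obtain q where q: "q \<in> module_hom R ?F M" "\<forall>x\<in>carrier M. q (F.basis x) = x"
    using F.exists_hom[OF M, of "\<lambda>x. x"] u by auto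
  have "(\<lambda>x. q (?i x)) \<in> module_hom R ?P M"
    by (rule module_hom_comp[OF P(3) q(1)])
  moreover have "(\<lambda>x. q (?i x)) ` carrier ?P = carrier M"
  proof -
    have "(\<lambda>x. q (?i x)) ` carrier ?P = q ` carrier ?F"
      unfolding image_module_def by (force simp: j image_image)
    also have "\<dots> = carrier M"
      using module_homD(1)[OF q(1)] q(2) F.basis_closed by (force intro!: image_eqI[where x = "F.basis _"])
    finally show ?thesis .
  qed
  ultimately show ?thesis by (intro exI[of _ ?P] exI[of _ "\<lambda>x. q (?i x)"]) auto
qed

text \<open>The kernel of each cover is again unitary, so it can be covered in turn.\<close>

lemma (in local_unit_ring) exists_projective_resolution:
  fixes M :: "('a, 'm) module"
  assumes M: "unitary_left_module R M" and R: "carrier R \<lesssim> (UNIV :: 'm set)"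
    and size: "infinite (UNIV :: 'm set) \<or> carrier R = {\<zero>}"
  shows "\<exists>P d e. projective_resolution R M P d e"
proof -
  obtain C :: "('a, 'm) module \<Rightarrow> ('a, 'm) module" and c where
    C: "\<And>M. unitary_left_module R M \<Longrightarrow>
      projective_module R (C M) \<and> c M \<in> module_hom R (C M) M \<and> c M ` carrier (C M) = carrier M"
    using exists_projective_cover[OF _ R size] by metis
  define K where "K = rec_nat M
    (\<lambda>_ L. (C L)\<lparr>carrier := kernel (add_monoid (C L)) (add_monoid L) (c L)\<rparr>)"
  have K0: "K 0 = M" and
    K_Suc: "K (Suc n) = (C (K n))\<lparr>carrier := kernel (add_monoid (C (K n))) (add_monoid (K n)) (c (K n))\<rparr>" for n
    by (simp_all add: K_def)
  have K: "unitary_left_module R (K n)" for n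
  proof (induction n)
    case (Suc n)
    show ?case
      unfolding K_Suc using C[OF Suc] Suc
      by (intro kernel_submodule) (auto simp: projective_module_def)
  qed (simp add: K0 M)
  have c: "c (K n) \<in> module_hom R (C (K n)) (K n)" "c (K n) ` carrier (C (K n)) = carrier (K n)"
    "projective_module R (C (K n))" for n
    using C[OF K] by auto
  have car: "carrier (K (Suc n)) = kernel (add_monoid (C (K n))) (add_monoid (K n)) (c (K n))" for n
    by (simp add: K_Suc)
  have incl: "c (K (Suc n)) \<in> module_hom R (C (K (Suc n))) (C (K n))" for n
    using module_homD[OF c(1)[of "Suc n"]]
    by (intro module_homI) (auto simp: K_Suc kernel_def)
  have ker: "kernel (add_monoid (C (K (Suc n)))) (add_monoid (C (K n))) (c (K (Suc n)))
    = kernel (add_monoid (C (K (Suc n)))) (add_monoid (K (Suc n))) (c (K (Suc n)))" for n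
    by (auto simp: kernel_def K_Suc)
  have "projective_resolution R (K 0) (\<lambda>n. C (K n)) (\<lambda>n. c (K (Suc n))) (c (K 0))"
    unfolding projective_resolution_def ker
    by (intro conjI allI) (simp_all only: c incl car One_nat_def)
  then have "projective_resolution R M (\<lambda>n. C (K n)) (\<lambda>n. c (K (Suc n))) (c (K 0))"
    by (simp only: K0)
  then show ?thesis by blast
qed

section \<open>Tensor products\<close>

lemma hom_free_Abelian_group_diff:
  assumes h: "h \<in> hom (free_Abelian_group S) A" and A: "group A"
    and "Poly_Mapping.keys a \<subseteq> S" "Poly_Mapping.keys b \<subseteq> S"
  shows "h (a - b) = h a \<otimes>\<^bsub>A\<^esub> inv\<^bsub>A\<^esub> h b"
proof -
  interpret h: group_hom "free_Abelian_group S" A h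
    using h A by (simp add: group_hom_def group_hom_axioms_def)
  have "h (a \<otimes>\<^bsub>free_Abelian_group S\<^esub> inv\<^bsub>free_Abelian_group S\<^esub> b) = h a \<otimes>\<^bsub>A\<^esub> inv\<^bsub>A\<^esub> h b"
    using assms(3,4) h.hom_mult[of a "inv\<^bsub>free_Abelian_group S\<^esub> b"] h.hom_inv[of b] by simp
  then show ?thesis
    using assms(3,4) by simp
qed

text \<open>The right action of \<open>r\<close> on \<open>x\<close> is written \<open>r \<odot> x\<close>, hence the reversed order in the last law.\<close>

locale right_module = R: local_unit_ring R + abelian_group N
  for R :: "('a, 'b) ring_scheme" (structure) and N :: "('a, 'n) module" (structure) +
  assumes act_closed:
      "\<lbrakk>r \<in> carrier R; x \<in> carrier N\<rbrakk> \<Longrightarrow> r \<odot>\<^bsub>N\<^esub> x \<in> carrier N"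
    and act_l_distr:
      "\<lbrakk>r \<in> carrier R; s \<in> carrier R; x \<in> carrier N\<rbrakk>
       \<Longrightarrow> (r \<oplus>\<^bsub>R\<^esub> s) \<odot>\<^bsub>N\<^esub> x = r \<odot>\<^bsub>N\<^esub> x \<oplus>\<^bsub>N\<^esub> s \<odot>\<^bsub>N\<^esub> x"
    and act_r_distr:
      "\<lbrakk>r \<in> carrier R; x \<in> carrier N; y \<in> carrier N\<rbrakk>
       \<Longrightarrow> r \<odot>\<^bsub>N\<^esub> (x \<oplus>\<^bsub>N\<^esub> y) = r \<odot>\<^bsub>N\<^esub> x \<oplus>\<^bsub>N\<^esub> r \<odot>\<^bsub>N\<^esub> y"
    and act_assoc:
      "\<lbrakk>r \<in> carrier R; s \<in> carrier R; x \<in> carrier N\<rbrakk>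
       \<Longrightarrow> (r \<otimes>\<^bsub>R\<^esub> s) \<odot>\<^bsub>N\<^esub> x = s \<odot>\<^bsub>N\<^esub> (r \<odot>\<^bsub>N\<^esub> x)"

definition rel_generators ::
    "('r, 'a) ring_scheme \<Rightarrow> ('r, 'n) module \<Rightarrow> ('r, 'm) module \<Rightarrow> ('n \<times> 'm \<Rightarrow>\<^sub>0 int) set" where
  "rel_generators R N M =
        {frag_of (x \<oplus>\<^bsub>N\<^esub> y, m) - frag_of (x, m) - frag_of (y, m) |x y m.
           x \<in> carrier N \<and> y \<in> carrier N \<and> m \<in> carrier M} \<union>
        {frag_of (x, m \<oplus>\<^bsub>M\<^esub> k) - frag_of (x, m) - frag_of (x, k) |x m k.
           x \<in> carrier N \<and> m \<in> carrier M \<and> k \<in> carrier M} \<union>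
        {frag_of (r \<odot>\<^bsub>N\<^esub> x, m) - frag_of (x, r \<odot>\<^bsub>M\<^esub> m) |r x m.
           r \<in> carrier R \<and> x \<in> carrier N \<and> m \<in> carrier M}"

lemma tensor_relations_eq:
  "tensor_relations R N M = generate (free_Abelian_group (carrier N \<times> carrier M)) (rel_generators R N M)"
  by (simp add: tensor_relations_def rel_generators_def)

abbreviation pair_map :: "('m \<Rightarrow> 'k) \<Rightarrow> ('n \<times> 'm \<Rightarrow>\<^sub>0 int) \<Rightarrow> 'n \<times> 'k \<Rightarrow>\<^sub>0 int" where
  "pair_map f \<equiv> frag_extend (\<lambda>(x, m). frag_of (x, f m))"

lemma keys_pair_map:
  assumes "Poly_Mapping.keys c \<subseteq> X \<times> Y" "f ` Y \<subseteq> Z"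
  shows "Poly_Mapping.keys (pair_map f c) \<subseteq> X \<times> Z"
  by (intro order_trans[OF keys_frag_extend]) (auto dest!: subsetD[OF assms(1)] intro: subsetD[OF assms(2)])

locale tensor_pair = right_module R N + M: module_local_units R M
  for R :: "('a, 'b) ring_scheme" (structure) and N :: "('a, 'n) module" (structure)
    and M :: "('a, 'm) module" (structure)
begin

abbreviation "Rel \<equiv> tensor_relations R N M"
abbreviation "FG \<equiv> free_Abelian_group (carrier N \<times> carrier M)"

lemma keys_frag_of_diff_diff:
  "\<lbrakk>a \<in> S; b \<in> S; c \<in> S\<rbrakk> \<Longrightarrow> Poly_Mapping.keys (frag_of a - frag_of b - frag_of c) \<subseteq> S"
  "\<lbrakk>a \<in> S; b \<in> S\<rbrakk> \<Longrightarrow> Poly_Mapping.keys (frag_of a - frag_of b) \<subseteq> S"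
  by (auto dest!: subsetD[OF keys_diff])

lemma rel_generators_subset: "rel_generators R N M \<subseteq> carrier FG"
  unfolding rel_generators_def
  by (intro Un_least subsetI; elim CollectE exE conjE)
    (simp_all add: keys_frag_of_diff_diff act_closed M.smult_closed)

lemma rel_subgroup: "subgroup Rel FG"
  unfolding tensor_relations_eq
  by (intro group.generate_is_subgroup rel_generators_subset group_free_Abelian_group)

lemma rel_keys: "c \<in> Rel \<Longrightarrow> Poly_Mapping.keys c \<subseteq> carrier N \<times> carrier M"
  using subgroup.mem_carrier[OF rel_subgroup] by simp

lemma rel_zero: "0 \<in> Rel"
  using subgroup.one_closed[OF rel_subgroup] by simp

lemma rel_add: "a \<in> Rel \<Longrightarrow> b \<in> Rel \<Longrightarrow> a + b \<in> Rel"
  using subgroup.m_closed[OF rel_subgroup] by simp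

lemma rel_minus: "a \<in> Rel \<Longrightarrow> - a \<in> Rel"
  using subgroup.m_inv_closed[OF rel_subgroup, of a] rel_keys[of a] by simp

lemma rel_diff: "a \<in> Rel \<Longrightarrow> b \<in> Rel \<Longrightarrow> a - b \<in> Rel"
  using rel_add[of a "- b"] rel_minus by simp

lemma rel_add_left:
  "\<lbrakk>x \<in> carrier N; y \<in> carrier N; m \<in> carrier M\<rbrakk>
    \<Longrightarrow> frag_of (x \<oplus>\<^bsub>N\<^esub> y, m) - frag_of (x, m) - frag_of (y, m) \<in> Rel"
  unfolding tensor_relations_eq by (rule generate.incl) (auto simp: rel_generators_def)

lemma rel_add_right:
  "\<lbrakk>x \<in> carrier N; m \<in> carrier M; k \<in> carrier M\<rbrakk>
    \<Longrightarrow> frag_of (x, m \<oplus>\<^bsub>M\<^esub> k) - frag_of (x, m) - frag_of (x, k) \<in> Rel"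
  unfolding tensor_relations_eq by (rule generate.incl) (auto simp: rel_generators_def)

lemma rel_balanced:
  "\<lbrakk>r \<in> carrier R; x \<in> carrier N; m \<in> carrier M\<rbrakk>
    \<Longrightarrow> frag_of (r \<odot>\<^bsub>N\<^esub> x, m) - frag_of (x, r \<odot>\<^bsub>M\<^esub> m) \<in> Rel"
  unfolding tensor_relations_eq by (rule generate.incl) (auto simp: rel_generators_def)

lemma rel_zero_left: "m \<in> carrier M \<Longrightarrow> frag_of (\<zero>\<^bsub>N\<^esub>, m) \<in> Rel"
  using rel_minus[OF rel_add_left[of "\<zero>\<^bsub>N\<^esub>" "\<zero>\<^bsub>N\<^esub>" m]] by simp

lemma rel_zero_right: "x \<in> carrier N \<Longrightarrow> frag_of (x, \<zero>\<^bsub>M\<^esub>) \<in> Rel"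
  using rel_minus[OF rel_add_right[of x "\<zero>\<^bsub>M\<^esub>" "\<zero>\<^bsub>M\<^esub>"]] by simp

lemma rel_coset: "Rel #>\<^bsub>FG\<^esub> c = {a. a - c \<in> Rel}"
proof -
  have "a \<in> (\<Union>h\<in>Rel. {h + c}) \<longleftrightarrow> a - c \<in> Rel" for a
    by (metis (no_types, lifting) UN_iff add_diff_cancel diff_add_cancel singletonD singletonI)
  then show ?thesis by (auto simp: r_coset_def)
qed

lemma rel_coset_eq_iff: "Rel #>\<^bsub>FG\<^esub> a = Rel #>\<^bsub>FG\<^esub> b \<longleftrightarrow> a - b \<in> Rel"
proof
  assume "Rel #>\<^bsub>FG\<^esub> a = Rel #>\<^bsub>FG\<^esub> b"
  moreover have "a \<in> Rel #>\<^bsub>FG\<^esub> a" by (simp add: rel_coset rel_zero)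
  ultimately show "a - b \<in> Rel" by (simp add: rel_coset)
next
  assume *: "a - b \<in> Rel"
  have "c - a \<in> Rel \<longleftrightarrow> c - b \<in> Rel" for c
    using rel_add[of "c - a" "a - b"] rel_diff[of "c - b" "a - b"] * by auto
  then show "Rel #>\<^bsub>FG\<^esub> a = Rel #>\<^bsub>FG\<^esub> b" by (simp add: rel_coset)
qed

lemma carrier_tensor:
  "carrier (tensor R N M) = (\<lambda>c. Rel #>\<^bsub>FG\<^esub> c) ` {c. Poly_Mapping.keys c \<subseteq> carrier N \<times> carrier M}"
  by (auto simp: tensor_def carrier_FactGroup)

lemma one_tensor: "\<one>\<^bsub>tensor R N M\<^esub> = Rel"
  by (simp add: tensor_def)

lemma rel_coset_eq_one_iff: "Rel #>\<^bsub>FG\<^esub> a = \<one>\<^bsub>tensor R N M\<^esub> \<longleftrightarrow> a \<in> Rel"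
  using rel_coset_eq_iff[of a 0] rel_coset[of 0] by (simp add: one_tensor)

lemma rel_normal: "Rel \<lhd> FG"
  by (simp add: comm_group.normal_iff_subgroup[OF abelian_free_Abelian_group] rel_subgroup)

lemma tensor_group: "group (tensor R N M)"
  unfolding tensor_def using normal.factorgroup_is_group[OF rel_normal] .

lemma mult_tensor:
  assumes "Poly_Mapping.keys a \<subseteq> carrier N \<times> carrier M" "Poly_Mapping.keys b \<subseteq> carrier N \<times> carrier M"
  shows "(Rel #>\<^bsub>FG\<^esub> a) \<otimes>\<^bsub>tensor R N M\<^esub> (Rel #>\<^bsub>FG\<^esub> b) = Rel #>\<^bsub>FG\<^esub> (a + b)"
  using normal.rcos_sum[OF rel_normal, of a b] assms by (simp add: tensor_def)

text \<open>The subgroup \<open>S\<close> takes the place of a quotient of the target: maps that are biadditive and balanced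
  only modulo \<open>S\<close> are treated without passing to \<open>A / S\<close>.\<close>

lemma hom_rel_subset:
  assumes A: "group A" and S: "subgroup S A" and h: "h \<in> hom FG A"
    and add_left: "\<And>x y m. \<lbrakk>x \<in> carrier N; y \<in> carrier N; m \<in> carrier M\<rbrakk>
      \<Longrightarrow> h (frag_of (x \<oplus>\<^bsub>N\<^esub> y, m) - frag_of (x, m) - frag_of (y, m)) \<in> S"
    and add_right: "\<And>x m k. \<lbrakk>x \<in> carrier N; m \<in> carrier M; k \<in> carrier M\<rbrakk>
      \<Longrightarrow> h (frag_of (x, m \<oplus>\<^bsub>M\<^esub> k) - frag_of (x, m) - frag_of (x, k)) \<in> S"
    and balanced: "\<And>r x m. \<lbrakk>r \<in> carrier R; x \<in> carrier N; m \<in> carrier M\<rbrakk>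
      \<Longrightarrow> h (frag_of (r \<odot>\<^bsub>N\<^esub> x, m) - frag_of (x, r \<odot>\<^bsub>M\<^esub> m)) \<in> S"
    and c: "c \<in> Rel"
  shows "h c \<in> S"
proof -
  interpret h: group_hom FG A h
    using h A by (simp add: group_hom_def group_hom_axioms_def)
  interpret S: subgroup S A by fact
  have gen: "h c \<in> S" if "c \<in> rel_generators R N M" for c
    using that unfolding rel_generators_def
    by (elim UnE CollectE exE conjE) (simp_all only: add_left add_right balanced)
  show ?thesis
    using c unfolding tensor_relations_eq
  proof induction
    case one
    then show ?case using h.hom_one S.one_closed by simp
  next
    case (inv c)
    then show ?case
      using S.m_inv_closed[OF gen[OF inv]] h.hom_inv[OF subsetD[OF rel_generators_subset inv]] by simp
  next
    case (eng a b)
    have "a \<in> carrier FG" "b \<in> carrier FG"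
      using eng.hyps by (auto intro!: subgroup.mem_carrier[OF rel_subgroup] simp only: tensor_relations_eq)
    then show ?case
      using S.m_closed[OF eng.IH] h.hom_mult[of a b] by simp
  qed (use gen in auto)
qed

end

lemma (in right_module) tensor_pairI: "unitary_left_module R M \<Longrightarrow> tensor_pair R N M"
  by (intro tensor_pair.intro right_module_axioms module_local_units.intro R.local_unit_ring_axioms)

lemma (in right_module) pair_map_rel:
  assumes M: "unitary_left_module R M" and K: "unitary_left_module R K" and f: "f \<in> module_hom R M K"
    and c: "c \<in> tensor_relations R N M"
  shows "pair_map f c \<in> tensor_relations R N K"
proof -
  interpret M: tensor_pair R N M by (rule tensor_pairI[OF M])
  interpret K: tensor_pair R N K by (rule tensor_pairI[OF K])
  note f = module_homD[OF f]
  show ?thesis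
  proof (rule M.hom_rel_subset[OF group_free_Abelian_group K.rel_subgroup _ _ _ _ c])
    show "pair_map f \<in> hom M.FG K.FG"
      using keys_pair_map[of _ "carrier N" "carrier M" f "carrier K"] f(1)
      by (intro homI) (auto simp: frag_extend_add)
  qed (use f K.rel_add_left K.rel_add_right K.rel_balanced in \<open>auto simp: frag_extend_diff\<close>)
qed

lemma (in right_module) tensor_map_coset:
  assumes M: "unitary_left_module R M" and K: "unitary_left_module R K" and f: "f \<in> module_hom R M K"
  shows "tensor_map R N K f (tensor_relations R N M #>\<^bsub>free_Abelian_group (carrier N \<times> carrier M)\<^esub> c)
    = tensor_relations R N K #>\<^bsub>free_Abelian_group (carrier N \<times> carrier K)\<^esub> pair_map f c"
proof -
  interpret M: tensor_pair R N M by (rule tensor_pairI[OF M])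
  interpret K: tensor_pair R N K by (rule tensor_pairI[OF K])
  have "(\<exists>a b. a - c \<in> M.Rel \<and> b \<in> K.Rel \<and> t = pair_map f a + b) \<longleftrightarrow> t - pair_map f c \<in> K.Rel" for t
  proof
    assume "\<exists>a b. a - c \<in> M.Rel \<and> b \<in> K.Rel \<and> t = pair_map f a + b"
    then obtain a b where "a - c \<in> M.Rel" "b \<in> K.Rel" and t: "t = pair_map f a + b" by blast
    then have "pair_map f (a - c) + b \<in> K.Rel"
      using pair_map_rel[OF M K f] K.rel_add by blast
    then show "t - pair_map f c \<in> K.Rel"
      by (simp add: t frag_extend_diff algebra_simps)
  next
    assume "t - pair_map f c \<in> K.Rel"
    then show "\<exists>a b. a - c \<in> M.Rel \<and> b \<in> K.Rel \<and> t = pair_map f a + b"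
      by (intro exI[of _ c] exI[of _ "t - pair_map f c"]) (simp add: M.rel_zero)
  qed
  moreover have "pair_map f ` {a. a - c \<in> M.Rel} <#>\<^bsub>K.FG\<^esub> K.Rel =
      {t. \<exists>a b. a - c \<in> M.Rel \<and> b \<in> K.Rel \<and> t = pair_map f a + b}"
    unfolding set_mult_def by (simp, blast)
  ultimately show ?thesis
    unfolding tensor_map_def M.rel_coset K.rel_coset by simp
qed

lemma (in right_module) tensor_map_hom:
  assumes M: "unitary_left_module R M" and K: "unitary_left_module R K" and f: "f \<in> module_hom R M K"
  shows "tensor_map R N K f \<in> hom (tensor R N M) (tensor R N K)"
proof -
  interpret M: tensor_pair R N M by (rule tensor_pairI[OF M])
  interpret K: tensor_pair R N K by (rule tensor_pairI[OF K])
  have keys: "Poly_Mapping.keys (pair_map f c) \<subseteq> carrier N \<times> carrier K"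
    if "Poly_Mapping.keys c \<subseteq> carrier N \<times> carrier M" for c
    by (rule keys_pair_map[OF that]) (use module_homD(1)[OF f] in auto)
  show ?thesis
  proof (rule homI)
    fix s t assume "s \<in> carrier (tensor R N M)" "t \<in> carrier (tensor R N M)"
    then obtain a b where ab: "Poly_Mapping.keys a \<subseteq> carrier N \<times> carrier M"
      "Poly_Mapping.keys b \<subseteq> carrier N \<times> carrier M" "s = M.Rel #>\<^bsub>M.FG\<^esub> a" "t = M.Rel #>\<^bsub>M.FG\<^esub> b"
      by (auto simp: M.carrier_tensor)
    then show "tensor_map R N K f (s \<otimes>\<^bsub>tensor R N M\<^esub> t) =
        tensor_map R N K f s \<otimes>\<^bsub>tensor R N K\<^esub> tensor_map R N K f t"
      by (simp add: M.mult_tensor K.mult_tensor keys tensor_map_coset[OF M K f] frag_extend_add)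
  qed (auto simp: M.carrier_tensor K.carrier_tensor tensor_map_coset[OF M K f] keys)
qed

section \<open>Vanishing of Tor\<close>

lemma chain_homology_trivial_iff:
  assumes C: "\<And>n. group (C n)" and d: "\<And>n. d n \<in> hom (C (Suc n)) (C n)"
    and dd: "\<And>n x. x \<in> carrier (C (Suc (Suc n))) \<Longrightarrow> d n (d (Suc n) x) = \<one>\<^bsub>C n\<^esub>"
  shows "trivial_group (chain_homology C d (Suc n)) \<longleftrightarrow>
    kernel (C (Suc n)) (C n) (d n) \<subseteq> d (Suc n) ` carrier (C (Suc (Suc n)))"
proof -
  let ?Z = "kernel (C (Suc n)) (C n) (d n)" and ?B = "d (Suc n) ` carrier (C (Suc (Suc n)))"
  interpret d: group_hom "C (Suc n)" "C n" "d n"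
    using C d by (simp add: group_hom_def group_hom_axioms_def)
  interpret d': group_hom "C (Suc (Suc n))" "C (Suc n)" "d (Suc n)"
    using C d by (simp add: group_hom_def group_hom_axioms_def)
  have Z: "subgroup ?Z (C (Suc n))" by (rule d.subgroup_kernel)
  then interpret Z: group "(C (Suc n))\<lparr>carrier := ?Z\<rparr>"
    by (rule subgroup.subgroup_is_group[OF _ C])
  have BZ: "?B \<subseteq> ?Z" using d'.hom_closed dd by (auto simp: kernel_def)
  have car: "carrier (chain_homology C d (Suc n)) = (\<lambda>z. ?B #>\<^bsub>C (Suc n)\<^esub> z) ` ?Z"
    by (auto simp: chain_homology_def chain_cycles_def carrier_FactGroup r_coset_def)
  have one: "\<one>\<^bsub>chain_homology C d (Suc n)\<^esub> = ?B"
    by (simp add: chain_homology_def)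
  have B: "subgroup ?B (C (Suc n))" by (rule d'.img_is_subgroup)
  show ?thesis
  proof
    assume triv: "trivial_group (chain_homology C d (Suc n))"
    show "?Z \<subseteq> ?B"
    proof
      fix z assume z: "z \<in> ?Z"
      then have "?B #>\<^bsub>C (Suc n)\<^esub> z \<in> carrier (chain_homology C d (Suc n))"
        unfolding car by blast
      then have "?B #>\<^bsub>C (Suc n)\<^esub> z = ?B"
        using triv one by (simp add: trivial_group_def)
      then show "z \<in> ?B"
        using group.coset_join1[OF C _ _ B] z by (auto simp: kernel_def)
    qed
  next
    assume "?Z \<subseteq> ?B"
    then have eq: "?B = ?Z" using BZ by blast
    have "?Z \<lhd> (C (Suc n))\<lparr>carrier := ?Z\<rparr>"
      using Z.inv_closed by (intro Z.normal_invI Z.subgroup_self[simplified]) (auto intro!: Z.m_closed[simplified])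
    from normal.factorgroup_is_group[OF this]
    have "group (chain_homology C d (Suc n))"
      by (simp add: chain_homology_def chain_cycles_def eq)
    moreover have "carrier (chain_homology C d (Suc n)) = {?B}"
    proof -
      have "?B #>\<^bsub>C (Suc n)\<^esub> z = ?B" if "z \<in> ?Z" for z
        using group.coset_join2[OF C _ B] that eq by (auto simp: kernel_def)
      moreover have "?Z \<noteq> {}" using subgroup.one_closed[OF Z] by blast
      ultimately show ?thesis by (auto simp: car)
    qed
    ultimately show "trivial_group (chain_homology C d (Suc n))"
      by (simp add: trivial_group_def one)
  qed
qed

text \<open>Exactness of \<open>N \<otimes> P\<close> in positive degrees, stated for representatives in the free abelian groups.
  The resolution is the one that was chosen in the definition of \<open>Tor\<close>; nothing is known about it
  beyond being a projective resolution.\<close>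

lemma (in right_module) Tor_trivial_iff:
  fixes M :: "('a, 'm) module"
  assumes M: "unitary_left_module R M" and R: "carrier R \<lesssim> (UNIV :: 'm set)"
    and size: "infinite (UNIV :: 'm set) \<or> carrier R = {\<zero>\<^bsub>R\<^esub>}"
  shows "\<exists>P d e. projective_resolution R M P d e \<and>
    (\<forall>n. trivial_group (Tor R (Suc n) N M) \<longleftrightarrow>
      (\<forall>c. Poly_Mapping.keys c \<subseteq> carrier N \<times> carrier (P (Suc n))
            \<and> pair_map (d n) c \<in> tensor_relations R N (P n) \<longrightarrow>
         (\<exists>b. Poly_Mapping.keys b \<subseteq> carrier N \<times> carrier (P (Suc (Suc n)))
            \<and> c - pair_map (d (Suc n)) b \<in> tensor_relations R N (P (Suc n)))))"
proof -
  let ?Q = "\<lambda>(P, d, e). projective_resolution R M P d e"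
  have "\<exists>x. ?Q x"
    using R.exists_projective_resolution[OF M R size] by auto
  then have "?Q (SOME x. ?Q x)" by (rule someI_ex)
  then obtain P d e where eq: "(SOME x. ?Q x) = (P, d, e)" and res: "projective_resolution R M P d e"
    by (cases "SOME x. ?Q x") auto
  have P: "unitary_left_module R (P n)" for n
    using res by (auto simp: projective_resolution_def projective_module_def)
  have d: "d n \<in> module_hom R (P (Suc n)) (P n)" for n
    using res by (auto simp: projective_resolution_def)
  have tp: "tensor_pair R N (P n)" for n by (rule tensor_pairI[OF P])
  let ?C = "\<lambda>i. tensor R N (P i)" and ?D = "\<lambda>i. tensor_map R N (P i) (d i)"
  let ?cl = "\<lambda>i c. tensor_relations R N (P i) #>\<^bsub>free_Abelian_group (carrier N \<times> carrier (P i))\<^esub> c"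
  have Tor: "Tor R n N M = chain_homology ?C ?D n" for n
    unfolding Tor_def eq by simp
  have dd: "d n (d (Suc n) x) = \<zero>\<^bsub>P n\<^esub>" if "x \<in> carrier (P (Suc (Suc n)))" for n x
  proof -
    have "d (Suc n) ` carrier (P (Suc (Suc n))) = kernel (add_monoid (P (Suc n))) (add_monoid (P n)) (d n)"
      using res by (auto simp: projective_resolution_def)
    then show ?thesis using that by (auto simp: kernel_def)
  qed
  have DD: "?D n (?D (Suc n) x) = \<one>\<^bsub>?C n\<^esub>" if x: "x \<in> carrier (?C (Suc (Suc n)))" for n x
  proof -
    obtain c where c: "Poly_Mapping.keys c \<subseteq> carrier N \<times> carrier (P (Suc (Suc n)))" "x = ?cl (Suc (Suc n)) c"
      using x by (auto simp: tensor_pair.carrier_tensor[OF tp])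
    have "pair_map (d n) (pair_map (d (Suc n)) c) \<in> tensor_relations R N (P n)"
      using c(1)
    proof (induction rule: frag_induction)
      case (one x)
      then show ?case
        using tensor_pair.rel_zero_right[OF tp] by (auto simp: dd)
    qed (auto simp: frag_extend_diff tensor_pair.rel_zero[OF tp] intro: tensor_pair.rel_diff[OF tp])
    then show ?thesis
      by (simp add: c(2) tensor_map_coset[OF P P d] tensor_pair.rel_coset_eq_one_iff[OF tp])
  qed
  have "trivial_group (Tor R (Suc n) N M) \<longleftrightarrow> (\<forall>c. Poly_Mapping.keys c \<subseteq> carrier N \<times> carrier (P (Suc n))
            \<and> pair_map (d n) c \<in> tensor_relations R N (P n) \<longrightarrow>
         (\<exists>b. Poly_Mapping.keys b \<subseteq> carrier N \<times> carrier (P (Suc (Suc n)))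
            \<and> c - pair_map (d (Suc n)) b \<in> tensor_relations R N (P (Suc n))))" (is "_ \<longleftrightarrow> ?rhs") for n
  proof -
    have D_one_iff: "?D n (?cl (Suc n) c) = \<one>\<^bsub>?C n\<^esub> \<longleftrightarrow> pair_map (d n) c \<in> tensor_relations R N (P n)" for c
      by (simp add: tensor_map_coset[OF P P d] tensor_pair.rel_coset_eq_one_iff[OF tp])
    have "trivial_group (Tor R (Suc n) N M) \<longleftrightarrow>
        kernel (?C (Suc n)) (?C n) (?D n) \<subseteq> ?D (Suc n) ` carrier (?C (Suc (Suc n)))"
      unfolding Tor by (rule chain_homology_trivial_iff[of ?C ?D, OF tensor_pair.tensor_group[OF tp] tensor_map_hom[OF P P d] DD])
    also have "kernel (?C (Suc n)) (?C n) (?D n) = ?cl (Suc n) `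
        {c. Poly_Mapping.keys c \<subseteq> carrier N \<times> carrier (P (Suc n)) \<and> pair_map (d n) c \<in> tensor_relations R N (P n)}"
      unfolding kernel_def tensor_pair.carrier_tensor[OF tp] using D_one_iff by blast
    also have "?D (Suc n) ` carrier (?C (Suc (Suc n))) = (\<lambda>b. ?cl (Suc n) (pair_map (d (Suc n)) b)) `
        {b. Poly_Mapping.keys b \<subseteq> carrier N \<times> carrier (P (Suc (Suc n)))}"
      by (simp add: tensor_pair.carrier_tensor[OF tp] tensor_map_coset[OF P P d] image_image)
    also have "(?cl (Suc n) ` {c. Poly_Mapping.keys c \<subseteq> carrier N \<times> carrier (P (Suc n)) \<and> pair_map (d n) c \<in> tensor_relations R N (P n)}
        \<subseteq> (\<lambda>b. ?cl (Suc n) (pair_map (d (Suc n)) b)) ` {b. Poly_Mapping.keys b \<subseteq> carrier N \<times> carrier (P (Suc (Suc n)))}) \<longleftrightarrow> ?rhs"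
      unfolding image_subset_iff image_iff Ball_def Bex_def mem_Collect_eq tensor_pair.rel_coset_eq_iff[OF tp] ..
    finally show ?thesis .
  qed
  with res show ?thesis by blast
qed

lemma (in abelian_group) add_minus_minus:
  assumes "a \<in> carrier G" "b \<in> carrier G" shows "(a \<oplus> b) \<ominus> a \<ominus> b = \<zero>"
  using assms by (simp add: minus_eq a_comm[of "a \<oplus> b" "\<ominus> a"] r_neg1 r_neg)

text \<open>An element of the free abelian group that vanishes in the tensor product does so because of finitely
  many relations. A map \<open>\<Lambda>\<close> that is only linear with respect to the elements occurring in them
  still sends it to zero. The hypotheses on \<open>\<Lambda>\<close> depend on finitely many elements, which is what allows
  \<open>\<Lambda>\<close> to be chosen afterwards.\<close>

lemma (in right_module) relation_finite_witness:
  assumes M: "unitary_left_module R M" and c: "c \<in> tensor_relations R N M"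
  shows "\<exists>A B. finite A \<and> A \<subseteq> carrier R \<and> finite B \<and> B \<subseteq> carrier N \<and>
    (\<forall>\<Lambda> h. (\<forall>x\<in>carrier N. \<Lambda> x \<in> carrier R) \<longrightarrow>
       (\<forall>x\<in>carrier N. \<forall>y\<in>carrier N. \<Lambda> (x \<oplus>\<^bsub>N\<^esub> y) = \<Lambda> x \<oplus>\<^bsub>R\<^esub> \<Lambda> y) \<longrightarrow>
       (\<forall>x\<in>B. \<forall>r\<in>A. \<Lambda> (r \<odot>\<^bsub>N\<^esub> x) = \<Lambda> x \<otimes>\<^bsub>R\<^esub> r) \<longrightarrow>
       h \<in> hom (free_Abelian_group (carrier N \<times> carrier M)) (add_monoid M) \<longrightarrow>
       (\<forall>x\<in>carrier N. \<forall>m\<in>carrier M. h (frag_of (x, m)) = \<Lambda> x \<odot>\<^bsub>M\<^esub> m) \<longrightarrow>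
       h c = \<zero>\<^bsub>M\<^esub>)" (is "?P c")
proof -
  interpret M: tensor_pair R N M by (rule tensor_pairI[OF M])
  define good where "good A B \<Lambda> h \<longleftrightarrow> (\<forall>x\<in>carrier N. \<Lambda> x \<in> carrier R) \<and>
       (\<forall>x\<in>carrier N. \<forall>y\<in>carrier N. \<Lambda> (x \<oplus>\<^bsub>N\<^esub> y) = \<Lambda> x \<oplus>\<^bsub>R\<^esub> \<Lambda> y) \<and>
       (\<forall>x\<in>B. \<forall>r\<in>A. \<Lambda> (r \<odot>\<^bsub>N\<^esub> x) = \<Lambda> x \<otimes>\<^bsub>R\<^esub> r) \<and>
       h \<in> hom M.FG (add_monoid M) \<and>
       (\<forall>x\<in>carrier N. \<forall>m\<in>carrier M. h (frag_of (x, m)) = \<Lambda> x \<odot>\<^bsub>M\<^esub> m)" for A B \<Lambda> h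
  define Q where "Q c \<longleftrightarrow> (\<exists>A B. finite A \<and> A \<subseteq> carrier R \<and> finite B \<and> B \<subseteq> carrier N \<and>
    (\<forall>\<Lambda> h. good A B \<Lambda> h \<longrightarrow> h c = \<zero>\<^bsub>M\<^esub>))" for c
  have diff: "h (a - b) = h a \<ominus>\<^bsub>M\<^esub> h b"
    if "h \<in> hom M.FG (add_monoid M)" "a \<in> carrier M.FG" "b \<in> carrier M.FG" for h a b
    using hom_free_Abelian_group_diff[OF that(1) M.M.a_group] that(2,3)
    by (simp add: a_minus_def a_inv_def)
  have mono: "good A B \<Lambda> h" if "good A' B' \<Lambda> h" "A \<subseteq> A'" "B \<subseteq> B'" for A B A' B' \<Lambda> h
    using that unfolding good_def by blast
  have gen: "Q c" if "c \<in> rel_generators R N M" for c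
  proof -
    from that consider
        x y m where "x \<in> carrier N" "y \<in> carrier N" "m \<in> carrier M"
          "c = frag_of (x \<oplus>\<^bsub>N\<^esub> y, m) - frag_of (x, m) - frag_of (y, m)"
      | x m k where "x \<in> carrier N" "m \<in> carrier M" "k \<in> carrier M"
          "c = frag_of (x, m \<oplus>\<^bsub>M\<^esub> k) - frag_of (x, m) - frag_of (x, k)"
      | r x m where "r \<in> carrier R" "x \<in> carrier N" "m \<in> carrier M"
          "c = frag_of (r \<odot>\<^bsub>N\<^esub> x, m) - frag_of (x, r \<odot>\<^bsub>M\<^esub> m)"
      unfolding rel_generators_def by (elim UnE CollectE exE conjE) metis+
    then show "Q c"
    proof cases
      case (1 x y m)
      have "h c = \<zero>\<^bsub>M\<^esub>" if "good {} {} \<Lambda> h" for \<Lambda> h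
      proof -
        have hom: "h \<in> hom M.FG (add_monoid M)" and \<Lambda>: "\<Lambda> x \<in> carrier R" "\<Lambda> y \<in> carrier R"
          and h: "h (frag_of (x \<oplus>\<^bsub>N\<^esub> y, m)) = (\<Lambda> x \<oplus>\<^bsub>R\<^esub> \<Lambda> y) \<odot>\<^bsub>M\<^esub> m"
            "h (frag_of (x, m)) = \<Lambda> x \<odot>\<^bsub>M\<^esub> m" "h (frag_of (y, m)) = \<Lambda> y \<odot>\<^bsub>M\<^esub> m"
          using that 1 by (auto simp: good_def)
        then show ?thesis
          using 1 by (simp add: diff M.keys_frag_of_diff_diff M.M.smult_l_distr M.M.smult_closed
              M.M.add_minus_minus)
      qed
      then show ?thesis unfolding Q_def by (intro exI[of _ "{}"]) auto
    next
      case (2 x m k)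
      have "h c = \<zero>\<^bsub>M\<^esub>" if "good {} {} \<Lambda> h" for \<Lambda> h
      proof -
        have hom: "h \<in> hom M.FG (add_monoid M)" and \<Lambda>: "\<Lambda> x \<in> carrier R"
          and h: "h (frag_of (x, m \<oplus>\<^bsub>M\<^esub> k)) = \<Lambda> x \<odot>\<^bsub>M\<^esub> (m \<oplus>\<^bsub>M\<^esub> k)"
            "h (frag_of (x, m)) = \<Lambda> x \<odot>\<^bsub>M\<^esub> m" "h (frag_of (x, k)) = \<Lambda> x \<odot>\<^bsub>M\<^esub> k"
          using that 2 by (auto simp: good_def)
        then show ?thesis
          using 2 by (simp add: diff M.keys_frag_of_diff_diff M.M.smult_r_distr M.M.smult_closed
              M.M.add_minus_minus)
      qed
      then show ?thesis unfolding Q_def by (intro exI[of _ "{}"]) auto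
    next
      case (3 r x m)
      have "h c = \<zero>\<^bsub>M\<^esub>" if "good {r} {x} \<Lambda> h" for \<Lambda> h
      proof -
        have hom: "h \<in> hom M.FG (add_monoid M)" and \<Lambda>: "\<Lambda> x \<in> carrier R"
          and h: "h (frag_of (r \<odot>\<^bsub>N\<^esub> x, m)) = (\<Lambda> x \<otimes>\<^bsub>R\<^esub> r) \<odot>\<^bsub>M\<^esub> m"
            "h (frag_of (x, r \<odot>\<^bsub>M\<^esub> m)) = \<Lambda> x \<odot>\<^bsub>M\<^esub> (r \<odot>\<^bsub>M\<^esub> m)"
          using that 3 by (auto simp: good_def act_closed M.M.smult_closed)
        then show ?thesis
          using 3 by (simp add: diff act_closed M.M.smult_assoc M.M.smult_closed M.M.minus_eq M.M.r_neg)
      qed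
      then show ?thesis
        unfolding Q_def using 3 by (intro exI[of _ "{r}"] exI[of _ "{x}"]) auto
    qed
  qed
  have "Q c"
    using c unfolding tensor_relations_eq
  proof induction
    case one
    have "h \<one>\<^bsub>M.FG\<^esub> = \<zero>\<^bsub>M\<^esub>" if "good {} {} \<Lambda> h" for \<Lambda> h
    proof -
      have "h \<in> hom M.FG (add_monoid M)" using that by (simp add: good_def)
      from hom_one[OF this group_free_Abelian_group M.M.a_group] show ?thesis by simp
    qed
    then show ?case unfolding Q_def by (intro exI[of _ "{}"]) auto
  next
    case (incl c)
    then show ?case by (rule gen)
  next
    case (inv c)
    have "h (- c) = \<zero>\<^bsub>M\<^esub>" if "h \<in> hom M.FG (add_monoid M)" "h c = \<zero>\<^bsub>M\<^esub>" for h
      using diff[OF that(1), of 0 c] that subsetD[OF M.rel_generators_subset inv]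
        hom_one[OF that(1) group_free_Abelian_group M.M.a_group] by (simp add: M.M.minus_eq)
    moreover have "inv\<^bsub>M.FG\<^esub> c = - c"
      using subsetD[OF M.rel_generators_subset inv] by simp
    ultimately show ?case
      using gen[OF inv] unfolding Q_def good_def by metis
  next
    case (eng a b)
    have car: "a \<in> carrier M.FG" "b \<in> carrier M.FG"
      using eng.hyps by (auto intro!: subgroup.mem_carrier[OF M.rel_subgroup] simp only: tensor_relations_eq)
    from eng.IH(1) obtain A B where AB: "finite A" "A \<subseteq> carrier R" "finite B" "B \<subseteq> carrier N"
      "\<And>\<Lambda> h. good A B \<Lambda> h \<Longrightarrow> h a = \<zero>\<^bsub>M\<^esub>" unfolding Q_def by blast
    from eng.IH(2) obtain A' B' where AB': "finite A'" "A' \<subseteq> carrier R" "finite B'" "B' \<subseteq> carrier N"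
      "\<And>\<Lambda> h. good A' B' \<Lambda> h \<Longrightarrow> h b = \<zero>\<^bsub>M\<^esub>" unfolding Q_def by blast
    have "h (a \<otimes>\<^bsub>M.FG\<^esub> b) = \<zero>\<^bsub>M\<^esub>" if "good (A \<union> A') (B \<union> B') \<Lambda> h" for \<Lambda> h
    proof -
      have "h \<in> hom M.FG (add_monoid M)" using that by (simp add: good_def)
      from hom_mult[OF this car] show ?thesis
        using AB(5)[OF mono[OF that]] AB'(5)[OF mono[OF that]] by simp
    qed
    then show ?case
      unfolding Q_def using AB AB' by (intro exI[of _ "A \<union> A'"] exI[of _ "B \<union> B'"]) auto
  qed
  then obtain A B where "finite A" "A \<subseteq> carrier R" "finite B" "B \<subseteq> carrier N"
      "\<And>\<Lambda> h. good A B \<Lambda> h \<Longrightarrow> h c = \<zero>\<^bsub>M\<^esub>" unfolding Q_def by blast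
  then show ?thesis
    by (intro exI[of _ A] exI[of _ B] conjI allI impI) (unfold good_def, blast+)
qed

text \<open>If \<open>N\<close> is locally a retract of \<open>R\<close>, with section \<open>\<Lambda>\<close> and retraction \<open>r \<mapsto> \<tau> r\<close>, then it is flat. A
  cycle \<open>c = \<Sum> x \<otimes> m\<close> is sent to \<open>\<Sum> \<Lambda> x m\<close>, which is a cycle of the exact complex \<open>P\<close> and so equals
  \<open>d z\<close> for some \<open>z\<close>. Because of \<open>x = \<tau> \<Lambda> x\<close>, the cycle \<open>c\<close> equals \<open>\<tau> \<otimes> d z\<close> in the tensor
  product.\<close>

theorem (in right_module) Tor_trivial_of_local_retract:
  fixes M :: "('a, 'm) module"
  assumes retract: "\<And>A B. \<lbrakk>finite A; A \<subseteq> carrier R; finite B; B \<subseteq> carrier N\<rbrakk> \<Longrightarrow>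
      \<exists>\<tau>\<in>carrier N. \<exists>\<Lambda>. (\<forall>x\<in>carrier N. \<Lambda> x \<in> carrier R) \<and>
        (\<forall>x\<in>carrier N. \<forall>y\<in>carrier N. \<Lambda> (x \<oplus>\<^bsub>N\<^esub> y) = \<Lambda> x \<oplus>\<^bsub>R\<^esub> \<Lambda> y) \<and>
        (\<forall>x\<in>B. \<Lambda> x \<odot>\<^bsub>N\<^esub> \<tau> = x) \<and>
        (\<forall>x\<in>B. \<forall>r\<in>A. \<Lambda> (r \<odot>\<^bsub>N\<^esub> x) = \<Lambda> x \<otimes>\<^bsub>R\<^esub> r)"
    and M: "unitary_left_module R M" and R: "carrier R \<lesssim> (UNIV :: 'm set)"
    and size: "infinite (UNIV :: 'm set) \<or> carrier R = {\<zero>\<^bsub>R\<^esub>}"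
  shows "trivial_group (Tor R (Suc n) N M)"
proof -
  obtain P d e where res: "projective_resolution R M P d e" and
    Tor: "\<And>n. trivial_group (Tor R (Suc n) N M) \<longleftrightarrow>
      (\<forall>c. Poly_Mapping.keys c \<subseteq> carrier N \<times> carrier (P (Suc n))
            \<and> pair_map (d n) c \<in> tensor_relations R N (P n) \<longrightarrow>
         (\<exists>b. Poly_Mapping.keys b \<subseteq> carrier N \<times> carrier (P (Suc (Suc n)))
            \<and> c - pair_map (d (Suc n)) b \<in> tensor_relations R N (P (Suc n))))"
    using Tor_trivial_iff[OF M R size] by blast
  have P: "unitary_left_module R (P n)" for n
    using res by (auto simp: projective_resolution_def projective_module_def)
  have d: "d n \<in> module_hom R (P (Suc n)) (P n)"
    using res by (auto simp: projective_resolution_def)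
  interpret P: tensor_pair R N "P n" by (rule tensor_pairI[OF P])
  interpret P': tensor_pair R N "P (Suc n)" by (rule tensor_pairI[OF P])
  show ?thesis
    unfolding Tor
  proof (intro allI impI, elim conjE)
    fix c assume c: "Poly_Mapping.keys c \<subseteq> carrier N \<times> carrier (P (Suc n))"
      and cyc: "pair_map (d n) c \<in> P.Rel"
    obtain A B where AB: "finite A" "A \<subseteq> carrier R" "finite B" "B \<subseteq> carrier N" and
      kill: "\<And>\<Lambda> h. \<lbrakk>\<forall>x\<in>carrier N. \<Lambda> x \<in> carrier R;
       \<forall>x\<in>carrier N. \<forall>y\<in>carrier N. \<Lambda> (x \<oplus>\<^bsub>N\<^esub> y) = \<Lambda> x \<oplus>\<^bsub>R\<^esub> \<Lambda> y;
       \<forall>x\<in>B. \<forall>r\<in>A. \<Lambda> (r \<odot>\<^bsub>N\<^esub> x) = \<Lambda> x \<otimes>\<^bsub>R\<^esub> r;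
       h \<in> hom P.FG (add_monoid (P n));
       \<forall>x\<in>carrier N. \<forall>m\<in>carrier (P n). h (frag_of (x, m)) = \<Lambda> x \<odot>\<^bsub>P n\<^esub> m\<rbrakk> \<Longrightarrow>
       h (pair_map (d n) c) = \<zero>\<^bsub>P n\<^esub>"
      using relation_finite_witness[OF P cyc] by blast
    define B' where "B' = B \<union> fst ` Poly_Mapping.keys c"
    have "finite B'" "B' \<subseteq> carrier N" using AB c by (auto simp: B'_def)
    from retract[OF AB(1,2) this] obtain \<tau> \<Lambda> where \<tau>: "\<tau> \<in> carrier N"
      and \<Lambda>: "\<forall>x\<in>carrier N. \<Lambda> x \<in> carrier R"
        "\<forall>x\<in>carrier N. \<forall>y\<in>carrier N. \<Lambda> (x \<oplus>\<^bsub>N\<^esub> y) = \<Lambda> x \<oplus>\<^bsub>R\<^esub> \<Lambda> y"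
      and sec: "\<forall>x\<in>B'. \<Lambda> x \<odot>\<^bsub>N\<^esub> \<tau> = x" and lin: "\<forall>x\<in>B'. \<forall>r\<in>A. \<Lambda> (r \<odot>\<^bsub>N\<^esub> x) = \<Lambda> x \<otimes>\<^bsub>R\<^esub> r"
      by blast
    have ex: "\<exists>h\<in>hom (free_Abelian_group (carrier N \<times> carrier (P k))) (add_monoid (P k)).
        \<forall>x\<in>carrier N. \<forall>m\<in>carrier (P k). h (frag_of (x, m)) = \<Lambda> x \<odot>\<^bsub>P k\<^esub> m" for k
    proof -
      interpret L: unitary_left_module R "P k" by (rule P)
      obtain h where "h \<in> hom (free_Abelian_group (carrier N \<times> carrier (P k))) (add_monoid (P k))"
        "\<And>z. z \<in> carrier N \<times> carrier (P k) \<Longrightarrow> h (frag_of z) = (case z of (x, m) \<Rightarrow> \<Lambda> x \<odot>\<^bsub>P k\<^esub> m)"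
        using comm_group.free_Abelian_group_universal[OF L.a_comm_group,
            of "\<lambda>(x, m). \<Lambda> x \<odot>\<^bsub>P k\<^esub> m" "carrier N \<times> carrier (P k)"] \<Lambda>(1) L.smult_closed
        by (auto simp: image_subset_iff)
      then show ?thesis by (intro bexI[of _ h] ballI) simp_all
    qed
    obtain h where h: "h \<in> hom P.FG (add_monoid (P n))"
      "\<forall>x\<in>carrier N. \<forall>m\<in>carrier (P n). h (frag_of (x, m)) = \<Lambda> x \<odot>\<^bsub>P n\<^esub> m" using ex by blast
    obtain g where g: "g \<in> hom P'.FG (add_monoid (P (Suc n)))"
      "\<forall>x\<in>carrier N. \<forall>m\<in>carrier (P (Suc n)). g (frag_of (x, m)) = \<Lambda> x \<odot>\<^bsub>P (Suc n)\<^esub> m" using ex by blast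
    have "h (pair_map (d n) c) = \<zero>\<^bsub>P n\<^esub>"
      by (rule kill[OF \<Lambda> _ h]) (use lin in \<open>auto simp: B'_def\<close>)
    have gdiff: "g (a - b) = g a \<ominus>\<^bsub>P (Suc n)\<^esub> g b"
      if "Poly_Mapping.keys a \<subseteq> carrier N \<times> carrier (P (Suc n))"
         "Poly_Mapping.keys b \<subseteq> carrier N \<times> carrier (P (Suc n))" for a b
      using hom_free_Abelian_group_diff[OF g(1) P'.M.a_group that]
      by (simp add: a_minus_def a_inv_def)
    have hdiff: "h (a - b) = h a \<ominus>\<^bsub>P n\<^esub> h b"
      if "Poly_Mapping.keys a \<subseteq> carrier N \<times> carrier (P n)"
         "Poly_Mapping.keys b \<subseteq> carrier N \<times> carrier (P n)" for a b
      using hom_free_Abelian_group_diff[OF h(1) P.M.a_group that]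
      by (simp add: a_minus_def a_inv_def)
    have g0: "g 0 = \<zero>\<^bsub>P (Suc n)\<^esub>" and h0: "h 0 = \<zero>\<^bsub>P n\<^esub>"
      using hom_one[OF g(1) group_free_Abelian_group P'.M.a_group]
        hom_one[OF h(1) group_free_Abelian_group P.M.a_group] by simp_all
    let ?good = "\<lambda>c. Poly_Mapping.keys c \<subseteq> carrier N \<times> carrier (P (Suc n))
      \<and> g c \<in> carrier (P (Suc n)) \<and> h (pair_map (d n) c) = d n (g c)
      \<and> c - frag_of (\<tau>, g c) \<in> P'.Rel"
    have "Poly_Mapping.keys c \<subseteq> B' \<times> carrier (P (Suc n))"
      using c by (force simp: B'_def)
    then have "?good c"
    proof (induction rule: frag_induction)
      show "?good 0"
        using module_hom_zero[OF d P P] P'.rel_minus[OF P'.rel_zero_right[OF \<tau>]]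
        by (simp add: g0 h0)
    next
      fix z assume "z \<in> B' \<times> carrier (P (Suc n))"
      then obtain x m where z: "z = (x, m)" "x \<in> B'" "m \<in> carrier (P (Suc n))" by auto
      have x: "x \<in> carrier N" "\<Lambda> x \<in> carrier R" "\<Lambda> x \<odot>\<^bsub>N\<^esub> \<tau> = x"
        using z \<open>B' \<subseteq> carrier N\<close> \<Lambda>(1) sec by auto
      show "?good (frag_of z)"
        using x z(3) P'.rel_balanced[OF x(2) \<tau> z(3)] P'.M.smult_closed module_homD[OF d] g(2) h(2)
        by (simp add: z(1))
    next
      fix a b assume ab: "?good a" "?good b"
      let ?D = "frag_of (\<tau>, g a) - frag_of (\<tau>, g a \<ominus>\<^bsub>P (Suc n)\<^esub> g b) - frag_of (\<tau>, g b)"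
      have keys: "Poly_Mapping.keys (pair_map (d n) x) \<subseteq> carrier N \<times> carrier (P n)" if "?good x" for x
        using that module_homD(1)[OF d] by (intro keys_pair_map[where Y = "carrier (P (Suc n))"]) auto
      have "g a = (g a \<ominus>\<^bsub>P (Suc n)\<^esub> g b) \<oplus>\<^bsub>P (Suc n)\<^esub> g b"
        using ab by (simp add: P'.M.minus_eq P'.M.a_assoc P'.M.l_neg)
      then have "?D \<in> P'.Rel"
        using P'.rel_add_right[OF \<tau>, of "g a \<ominus>\<^bsub>P (Suc n)\<^esub> g b" "g b"] ab by simp
      then have "(a - frag_of (\<tau>, g a)) - (b - frag_of (\<tau>, g b)) + ?D \<in> P'.Rel"
        using P'.rel_add[OF P'.rel_diff, of "a - frag_of (\<tau>, g a)" "b - frag_of (\<tau>, g b)" ?D] ab by blast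
      moreover have "(a - frag_of (\<tau>, g a)) - (b - frag_of (\<tau>, g b)) + ?D
          = (a - b) - frag_of (\<tau>, g a \<ominus>\<^bsub>P (Suc n)\<^esub> g b)"
        by simp
      moreover have "d n (g a \<ominus>\<^bsub>P (Suc n)\<^esub> g b) = d n (g a) \<ominus>\<^bsub>P n\<^esub> d n (g b)"
        using ab module_homD(2)[OF d] module_hom_minus[OF d P P]
        by (simp add: P'.M.minus_eq P.M.minus_eq)
      ultimately show "?good (a - b)"
        using ab keys[OF ab(1)] keys[OF ab(2)] order_trans[OF keys_diff[of a b]]
        by (simp add: gdiff hdiff frag_extend_diff)
    qed
    then have gc: "g c \<in> carrier (P (Suc n))" "d n (g c) = \<zero>\<^bsub>P n\<^esub>" "c - frag_of (\<tau>, g c) \<in> P'.Rel"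
      using \<open>h (pair_map (d n) c) = \<zero>\<^bsub>P n\<^esub>\<close> by auto
    have "d (Suc n) ` carrier (P (Suc (Suc n))) = kernel (add_monoid (P (Suc n))) (add_monoid (P n)) (d n)"
      using res by (auto simp: projective_resolution_def)
    then obtain z where z: "z \<in> carrier (P (Suc (Suc n)))" "g c = d (Suc n) z"
      using gc by (force simp: kernel_def)
    then show "\<exists>b. Poly_Mapping.keys b \<subseteq> carrier N \<times> carrier (P (Suc (Suc n)))
            \<and> c - pair_map (d (Suc n)) b \<in> P'.Rel"
      using gc(3) \<tau> by (intro exI[of _ "frag_of (\<tau>, z)"]) simp
  qed
qed

lemma (in local_unit_ring) left_ideal_module:
  assumes e: "e \<in> carrier R"
  shows "unitary_left_module R \<lparr>carrier = {a \<in> carrier R. a \<otimes> e = a}, monoid.mult = undefined,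
    one = undefined, zero = \<zero>, add = (\<oplus>), smult = (\<otimes>)\<rparr>" (is "unitary_left_module R ?L")
proof (rule unitary_left_moduleI)
  show "abelian_group ?L"
  proof (rule abelian_groupI)
    fix a assume "a \<in> carrier ?L"
    then show "\<exists>b\<in>carrier ?L. b \<oplus>\<^bsub>?L\<^esub> a = \<zero>\<^bsub>?L\<^esub>"
      using e by (intro bexI[of _ "\<ominus> a"]) (auto simp: l_neg l_minus)
  qed (use e in \<open>auto simp: a_ac l_distr\<close>)
  fix a assume "a \<in> carrier ?L"
  then show "\<exists>u\<in>carrier R. u \<odot>\<^bsub>?L\<^esub> a = a"
    using local_units[of "{a}"] by auto
qed (use e in \<open>auto simp: l_distr r_distr m_assoc\<close>)

text \<open>The equational criterion for flatness, for one relation \<open>n r = 0\<close>. Classically one tensors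
  \<open>0 \<rightarrow> R r \<rightarrow> R e \<rightarrow> R e / R r \<rightarrow> 0\<close> with \<open>N\<close>, but the resolution \<open>P\<close> of \<open>M = R e / R r\<close> is not of our
  choosing. Let \<open>p\<close> in \<open>P\<^sub>0\<close> lie above the class of \<open>e\<close>. Then \<open>r p\<close> lies above 0, so \<open>r p = d y\<close>, and
  \<open>n \<otimes> y\<close> is a cycle since \<open>n \<otimes> r p = n r \<otimes> p = 0\<close>. By assumption it is a boundary. Lift \<open>P\<^sub>0 \<rightarrow> M\<close>
  to a map \<open>f\<close> into \<open>R e\<close>. The map \<open>x \<otimes> z \<mapsto> x a\<close> with \<open>a r = f (d z)\<close> is well defined modulo the
  elements \<open>m k\<close> with \<open>k r = 0\<close> and kills boundaries. Its value at \<open>n \<otimes> y\<close> is \<open>n\<close>, since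
  \<open>f (d y) = r f p\<close> with \<open>f p\<close> congruent to \<open>e\<close> modulo \<open>R r\<close>.\<close>

theorem (in right_module) annihilated_mem_span_if_Tor_trivial:
  assumes Tor: "\<And>M :: ('a, 'm) module. unitary_left_module R M \<Longrightarrow> trivial_group (Tor R (Suc 0) N M)"
    and R: "carrier R \<lesssim> (UNIV :: 'm set)"
    and size: "infinite (UNIV :: 'm set) \<or> carrier R = {\<zero>\<^bsub>R\<^esub>}"
    and e: "e \<in> carrier R" "e \<otimes>\<^bsub>R\<^esub> e = e" and r: "r \<in> carrier R" "e \<otimes>\<^bsub>R\<^esub> r = r" "r \<otimes>\<^bsub>R\<^esub> e = r"
    and n: "n \<in> carrier N" "e \<odot>\<^bsub>N\<^esub> n = n" "r \<odot>\<^bsub>N\<^esub> n = \<zero>\<^bsub>N\<^esub>"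
  shows "n \<in> generate (add_monoid N)
    {k \<odot>\<^bsub>N\<^esub> m |k m. k \<in> carrier R \<and> k \<otimes>\<^bsub>R\<^esub> r = \<zero>\<^bsub>R\<^esub> \<and> m \<in> carrier N}" (is "n \<in> ?S")
proof -
  let ?X = "{k \<odot>\<^bsub>N\<^esub> m |k m. k \<in> carrier R \<and> k \<otimes>\<^bsub>R\<^esub> r = \<zero>\<^bsub>R\<^esub> \<and> m \<in> carrier N}"
  define L :: "('a, 'a) module" where
    "L = \<lparr>carrier = {a \<in> carrier R. a \<otimes>\<^bsub>R\<^esub> e = a}, monoid.mult = undefined,
      one = undefined, zero = \<zero>\<^bsub>R\<^esub>, add = (\<oplus>\<^bsub>R\<^esub>), smult = (\<otimes>\<^bsub>R\<^esub>)\<rparr>"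
  have L_simps: "carrier L = {a \<in> carrier R. a \<otimes>\<^bsub>R\<^esub> e = a}" "\<zero>\<^bsub>L\<^esub> = \<zero>\<^bsub>R\<^esub>"
    "a \<oplus>\<^bsub>L\<^esub> b = a \<oplus>\<^bsub>R\<^esub> b" "a \<odot>\<^bsub>L\<^esub> b = a \<otimes>\<^bsub>R\<^esub> b" for a b
    by (simp_all add: L_def)
  have L: "unitary_left_module R L"
    unfolding L_def by (rule R.left_ideal_module[OF e(1)])
  interpret L: module_local_units R L
    by (rule module_local_units.intro[OF R.local_unit_ring_axioms L])
  have LR: "a \<in> carrier R" "a \<otimes>\<^bsub>R\<^esub> e = a" if "a \<in> carrier L" for a
    using that by (auto simp: L_simps)
  have eL: "e \<in> carrier L" and rL: "r \<in> carrier L" using e r by (auto simp: L_simps)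
  define I where "I = (\<lambda>a. a \<otimes>\<^bsub>R\<^esub> r) ` carrier L"
  have "a \<otimes>\<^bsub>R\<^esub> r \<in> carrier L" if "a \<in> carrier L" for a
    using L.smult_closed[OF LR(1)[OF that] rL] by (simp only: L_simps)
  then have IL: "I \<subseteq> carrier L" by (auto simp only: I_def)
  have "group_hom (add_monoid L) (add_monoid L) (\<lambda>a. a \<otimes>\<^bsub>R\<^esub> r)"
    using e r L.a_group by (auto simp: group_hom_def group_hom_axioms_def hom_def L_simps R.l_distr R.m_assoc)
  from group_hom.img_is_subgroup[OF this] have I: "subgroup I (add_monoid L)"
    by (simp add: I_def)
  define C where "C a = I #>\<^bsub>add_monoid L\<^esub> a" for a
  have C_mem: "x \<in> C a \<longleftrightarrow> (\<exists>b\<in>carrier L. x = b \<otimes>\<^bsub>R\<^esub> r \<oplus>\<^bsub>R\<^esub> a)" for x a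
    by (auto simp: C_def r_coset_def I_def L_simps)
  have C_self: "a \<in> C a" if "a \<in> carrier L" for a
    using group.rcos_self[OF L.a_group _ I] that by (simp add: C_def)
  have C_repr: "C a = C b" if "b \<in> C a" "a \<in> carrier L" for a b
    using group.repr_independence[OF L.a_group _ _ I] that by (simp add: C_def)
  have C_carrier: "x \<in> carrier L" if "x \<in> C a" "a \<in> carrier L" for x a
    using that IL by (auto simp: C_def r_coset_def)
  obtain j :: "'a \<Rightarrow> 'm" where j: "inj_on j (carrier R)"
    using R by (auto simp: lepoll_def)
  have jL: "inj_on j (carrier L)" by (rule inj_on_subset[OF j]) (auto simp: L_simps)
  \<comment> \<open>The quotient \<open>R e / R r\<close> is realised in the codomain of \<open>j\<close> by choosing a representative of each coset.\<close>
  define \<pi> where "\<pi> a = j (SOME x. x \<in> C a)" for a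
  have \<pi>_eq_iff: "\<pi> a = \<pi> b \<longleftrightarrow> C a = C b" if "a \<in> carrier L" "b \<in> carrier L" for a b
  proof
    have some: "(SOME x. x \<in> C a) \<in> C a" if "a \<in> carrier L" for a
      using C_self[OF that] by (rule someI)
    assume "\<pi> a = \<pi> b"
    then have "(SOME x. x \<in> C a) = (SOME x. x \<in> C b)"
      using inj_onD[OF jL _ C_carrier[OF some that(1)] C_carrier[OF some that(2)]] that
      by (simp add: \<pi>_def)
    then show "C a = C b"
      using C_repr some that by metis
  qed (simp add: \<pi>_def)
  have \<pi>_eqI: "\<pi> x = \<pi> a" if "b \<in> carrier L" "x = b \<otimes>\<^bsub>R\<^esub> r \<oplus>\<^bsub>R\<^esub> a" "a \<in> carrier L" for x a b
  proof -
    have "x \<in> C a" using that C_mem by blast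
    then show ?thesis using \<pi>_eq_iff C_repr C_carrier that(3) by metis
  qed
  have \<pi>_eqD: "\<exists>b\<in>carrier L. x = b \<otimes>\<^bsub>R\<^esub> r \<oplus>\<^bsub>R\<^esub> a" if "\<pi> x = \<pi> a" "x \<in> carrier L" "a \<in> carrier L" for x a
    using that \<pi>_eq_iff C_self C_mem by metis
  have cong_add: "\<pi> (x \<oplus>\<^bsub>L\<^esub> y) = \<pi> (x' \<oplus>\<^bsub>L\<^esub> y')"
    if "x \<in> carrier L" "x' \<in> carrier L" "y \<in> carrier L" "y' \<in> carrier L" "\<pi> x = \<pi> x'" "\<pi> y = \<pi> y'" for x x' y y'
  proof -
    note * = that
    obtain b c where bc: "b \<in> carrier L" "x = b \<otimes>\<^bsub>R\<^esub> r \<oplus>\<^bsub>R\<^esub> x'" "c \<in> carrier L" "y = c \<otimes>\<^bsub>R\<^esub> r \<oplus>\<^bsub>R\<^esub> y'"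
      using \<pi>_eqD[OF *(5,1,2)] \<pi>_eqD[OF *(6,3,4)] by blast
    have "x \<oplus>\<^bsub>R\<^esub> y = (b \<oplus>\<^bsub>L\<^esub> c) \<otimes>\<^bsub>R\<^esub> r \<oplus>\<^bsub>R\<^esub> (x' \<oplus>\<^bsub>L\<^esub> y')"
      unfolding bc(2,4) using LR(1) bc(1,3) that r(1) by (simp add: L_simps R.l_distr R.a_ac)
    then show ?thesis
      using \<pi>_eqI[of "b \<oplus>\<^bsub>L\<^esub> c" "x \<oplus>\<^bsub>R\<^esub> y" "x' \<oplus>\<^bsub>L\<^esub> y'"] bc(1,3) that L.a_closed L_simps(3) by simp
  qed
  have cong_smult: "\<pi> (a \<odot>\<^bsub>L\<^esub> x) = \<pi> (a \<odot>\<^bsub>L\<^esub> x')"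
    if "a \<in> carrier R" "x \<in> carrier L" "x' \<in> carrier L" "\<pi> x = \<pi> x'" for a x x'
  proof -
    note * = that
    obtain b where b: "b \<in> carrier L" "x = b \<otimes>\<^bsub>R\<^esub> r \<oplus>\<^bsub>R\<^esub> x'"
      using \<pi>_eqD[OF *(4,2,3)] by blast
    have "a \<odot>\<^bsub>L\<^esub> x = (a \<odot>\<^bsub>L\<^esub> b) \<otimes>\<^bsub>R\<^esub> r \<oplus>\<^bsub>R\<^esub> (a \<odot>\<^bsub>L\<^esub> x')"
      unfolding b(2) using LR(1) b(1) that(1,3) r(1) by (simp add: L_simps R.r_distr R.m_assoc)
    then show ?thesis
      by (rule \<pi>_eqI[rotated]) (use b that L.smult_closed in auto)
  qed
  define M where "M = image_module \<pi> L"
  have M: "unitary_left_module R M" and \<pi>: "\<pi> \<in> module_hom R L M"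
    unfolding M_def using R.image_module[OF L, of \<pi>] cong_add cong_smult by blast+
  have M_carrier: "carrier M = \<pi> ` carrier L" by (simp add: M_def image_module_def)
  note L' = R.image_module_inj[OF L jL]
  let ?L' = "image_module j L" and ?i = "inv_into (carrier L) j"
  obtain P d \<epsilon> where res: "projective_resolution R M P d \<epsilon>" and
    TorM: "\<And>n. trivial_group (Tor R (Suc n) N M) \<longleftrightarrow>
      (\<forall>c. Poly_Mapping.keys c \<subseteq> carrier N \<times> carrier (P (Suc n))
            \<and> pair_map (d n) c \<in> tensor_relations R N (P n) \<longrightarrow>
         (\<exists>b. Poly_Mapping.keys b \<subseteq> carrier N \<times> carrier (P (Suc (Suc n)))
            \<and> c - pair_map (d (Suc n)) b \<in> tensor_relations R N (P (Suc n))))"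
    using Tor_trivial_iff[OF M R size] by blast
  have P: "unitary_left_module R (P n)" for n
    using res by (auto simp: projective_resolution_def projective_module_def)
  have d: "d n \<in> module_hom R (P (Suc n)) (P n)" for n
    using res by (auto simp: projective_resolution_def)
  have \<epsilon>: "\<epsilon> \<in> module_hom R (P 0) M" "\<epsilon> ` carrier (P 0) = carrier M"
    and ex0: "d 0 ` carrier (P (Suc 0)) = kernel (add_monoid (P 0)) (add_monoid M) \<epsilon>"
    and ex1: "d (Suc 0) ` carrier (P (Suc (Suc 0))) = kernel (add_monoid (P (Suc 0))) (add_monoid (P 0)) (d 0)"
    using res by (auto simp: projective_resolution_def)
  interpret P0: tensor_pair R N "P 0" by (rule tensor_pairI[OF P])
  interpret P1: tensor_pair R N "P (Suc 0)" by (rule tensor_pairI[OF P])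
  \<comment> \<open>Projectivity of \<open>P 0\<close> is tested on the copy of \<open>L\<close> whose elements lie in the right type.\<close>
  obtain f where f: "f \<in> module_hom R (P 0) L" "\<And>x. x \<in> carrier (P 0) \<Longrightarrow> \<pi> (f x) = \<epsilon> x"
  proof -
    have q: "(\<lambda>u. \<pi> (?i u)) \<in> module_hom R ?L' M" by (rule module_hom_comp[OF L'(3) \<pi>])
    have "(\<lambda>u. \<pi> (?i u)) ` carrier ?L' = carrier M"
      by (simp add: M_carrier image_module_def image_image jL cong: image_cong)
    moreover have "projective_module R (P 0)"
      using res by (auto simp: projective_resolution_def)
    ultimately obtain h where "h \<in> module_hom R (P 0) ?L'" "\<forall>x\<in>carrier (P 0). \<pi> (?i (h x)) = \<epsilon> x"
      using L'(1) M q \<epsilon>(1) unfolding projective_module_def by blast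
    then show ?thesis
      using that[of "\<lambda>x. ?i (h x)"] module_hom_comp[OF _ L'(3)] by blast
  qed
  have "\<pi> e \<in> carrier M" using eL M_carrier by blast
  then obtain p0 where p0: "p0 \<in> carrier (P 0)" "\<epsilon> p0 = \<pi> e" using \<epsilon>(2) by (metis imageE)
  define p where "p = e \<odot>\<^bsub>P 0\<^esub> p0"
  have p: "p \<in> carrier (P 0)" "\<epsilon> p = \<pi> e"
    using p0 e P0.M.smult_closed module_homD(3)[OF \<epsilon>(1) e(1) p0(1)] module_homD(3)[OF \<pi> e(1) eL]
    by (simp_all add: p_def L_simps)
  have \<pi>0: "\<pi> \<zero>\<^bsub>R\<^esub> = \<zero>\<^bsub>M\<^esub>" using module_hom_zero[OF \<pi> L M] by (simp add: L_simps)
  have zL: "\<zero>\<^bsub>R\<^esub> \<in> carrier L" using L.zero_closed by (simp add: L_simps)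
  have "\<pi> r = \<pi> \<zero>\<^bsub>R\<^esub>"
    by (rule \<pi>_eqI[OF eL _ zL]) (use r in simp)
  then have "\<epsilon> (r \<odot>\<^bsub>P 0\<^esub> p) = \<zero>\<^bsub>M\<^esub>"
    using module_homD(3)[OF \<epsilon>(1) r(1) p(1)] module_homD(3)[OF \<pi> r(1) eL] p(2) r(3) \<pi>0
    by (simp add: L_simps)
  then have "r \<odot>\<^bsub>P 0\<^esub> p \<in> kernel (add_monoid (P 0)) (add_monoid M) \<epsilon>"
    using P0.M.smult_closed[OF r(1) p(1)] by (simp add: kernel_def)
  then obtain y where y: "y \<in> carrier (P (Suc 0))" "d 0 y = r \<odot>\<^bsub>P 0\<^esub> p"
    unfolding ex0[symmetric] by (metis imageE)
  have "frag_of (n, r \<odot>\<^bsub>P 0\<^esub> p) \<in> P0.Rel"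
    using P0.rel_diff[OF P0.rel_zero_left[OF p(1)] P0.rel_balanced[OF r(1) n(1) p(1)]] n(3) by simp
  then have "pair_map (d 0) (frag_of (n, y)) \<in> P0.Rel"
    by (simp add: y)
  moreover have "Poly_Mapping.keys (frag_of (n, y)) \<subseteq> carrier N \<times> carrier (P (Suc 0))"
    using n y by simp
  ultimately obtain b where b: "Poly_Mapping.keys b \<subseteq> carrier N \<times> carrier (P (Suc (Suc 0)))"
    "frag_of (n, y) - pair_map (d (Suc 0)) b \<in> P1.Rel"
    using Tor[OF M] TorM[of 0] by blast
  have "\<exists>a\<in>carrier L. a \<otimes>\<^bsub>R\<^esub> r = f (d 0 z)" if z: "z \<in> carrier (P (Suc 0))" for z
  proof -
    have dz: "d 0 z \<in> carrier (P 0)" "\<epsilon> (d 0 z) = \<zero>\<^bsub>M\<^esub>"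
      using ex0 z by (auto simp: kernel_def)
    then have "\<pi> (f (d 0 z)) = \<pi> \<zero>\<^bsub>R\<^esub>" using f(2) \<pi>0 by simp
    from \<pi>_eqD[OF this module_homD(1)[OF f(1) dz(1)] zL]
    show ?thesis using LR(1) r by (auto intro!: bexI)
  qed
  then obtain \<alpha> where \<alpha>: "\<And>z. z \<in> carrier (P (Suc 0)) \<Longrightarrow> \<alpha> z \<in> carrier L \<and> \<alpha> z \<otimes>\<^bsub>R\<^esub> r = f (d 0 z)"
    by metis
  have \<alpha>R: "\<alpha> z \<in> carrier R" if "z \<in> carrier (P (Suc 0))" for z using \<alpha>[OF that] LR by blast
  have X: "?X \<subseteq> carrier N" using act_closed by auto
  then have S: "subgroup ?S (add_monoid N)"
    by (intro group.generate_is_subgroup a_group) simp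
  have S_mem: "k \<odot>\<^bsub>N\<^esub> m \<in> ?S" if "k \<in> carrier R" "k \<otimes>\<^bsub>R\<^esub> r = \<zero>\<^bsub>R\<^esub>" "m \<in> carrier N" for k m
    by (rule generate.incl) (use that in blast)
  have S_diff: "a \<odot>\<^bsub>N\<^esub> m \<ominus>\<^bsub>N\<^esub> b \<odot>\<^bsub>N\<^esub> m \<in> ?S"
    if "a \<in> carrier R" "b \<in> carrier R" "m \<in> carrier N" "a \<otimes>\<^bsub>R\<^esub> r = b \<otimes>\<^bsub>R\<^esub> r" for a b m
  proof -
    have 1: "(a \<ominus>\<^bsub>R\<^esub> b) \<otimes>\<^bsub>R\<^esub> r = \<zero>\<^bsub>R\<^esub>"
      using that r by (simp add: R.minus_eq R.l_distr R.l_minus R.r_neg)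
    have "(a \<ominus>\<^bsub>R\<^esub> b) \<odot>\<^bsub>N\<^esub> m \<oplus>\<^bsub>N\<^esub> b \<odot>\<^bsub>N\<^esub> m = a \<odot>\<^bsub>N\<^esub> m"
      using that act_l_distr[of "a \<ominus>\<^bsub>R\<^esub> b" b m] by (simp add: R.minus_eq R.a_assoc R.l_neg)
    then have "(a \<ominus>\<^bsub>R\<^esub> b) \<odot>\<^bsub>N\<^esub> m = a \<odot>\<^bsub>N\<^esub> m \<ominus>\<^bsub>N\<^esub> b \<odot>\<^bsub>N\<^esub> m"
      using that act_closed R.minus_closed[of a b]
      by (metis a_inv_closed minus_eq r_neg a_assoc r_zero)
    then show ?thesis using S_mem[OF _ 1 that(3)] that by (metis R.minus_closed)
  qed
  have S_carrier: "x \<in> carrier N" if "x \<in> ?S" for x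
    using subgroup.mem_carrier[OF S that] by simp
  have S_zero: "\<zero>\<^bsub>N\<^esub> \<in> ?S" using subgroup.one_closed[OF S] by simp
  have S_add: "a \<oplus>\<^bsub>N\<^esub> b \<in> ?S" if "a \<in> ?S" "b \<in> ?S" for a b
    using subgroup.m_closed[OF S that] by simp
  have S_minus: "a \<ominus>\<^bsub>N\<^esub> b \<in> ?S" if "a \<in> ?S" "b \<in> ?S" for a b
    using subgroup.m_closed[OF S that(1) subgroup.m_inv_closed[OF S that(2)]]
    by (simp add: minus_eq a_inv_def)
  obtain h where h: "h \<in> hom P1.FG (add_monoid N)"
    "\<And>z. z \<in> carrier N \<times> carrier (P (Suc 0)) \<Longrightarrow> h (frag_of z) = (case z of (m, z) \<Rightarrow> \<alpha> z \<odot>\<^bsub>N\<^esub> m)"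
    using comm_group.free_Abelian_group_universal[OF a_comm_group,
        of "\<lambda>(m, z). \<alpha> z \<odot>\<^bsub>N\<^esub> m" "carrier N \<times> carrier (P (Suc 0))"] \<alpha>R act_closed
    by (auto simp: image_subset_iff)
  have h_of: "h (frag_of (m, z)) = \<alpha> z \<odot>\<^bsub>N\<^esub> m" if "m \<in> carrier N" "z \<in> carrier (P (Suc 0))" for m z
    using h(2) that by simp
  have h_diff: "h (a - b) = h a \<ominus>\<^bsub>N\<^esub> h b"
    if "Poly_Mapping.keys a \<subseteq> carrier N \<times> carrier (P (Suc 0))"
       "Poly_Mapping.keys b \<subseteq> carrier N \<times> carrier (P (Suc 0))" for a b
    using hom_free_Abelian_group_diff[OF h(1) a_group that]
    by (simp add: a_minus_def a_inv_def)
  have h_rel: "h c \<in> ?S" if "c \<in> P1.Rel" for c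
  proof (rule P1.hom_rel_subset[OF a_group S h(1) _ _ _ that])
    fix x x' m assume *: "x \<in> carrier N" "x' \<in> carrier N" "m \<in> carrier (P (Suc 0))"
    show "h (frag_of (x \<oplus>\<^bsub>N\<^esub> x', m) - frag_of (x, m) - frag_of (x', m)) \<in> ?S"
      using * S_zero by (simp add: h_diff P1.keys_frag_of_diff_diff h_of act_r_distr \<alpha>R act_closed add_minus_minus)
  next
    fix x m k assume *: "x \<in> carrier N" "m \<in> carrier (P (Suc 0))" "k \<in> carrier (P (Suc 0))"
    have mk: "m \<oplus>\<^bsub>P (Suc 0)\<^esub> k \<in> carrier (P (Suc 0))" using * by simp
    have "f (d 0 (m \<oplus>\<^bsub>P (Suc 0)\<^esub> k)) = f (d 0 m) \<oplus>\<^bsub>R\<^esub> f (d 0 k)"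
      using * module_homD(1,2)[OF d[of 0]] module_homD(2)[OF f(1)] by (simp add: L_simps)
    then have "\<alpha> (m \<oplus>\<^bsub>P (Suc 0)\<^esub> k) \<otimes>\<^bsub>R\<^esub> r = (\<alpha> m \<oplus>\<^bsub>R\<^esub> \<alpha> k) \<otimes>\<^bsub>R\<^esub> r"
      using * \<alpha> \<alpha>R mk r by (simp add: R.l_distr)
    then have "\<alpha> (m \<oplus>\<^bsub>P (Suc 0)\<^esub> k) \<odot>\<^bsub>N\<^esub> x \<ominus>\<^bsub>N\<^esub> (\<alpha> m \<oplus>\<^bsub>R\<^esub> \<alpha> k) \<odot>\<^bsub>N\<^esub> x \<in> ?S"
      using * \<alpha>R mk by (intro S_diff) auto
    moreover have "h (frag_of (x, m \<oplus>\<^bsub>P (Suc 0)\<^esub> k) - frag_of (x, m) - frag_of (x, k)) =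
        \<alpha> (m \<oplus>\<^bsub>P (Suc 0)\<^esub> k) \<odot>\<^bsub>N\<^esub> x \<ominus>\<^bsub>N\<^esub> (\<alpha> m \<oplus>\<^bsub>R\<^esub> \<alpha> k) \<odot>\<^bsub>N\<^esub> x"
      using * mk \<alpha>R act_closed
      by (simp add: h_diff P1.keys_frag_of_diff_diff h_of act_l_distr minus_eq minus_add a_assoc)
    ultimately show "h (frag_of (x, m \<oplus>\<^bsub>P (Suc 0)\<^esub> k) - frag_of (x, m) - frag_of (x, k)) \<in> ?S"
      by simp
  next
    fix a x m assume *: "a \<in> carrier R" "x \<in> carrier N" "m \<in> carrier (P (Suc 0))"
    have am: "a \<odot>\<^bsub>P (Suc 0)\<^esub> m \<in> carrier (P (Suc 0))" using * P1.M.smult_closed by simp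
    have "f (d 0 (a \<odot>\<^bsub>P (Suc 0)\<^esub> m)) = a \<otimes>\<^bsub>R\<^esub> f (d 0 m)"
      using * module_homD(1,3)[OF d[of 0]] module_homD(3)[OF f(1)] by (simp add: L_simps)
    then have "(a \<otimes>\<^bsub>R\<^esub> \<alpha> m) \<otimes>\<^bsub>R\<^esub> r = \<alpha> (a \<odot>\<^bsub>P (Suc 0)\<^esub> m) \<otimes>\<^bsub>R\<^esub> r"
      using * \<alpha> \<alpha>R am r by (simp add: R.m_assoc)
    then have "(a \<otimes>\<^bsub>R\<^esub> \<alpha> m) \<odot>\<^bsub>N\<^esub> x \<ominus>\<^bsub>N\<^esub> \<alpha> (a \<odot>\<^bsub>P (Suc 0)\<^esub> m) \<odot>\<^bsub>N\<^esub> x \<in> ?S"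
      using * \<alpha>R am by (intro S_diff) auto
    then show "h (frag_of (a \<odot>\<^bsub>N\<^esub> x, m) - frag_of (x, a \<odot>\<^bsub>P (Suc 0)\<^esub> m)) \<in> ?S"
      using * am \<alpha>R act_closed by (simp add: h_diff h_of act_assoc)
  qed
  have "Poly_Mapping.keys (pair_map (d (Suc 0)) b) \<subseteq> carrier N \<times> carrier (P (Suc 0)) \<and> h (pair_map (d (Suc 0)) b) \<in> ?S"
    using b(1)
  proof (induction rule: frag_induction)
    case zero
    then show ?case
      using hom_one[OF h(1) group_free_Abelian_group a_group] S_zero by simp
  next
    case (one z)
    then obtain m x where z: "z = (m, x)" "m \<in> carrier N" "x \<in> carrier (P (Suc (Suc 0)))" by auto
    have dx: "d (Suc 0) x \<in> carrier (P (Suc 0))" "d 0 (d (Suc 0) x) = \<zero>\<^bsub>P 0\<^esub>"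
      using ex1 z by (auto simp: kernel_def)
    then have "\<alpha> (d (Suc 0) x) \<otimes>\<^bsub>R\<^esub> r = \<zero>\<^bsub>R\<^esub>"
      using \<alpha>[OF dx(1)] module_hom_zero[OF f(1) P L] by (simp add: L_simps)
    then show ?case
      using z dx \<alpha>R S_mem by (simp add: h_of)
  next
    case (diff a b)
    then show ?case
      using order_trans[OF keys_diff Un_least, of "pair_map (d (Suc 0)) a"
          "carrier N \<times> carrier (P (Suc 0))" "pair_map (d (Suc 0)) b"] S_minus by (simp add: frag_extend_diff h_diff)
  qed
  then have "h (frag_of (n, y)) \<in> ?S"
    using S_add[OF h_rel[OF b(2)], of "h (pair_map (d (Suc 0)) b)"]
      h_diff[of "frag_of (n, y)" "pair_map (d (Suc 0)) b"] n y S_carrier h_of \<alpha>R act_closed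
    by (simp add: minus_eq a_assoc l_neg)
  then have \<alpha>n: "\<alpha> y \<odot>\<^bsub>N\<^esub> n \<in> ?S" using h_of n y by simp
  have fp: "f p \<in> carrier L" using module_homD(1)[OF f(1) p(1)] .
  obtain c where c: "c \<in> carrier L" "f p = c \<otimes>\<^bsub>R\<^esub> r \<oplus>\<^bsub>R\<^esub> e"
    using \<pi>_eqD[OF _ fp eL] f(2)[OF p(1)] p(2) by auto
  have "\<alpha> y \<otimes>\<^bsub>R\<^esub> r = r \<otimes>\<^bsub>R\<^esub> f p"
    using \<alpha>[OF y(1)] y(2) module_homD(3)[OF f(1) r(1) p(1)] by (simp add: L_simps)
  also have "\<dots> = (r \<otimes>\<^bsub>R\<^esub> c \<oplus>\<^bsub>R\<^esub> e) \<otimes>\<^bsub>R\<^esub> r"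
    unfolding c(2) using LR(1)[OF c(1)] r e by (simp add: R.r_distr R.l_distr R.m_assoc)
  finally have "\<alpha> y \<odot>\<^bsub>N\<^esub> n \<ominus>\<^bsub>N\<^esub> (r \<otimes>\<^bsub>R\<^esub> c \<oplus>\<^bsub>R\<^esub> e) \<odot>\<^bsub>N\<^esub> n \<in> ?S"
    using LR(1)[OF c(1)] r e n \<alpha>R[OF y(1)] by (intro S_diff) auto
  moreover have "c \<odot>\<^bsub>N\<^esub> \<zero>\<^bsub>N\<^esub> = \<zero>\<^bsub>N\<^esub>"
    using act_r_distr[OF LR(1)[OF c(1)], of "\<zero>\<^bsub>N\<^esub>" "\<zero>\<^bsub>N\<^esub>"] act_closed[OF LR(1)[OF c(1)], of "\<zero>\<^bsub>N\<^esub>"]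
    by (metis add.r_cancel_one l_zero zero_closed)
  then have "(r \<otimes>\<^bsub>R\<^esub> c \<oplus>\<^bsub>R\<^esub> e) \<odot>\<^bsub>N\<^esub> n = n"
    using LR(1)[OF c(1)] r e n by (simp add: act_l_distr act_assoc)
  ultimately have "\<alpha> y \<odot>\<^bsub>N\<^esub> n \<ominus>\<^bsub>N\<^esub> (\<alpha> y \<odot>\<^bsub>N\<^esub> n \<ominus>\<^bsub>N\<^esub> n) \<in> ?S"
    using S_minus[OF \<alpha>n] by simp
  moreover have "\<alpha> y \<odot>\<^bsub>N\<^esub> n \<ominus>\<^bsub>N\<^esub> (\<alpha> y \<odot>\<^bsub>N\<^esub> n \<ominus>\<^bsub>N\<^esub> n) = n"
    using S_carrier[OF \<alpha>n] n by (simp add: minus_eq minus_add r_neg2)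
  ultimately show ?thesis by simp
qed

section \<open>Topological preliminaries\<close>

text \<open>Inside a compact neighbourhood \<open>K\<close> the quasi-component of \<open>x\<close> is its component \<open>{x}\<close>, so that \<open>x\<close> can be
  separated from the compact set \<open>K - U\<close> by a clopen subset of \<open>K\<close>. A clopen subset of \<open>K\<close> inside the
  open set \<open>U\<close> is open in the whole space.\<close>

lemma compact_open_neighbourhood:
  assumes lc: "locally_compact_space X" and H: "Hausdorff_space X" and td: "totally_disconnected_space X"
    and W: "openin X W" "x \<in> W"
  shows "\<exists>V. openin X V \<and> compactin X V \<and> x \<in> V \<and> V \<subseteq> W"
proof -
  have nb: "neighbourhood_base_of (compactin X) X"
    using lc H by (simp add: locally_compact_space_neighbourhood_base)
  then obtain U K where UK: "openin X U" "compactin X K" "x \<in> U" "U \<subseteq> K" "K \<subseteq> W"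
    using nb[unfolded neighbourhood_base_of, rule_format, of W x] W by blast
  let ?Y = "subtopology X K"
  have KX: "K \<subseteq> topspace X" using UK(2) compactin_subset_topspace by blast
  have top: "topspace ?Y = K" using KX by auto
  have cY: "compact_space ?Y" using UK(2) by (simp add: compact_space_subtopology)
  have HY: "Hausdorff_space ?Y" using H by (rule Hausdorff_space_subtopology)
  have xY: "x \<in> topspace ?Y" using UK top by blast
  have "quasi_component_of_set ?Y x = {x}"
  proof -
    have "quasi_component_of ?Y x = connected_component_of ?Y x"
      using cY HY by (intro quasi_eq_connected_component_of) auto
    moreover have "y = x" if c: "connected_component_of ?Y x y" for y
    proof -
      obtain S where "connectedin ?Y S" "x \<in> S" "y \<in> S"
        using c unfolding connected_component_of_def by blast
      then show ?thesis
        using td unfolding totally_disconnected_space_def by (metis connectedin_subtopology)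
    qed
    moreover have "connected_component_of ?Y x x"
      using xY by (simp add: connected_component_of_refl)
    ultimately show ?thesis by auto
  qed
  then have "{x} \<in> quasi_components_of ?Y"
    using xY unfolding quasi_components_of_def by (metis imageI)
  moreover have "compactin ?Y (K - U)"
  proof -
    have "closedin ?Y (K - U)"
      unfolding closedin_def top using UK(1) by (auto simp: openin_subtopology Diff_Diff_Int intro!: exI[of _ U])
    then show ?thesis using closedin_compact_space[OF cY] by blast
  qed
  ultimately have "separated_between ?Y {x} (K - U)"
    using UK(3) by (simp add: separated_between_quasi_component_compact)
  then obtain A B where AB: "openin ?Y A" "openin ?Y B" "A \<union> B = K" "disjnt A B" "x \<in> A" "K - U \<subseteq> B"
    unfolding separated_between_def top by blast
  have AU: "A \<subseteq> U" using AB unfolding disjnt_def by blast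
  have "openin X A"
  proof -
    obtain Q where Q: "openin X Q" "A = Q \<inter> K" using AB(1) by (auto simp: openin_subtopology)
    then have "A = Q \<inter> U" using AU UK(4) by blast
    then show ?thesis using Q UK(1) by blast
  qed
  moreover have "compactin X A"
  proof -
    have "A = topspace ?Y - B" using AB(3,4) top unfolding disjnt_def by blast
    then have "closedin ?Y A" using AB(2) by (simp only: closedin_diff closedin_topspace openin_closedin_eq)
    then have "compactin ?Y A" using closedin_compact_space[OF cY] by blast
    then show ?thesis by (simp add: compactin_subtopology)
  qed
  ultimately show ?thesis using AB(5) AU UK by blast
qed

lemma compactin_Diff_open:
  assumes "compactin X K" "openin X U" shows "compactin X (K - U)"
proof -
  have "K - U = (topspace X - U) \<inter> K"
    using compactin_subset_topspace[OF assms(1)] by blast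
  then show ?thesis
    using assms by (metis closed_Int_compactin closedin_diff closedin_topspace)
qed

lemma compactin_finite_subcover_pointwise:
  assumes "compactin X K" "\<And>x. x \<in> K \<Longrightarrow> \<exists>U. Q U \<and> openin X U \<and> x \<in> U"
  shows "\<exists>\<U>. finite \<U> \<and> (\<forall>U\<in>\<U>. Q U \<and> openin X U) \<and> K \<subseteq> \<Union>\<U>"
proof -
  have "\<exists>\<F>. finite \<F> \<and> \<F> \<subseteq> {U. Q U \<and> openin X U} \<and> K \<subseteq> \<Union>\<F>"
    using assms by (intro compactinD) auto
  then show ?thesis by blast
qed

section \<open>Groupoids\<close>

context topological_groupoid begin

abbreviation "\<T> \<equiv> arr_top G"
abbreviation "\<A> \<equiv> arrows G"
abbreviation "\<U> \<equiv> units G"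
abbreviation "s \<equiv> src G"
abbreviation "r \<equiv> rng G"
abbreviation "iv \<equiv> ginv G"
abbreviation comp (infixl "\<cdot>" 75) where "g \<cdot> h \<equiv> gcomp G g h"

lemma unit_arrow: "u \<in> \<U> \<Longrightarrow> u \<in> \<A>" and src_of_unit: "u \<in> \<U> \<Longrightarrow> s u = u"
  by (auto simp: units_def)

lemma topspace_arr: "topspace \<T> = \<A>" by (simp add: arrows_def)

lemma topspace_unit_space: "topspace (unit_space G) = \<U>"
  by (auto simp: unit_space_def units_def arrows_def)

lemma src_src: "g \<in> \<A> \<Longrightarrow> s (s g) = s g" and rng_src: "g \<in> \<A> \<Longrightarrow> r (s g) = s g"
  and src_rng: "g \<in> \<A> \<Longrightarrow> s (r g) = r g" and rng_rng: "g \<in> \<A> \<Longrightarrow> r (r g) = r g"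
  using src_unit rng_unit rng_of_unit src_of_unit by auto

lemma ginv_comp_cancel: "\<lbrakk>a \<in> \<A>; b \<in> \<A>; s a = r b\<rbrakk> \<Longrightarrow> iv a \<cdot> (a \<cdot> b) = b"
  using comp_assoc[of "iv a" a b] by (simp add: ginv_closed src_ginv ginv_comp comp_rng)

lemma comp_ginv_cancel: "\<lbrakk>a \<in> \<A>; b \<in> \<A>; r a = r b\<rbrakk> \<Longrightarrow> a \<cdot> (iv a \<cdot> b) = b"
  using comp_assoc[of a "iv a" b] by (simp add: ginv_closed src_ginv rng_ginv comp_ginv comp_rng)

lemma comp_comp_ginv: "\<lbrakk>a \<in> \<A>; b \<in> \<A>; s a = r b\<rbrakk> \<Longrightarrow> (a \<cdot> b) \<cdot> iv b = a"
  using comp_assoc[of a b "iv b"] comp_src[of a] by (simp add: ginv_closed rng_ginv comp_ginv)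

lemma comp_ginv_comp: "\<lbrakk>a \<in> \<A>; b \<in> \<A>; s a = s b\<rbrakk> \<Longrightarrow> (a \<cdot> iv b) \<cdot> b = a"
  using comp_assoc[of a "iv b" b] comp_src[of a] by (simp add: ginv_closed rng_ginv src_ginv ginv_comp)

lemma ginv_ginv: "g \<in> \<A> \<Longrightarrow> iv (iv g) = g"
  using comp_ginv_cancel[of "iv g" "s g"] comp_comp_ginv[of "iv (iv g)" "iv g"]
    comp_src[of g] comp_src[of "iv (iv g)"] comp_assoc[of "iv (iv g)" "iv g" g]
  by (simp add: ginv_closed rng_ginv src_ginv ginv_comp comp_rng)

lemma ginv_unit: "u \<in> \<U> \<Longrightarrow> iv u = u"
  using comp_src[of "iv u"] ginv_comp[of u] comp_assoc[of "iv u" u u]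
  by (metis comp_rng ginv_closed rng_ginv rng_of_unit src_of_unit unit_arrow src_ginv)

lemma eq_if_ginv_comp_unit:
  assumes "a \<in> \<A>" "b \<in> \<A>" "r a = r b" "iv a \<cdot> b \<in> \<U>"
  shows "a = b"
proof -
  have "iv a \<cdot> b = s (iv a \<cdot> b)" using assms(4) src_of_unit by simp
  also have "\<dots> = s b" using assms by (simp add: src_comp ginv_closed src_ginv)
  finally have 1: "iv a \<cdot> b = s b" .
  then have "s b = r (iv a \<cdot> b)" using assms by (metis rng_src)
  also have "\<dots> = s a" using assms by (simp add: rng_comp ginv_closed src_ginv rng_ginv)
  finally have "b = a \<cdot> s a" using comp_ginv_cancel[OF assms(1-3)] 1 by simp
  then show ?thesis using comp_src assms(1) by simp
qed

lemma eq_if_comp_ginv_unit: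
  assumes "a \<in> \<A>" "b \<in> \<A>" "s a = s b" "a \<cdot> iv b \<in> \<U>"
  shows "a = b"
proof -
  have "iv (iv a) \<cdot> iv b \<in> \<U>" using assms(1,4) by (simp add: ginv_ginv)
  then have "iv a = iv b"
    by (rule eq_if_ginv_comp_unit[rotated -1]) (use assms(1-3) in \<open>simp_all add: ginv_closed rng_ginv\<close>)
  then have "iv (iv a) = iv (iv b)" by (rule arg_cong)
  then show ?thesis using assms(1,2) by (simp add: ginv_ginv)
qed

lemma homeomorphic_ginv: "homeomorphic_map \<T> \<T> iv"
  unfolding homeomorphic_map_maps homeomorphic_maps_def
  using continuous_ginv by (intro exI[of _ iv]) (simp add: topspace_arr ginv_ginv)

end

section \<open>Compact open bisections\<close>

context ample_groupoid begin

lemma continuous_src: "continuous_map \<T> (unit_space G) s"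
  unfolding continuous_map_def
proof (intro conjI allI impI)
  show "s \<in> topspace \<T> \<rightarrow> topspace (unit_space G)"
    by (auto simp: topspace_arr topspace_unit_space src_unit)
  fix V assume V: "openin (unit_space G) V"
  show "openin \<T> {g \<in> topspace \<T>. s g \<in> V}"
  proof (subst openin_subopen, intro ballI)
    fix g assume g: "g \<in> {g \<in> topspace \<T>. s g \<in> V}"
    then obtain U where U: "openin \<T> U" "g \<in> U" "openin (unit_space G) (s ` U)"
      "homeomorphic_map (subtopology \<T> U) (subtopology (unit_space G) (s ` U)) s"
      using local_homeo_src unfolding local_homeomorphic_map_def by blast
    have "openin (subtopology \<T> U) {g \<in> topspace (subtopology \<T> U). s g \<in> V \<inter> s ` U}"
      by (rule openin_continuous_map_preimage[OF homeomorphic_imp_continuous_map[OF U(4)]])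
        (use V in \<open>auto simp: openin_subtopology\<close>)
    then have "openin \<T> {g \<in> topspace (subtopology \<T> U). s g \<in> V \<inter> s ` U}"
      using U(1) openin_trans_full by blast
    then show "\<exists>T. openin \<T> T \<and> g \<in> T \<and> T \<subseteq> {g \<in> topspace \<T>. s g \<in> V}"
      by (rule_tac exI, intro conjI, assumption) (use g U(2) in auto)
  qed
qed

lemma src_image_open:
  assumes W: "openin \<T> W" shows "openin (unit_space G) (s ` W)"
proof (subst openin_subopen, intro ballI)
  fix x assume "x \<in> s ` W"
  then obtain g where g: "g \<in> W" "x = s g" by blast
  then have "g \<in> topspace \<T>" using W openin_subset by blast
  then obtain U where U: "openin \<T> U" "g \<in> U" "openin (unit_space G) (s ` U)"
    "homeomorphic_map (subtopology \<T> U) (subtopology (unit_space G) (s ` U)) s"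
    using local_homeo_src unfolding local_homeomorphic_map_def by blast
  have "openin (subtopology \<T> U) (W \<inter> U)" using W by (auto simp: openin_subtopology)
  then have "openin (subtopology (unit_space G) (s ` U)) (s ` (W \<inter> U))"
    using homeomorphic_imp_open_map[OF U(4)] unfolding open_map_def by blast
  then have "openin (unit_space G) (s ` (W \<inter> U))" using U(3) openin_trans_full by blast
  then show "\<exists>T. openin (unit_space G) T \<and> x \<in> T \<and> T \<subseteq> s ` W"
    using g U(2) by (intro exI[of _ "s ` (W \<inter> U)"]) auto
qed

text \<open>Near a unit, an arrow and its source lie in one set on which the source map is injective. They have
  the same source, so the arrow equals its source and is a unit.\<close>

lemma open_units: "openin \<T> \<U>"
proof (subst openin_subopen, intro ballI)
  fix u assume u: "u \<in> \<U>"
  then have "u \<in> topspace \<T>" by (simp add: topspace_arr unit_arrow)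
  then obtain U where U: "openin \<T> U" "u \<in> U"
    "homeomorphic_map (subtopology \<T> U) (subtopology (unit_space G) (s ` U)) s"
    using local_homeo_src unfolding local_homeomorphic_map_def by blast
  have UA: "U \<subseteq> \<A>" using U(1) openin_subset topspace_arr by blast
  have inj: "inj_on s U"
    using homeomorphic_imp_injective_map[OF U(3)] UA by (simp add: topspace_arr Int_absorb1)
  have "openin (unit_space G) (U \<inter> \<U>)"
    unfolding unit_space_def using U(1) by (auto simp: openin_subtopology)
  from openin_continuous_map_preimage_gen[OF continuous_src U(1) this]
  have "openin \<T> {g \<in> U. s g \<in> U \<inter> \<U>}" .
  moreover have "{g \<in> U. s g \<in> U \<inter> \<U>} \<subseteq> \<U>"
  proof
    fix g assume g: "g \<in> {g \<in> U. s g \<in> U \<inter> \<U>}"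
    then have "s (s g) = s g" using UA src_src by blast
    then have "s g = g" using inj g by (auto dest: inj_onD)
    then show "g \<in> \<U>" using g by auto
  qed
  ultimately show "\<exists>T. openin \<T> T \<and> u \<in> T \<and> T \<subseteq> \<U>"
    using u U(2) src_of_unit by (intro exI[of _ "{g \<in> U. s g \<in> U \<inter> \<U>}"]) auto
qed

lemma openin_unit_space_iff: "openin (unit_space G) V \<longleftrightarrow> openin \<T> V \<and> V \<subseteq> \<U>"
  unfolding unit_space_def using openin_open_subtopology[OF open_units] by blast

lemma compactin_unit_space_iff: "compactin (unit_space G) V \<longleftrightarrow> compactin \<T> V \<and> V \<subseteq> \<U>"
  unfolding unit_space_def by (rule compactin_subtopology)

lemma compact_open_unit_space_iff:
  "compact_open (unit_space G) V \<longleftrightarrow> openin \<T> V \<and> compactin \<T> V \<and> V \<subseteq> \<U>"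
  unfolding compact_open_def openin_unit_space_iff compactin_unit_space_iff
  using Hausdorff_space_subtopology[OF Hausdorff_units] by blast

lemma continuous_rng: "continuous_map \<T> (unit_space G) r"
proof -
  have "continuous_map \<T> (unit_space G) (s \<circ> iv)"
    using continuous_ginv continuous_src by (rule continuous_map_compose)
  then show ?thesis
    by (rule continuous_map_eq) (simp add: topspace_arr src_ginv)
qed

lemma rng_image: "W \<subseteq> \<A> \<Longrightarrow> r ` W = s ` iv ` W"
  by (auto simp: image_image src_ginv subset_iff intro!: image_cong)

lemma ginv_image_open: "openin \<T> W \<Longrightarrow> openin \<T> (iv ` W)"
  using homeomorphic_imp_open_map[OF homeomorphic_ginv] by (simp add: open_map_def)

lemma rng_image_open: "openin \<T> W \<Longrightarrow> openin (unit_space G) (r ` W)"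
  using rng_image[of W] src_image_open[OF ginv_image_open] openin_subset[of \<T> W] topspace_arr by metis

text \<open>Source and range take values in a Hausdorff space, so arrows that cannot be separated have the same
  source and range. This gives the Hausdorff property of bisections and of principal subgroupoids.\<close>

lemma Hausdorff_if_inj:
  assumes "W \<subseteq> \<A>" "inj_on (\<lambda>g. (s g, r g)) W"
  shows "Hausdorff_space (subtopology \<T> W)"
proof (rule Hausdorff_space_injective_preimage)
  show "Hausdorff_space (prod_topology (unit_space G) (unit_space G))"
    using Hausdorff_units by (simp add: Hausdorff_space_prod_topology)
  show "continuous_map (subtopology \<T> W) (prod_topology (unit_space G) (unit_space G)) (\<lambda>g. (s g, r g))"
    using continuous_src continuous_rng
    by (intro continuous_map_from_subtopology) (simp add: continuous_map_paired)
qed (use assms in \<open>auto simp: topspace_arr Int_absorb1\<close>)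

text \<open>Openness and compactness are part of the notion here. These sets generate the ring, and the products,
  inverses, sources and ranges of them are again such sets.\<close>

definition bisection :: "'g set \<Rightarrow> bool" where
  "bisection B \<longleftrightarrow> openin \<T> B \<and> compactin \<T> B \<and> inj_on s B \<and> inj_on r B"

lemma bisectionD:
  assumes "bisection B"
  shows "openin \<T> B" "compactin \<T> B" "B \<subseteq> \<A>"
    and "\<lbrakk>a \<in> B; b \<in> B; s a = s b\<rbrakk> \<Longrightarrow> a = b" and "\<lbrakk>a \<in> B; b \<in> B; r a = r b\<rbrakk> \<Longrightarrow> a = b"
  using assms openin_subset[of \<T> B] by (auto simp: bisection_def topspace_arr dest: inj_onD)

lemma bisection_compact_open: "bisection B \<Longrightarrow> compact_open \<T> B"
proof -
  assume B: "bisection B"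
  have "inj_on (\<lambda>g. (s g, r g)) B"
    using bisectionD(4)[OF B] by (intro inj_onI) simp
  then show ?thesis
    using Hausdorff_if_inj[OF bisectionD(3)[OF B]] bisectionD(1,2)[OF B] by (simp add: compact_open_def)
qed

lemma bisection_subset: "\<lbrakk>bisection B; C \<subseteq> B; openin \<T> C; compactin \<T> C\<rbrakk> \<Longrightarrow> bisection C"
  unfolding bisection_def by (blast intro: inj_on_subset)

lemma bisection_units: "\<lbrakk>openin \<T> V; compactin \<T> V; V \<subseteq> \<U>\<rbrakk> \<Longrightarrow> bisection V"
  unfolding bisection_def by (metis (full_types) inj_onI rng_of_unit src_of_unit subsetD)

lemma bisection_src: "bisection B \<Longrightarrow> bisection (s ` B)"
  and bisection_rng: "bisection B \<Longrightarrow> bisection (r ` B)"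
proof -
  assume B: "bisection B"
  have "compactin (unit_space G) (s ` B)" "compactin (unit_space G) (r ` B)"
    using image_compactin bisectionD(2)[OF B] continuous_src continuous_rng by blast+
  moreover have "openin (unit_space G) (s ` B)" "openin (unit_space G) (r ` B)"
    using src_image_open rng_image_open bisectionD(1)[OF B] by blast+
  ultimately show "bisection (s ` B)" "bisection (r ` B)"
    by (simp_all add: bisection_units openin_unit_space_iff compactin_unit_space_iff)
qed

lemma src_subset: "W \<subseteq> \<A> \<Longrightarrow> s ` W \<subseteq> \<U>" and rng_subset: "W \<subseteq> \<A> \<Longrightarrow> r ` W \<subseteq> \<U>"
  using src_unit rng_unit by auto

lemma bisection_ginv: "bisection B \<Longrightarrow> bisection (iv ` B)"
proof -
  assume B: "bisection B"
  have "inj_on s (iv ` B)" "inj_on r (iv ` B)"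
    using bisectionD(3-5)[OF B] by (auto intro!: inj_onI simp: subset_iff src_ginv rng_ginv) metis+
  then show ?thesis
    using bisectionD(1,2)[OF B] ginv_image_open image_compactin[OF _ continuous_ginv]
    by (auto simp: bisection_def)
qed

text \<open>The range map is injective near \<open>g\<close> because the source map is injective near the inverse of \<open>g\<close>.\<close>

lemma exists_bisection:
  assumes W: "openin \<T> W" "g \<in> W"
  shows "\<exists>B. bisection B \<and> g \<in> B \<and> B \<subseteq> W"
proof -
  have gA: "g \<in> \<A>" using W openin_subset topspace_arr by blast
  then have "g \<in> topspace \<T>" "iv g \<in> topspace \<T>" by (simp_all add: topspace_arr ginv_closed)
  then obtain U U' where U: "openin \<T> U" "g \<in> U"
      "homeomorphic_map (subtopology \<T> U) (subtopology (unit_space G) (s ` U)) s"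
    and U': "openin \<T> U'" "iv g \<in> U'"
      "homeomorphic_map (subtopology \<T> U') (subtopology (unit_space G) (s ` U')) s"
    using local_homeo_src unfolding local_homeomorphic_map_def by meson
  have UA: "U \<subseteq> \<A>" "U' \<subseteq> \<A>" using U(1) U'(1) openin_subset topspace_arr by blast+
  have inj: "inj_on s U" "inj_on s U'"
    using homeomorphic_imp_injective_map[OF U(3)] homeomorphic_imp_injective_map[OF U'(3)] UA
    by (simp_all add: topspace_arr Int_absorb1)
  define W' where "W' = W \<inter> U \<inter> {g \<in> topspace \<T>. iv g \<in> U'}"
  have W': "openin \<T> W'" "g \<in> W'"
    unfolding W'_def using W U(1,2) U'(1,2) gA openin_continuous_map_preimage[OF continuous_ginv U'(1)]
    by (auto simp: topspace_arr)
  obtain V where V: "openin (unit_space G) V" "compactin (unit_space G) V" "s g \<in> V" "V \<subseteq> s ` W'"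
    using compact_open_neighbourhood[OF locally_compact_units Hausdorff_units totally_disconnected_units
        src_image_open[OF W'(1)]] W'(2) by blast
  define B where "B = {g \<in> W'. s g \<in> V}"
  have B: "openin \<T> B"
    unfolding B_def by (rule openin_continuous_map_preimage_gen[OF continuous_src W'(1) V(1)])
  have sB: "s ` B = V" using V(4) by (auto simp: B_def)
  have BU: "B \<subseteq> U" by (auto simp: B_def W'_def)
  have "compactin (subtopology (unit_space G) (s ` U)) (s ` B)"
    using V(2) BU by (auto simp: sB[symmetric] compactin_subtopology)
  then have "compactin (subtopology \<T> U) B"
    using homeomorphic_map_compactness[OF U(3), of B] BU UA by (auto simp: topspace_arr)
  then have "compactin \<T> B" by (simp add: compactin_subtopology)
  moreover have "inj_on r B"
  proof (rule inj_onI)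
    fix a b assume ab: "a \<in> B" "b \<in> B" "r a = r b"
    then have "a \<in> \<A>" "b \<in> \<A>" "iv a \<in> U'" "iv b \<in> U'" using BU UA by (auto simp: B_def W'_def)
    then show "a = b" using inj_onD[OF inj(2), of "iv a" "iv b"] ab(3) src_ginv ginv_ginv by metis
  qed
  ultimately have "bisection B"
    using B inj_on_subset[OF inj(1) BU] by (simp add: bisection_def)
  then show ?thesis using W' V(3) by (intro exI[of _ B]) (auto simp: B_def W'_def)
qed

definition arrow_products :: "'g set \<Rightarrow> 'g set \<Rightarrow> 'g set" where
  "arrow_products A B = {a \<cdot> b |a b. a \<in> A \<and> b \<in> B \<and> s a = r b}"

text \<open>Let \<open>g = a b\<close>. Multiplication is continuous at \<open>(g, b\<^sup>-\<^sup>1)\<close>, so \<open>k c\<^sup>-\<^sup>1\<close> stays in \<open>A\<close> for \<open>k\<close> near \<open>g\<close> and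
  \<open>c\<close> in \<open>B\<close> near \<open>b\<close> with the same source. Such a \<open>c\<close> exists for all \<open>k\<close> near \<open>g\<close> since the source map is
  open, and then \<open>k = (k c\<^sup>-\<^sup>1) c\<close>.\<close>

lemma arrow_products_open:
  assumes A: "openin \<T> A" and B: "openin \<T> B" shows "openin \<T> (arrow_products A B)"
proof (subst openin_subopen, intro ballI)
  have AA: "A \<subseteq> \<A>" "B \<subseteq> \<A>" using A B openin_subset topspace_arr by blast+
  fix g assume "g \<in> arrow_products A B"
  then obtain a b where ab: "a \<in> A" "b \<in> B" "s a = r b" "g = a \<cdot> b" by (auto simp: arrow_products_def)
  then have abA: "a \<in> \<A>" "b \<in> \<A>" and gA: "g \<in> \<A>" using AA comp_closed by auto
  let ?E = "{(g, h). s g = r h}"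
  let ?P = "subtopology (prod_topology \<T> \<T>) ?E"
  have "openin ?P {p \<in> topspace ?P. (case p of (g, h) \<Rightarrow> g \<cdot> h) \<in> A}"
    by (rule openin_continuous_map_preimage[OF continuous_comp A])
  then obtain Q where Q: "openin (prod_topology \<T> \<T>) Q"
    "{p \<in> topspace ?P. (case p of (g, h) \<Rightarrow> g \<cdot> h) \<in> A} = Q \<inter> ?E"
    unfolding openin_subtopology by blast
  have "(g, iv b) \<in> {p \<in> topspace ?P. (case p of (g, h) \<Rightarrow> g \<cdot> h) \<in> A}"
    using ab abA gA by (simp add: topspace_arr ginv_closed src_comp rng_ginv comp_comp_ginv)
  then have "(g, iv b) \<in> Q" using Q(2) by blast
  then obtain O1 O2 where O12: "openin \<T> O1" "openin \<T> O2" "g \<in> O1" "iv b \<in> O2" "O1 \<times> O2 \<subseteq> Q"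
    using Q(1)[unfolded openin_prod_topology_alt, rule_format, of g "iv b"] by blast
  define B' where "B' = {b \<in> B. iv b \<in> O2}"
  have B': "openin \<T> B'"
    unfolding B'_def by (rule openin_continuous_map_preimage_gen[OF continuous_ginv B O12(2)])
  define N where "N = {g \<in> O1. s g \<in> s ` B'}"
  have "openin \<T> N"
    unfolding N_def by (rule openin_continuous_map_preimage_gen[OF continuous_src O12(1) src_image_open[OF B']])
  moreover have "g \<in> N"
    using O12 ab abA by (auto simp: N_def B'_def src_comp)
  moreover have "N \<subseteq> arrow_products A B"
  proof
    fix k assume "k \<in> N"
    then obtain c where c: "k \<in> O1" "c \<in> B" "iv c \<in> O2" "s k = s c" by (auto simp: N_def B'_def)
    then have kc: "k \<in> \<A>" "c \<in> \<A>" using AA O12(1) openin_subset topspace_arr by blast+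
    have "(k, iv c) \<in> Q \<inter> ?E" using c kc O12(5) by (auto simp: rng_ginv)
    then have "k \<cdot> iv c \<in> A" using Q(2) by auto
    moreover have "k = (k \<cdot> iv c) \<cdot> c" "s (k \<cdot> iv c) = r c"
      using kc c by (simp_all add: comp_ginv_comp src_comp ginv_closed rng_ginv src_ginv)
    ultimately show "k \<in> arrow_products A B" using c by (auto simp: arrow_products_def)
  qed
  ultimately show "\<exists>T. openin \<T> T \<and> g \<in> T \<and> T \<subseteq> arrow_products A B" by blast
qed

text \<open>The composable pairs of \<open>A \<times> B\<close> form a closed subset, because the unit space is Hausdorff.\<close>

lemma arrow_products_compact:
  assumes A: "compactin \<T> A" and B: "compactin \<T> B" shows "compactin \<T> (arrow_products A B)"
proof -
  let ?E = "{(g, h). s g = r h}"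
  have AA: "A \<subseteq> \<A>" "B \<subseteq> \<A>" using A B compactin_subset_topspace topspace_arr by metis+
  have "closedin (prod_topology \<T> \<T>) {p \<in> topspace (prod_topology \<T> \<T>). (s \<circ> fst) p = (r \<circ> snd) p}"
    by (rule closedin_continuous_maps_eq[OF Hausdorff_units])
      (intro continuous_map_compose[OF continuous_map_fst continuous_src]
        continuous_map_compose[OF continuous_map_snd continuous_rng])+
  moreover have "compactin (prod_topology \<T> \<T>) (A \<times> B)" using A B by (simp add: compactin_Times)
  ultimately have "compactin (prod_topology \<T> \<T>)
      ({p \<in> topspace (prod_topology \<T> \<T>). (s \<circ> fst) p = (r \<circ> snd) p} \<inter> (A \<times> B))"
    by (rule closed_Int_compactin)
  moreover have "{p \<in> topspace (prod_topology \<T> \<T>). (s \<circ> fst) p = (r \<circ> snd) p} \<inter> (A \<times> B) = ?E \<inter> (A \<times> B)"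
    using AA by (auto simp: topspace_arr)
  ultimately have "compactin (subtopology (prod_topology \<T> \<T>) ?E) (?E \<inter> (A \<times> B))"
    by (simp add: compactin_subtopology)
  from image_compactin[OF this continuous_comp]
  have "compactin \<T> ((\<lambda>(g, h). g \<cdot> h) ` (?E \<inter> (A \<times> B)))" .
  moreover have "(\<lambda>(g, h). g \<cdot> h) ` (?E \<inter> (A \<times> B)) = arrow_products A B"
    by (force simp: arrow_products_def image_iff)
  ultimately show ?thesis by simp
qed

lemma bisection_arrow_products:
  assumes A: "bisection A" and B: "bisection B" shows "bisection (arrow_products A B)"
proof -
  note sub = bisectionD(3)[OF A] bisectionD(3)[OF B]
  have "inj_on s (arrow_products A B)"
  proof (rule inj_onI)
    fix g h assume "g \<in> arrow_products A B" "h \<in> arrow_products A B" and eq: "s g = s h"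
    then obtain a b c d where *: "a \<in> A" "b \<in> B" "s a = r b" "g = a \<cdot> b" "c \<in> A" "d \<in> B" "s c = r d" "h = c \<cdot> d"
      by (auto simp: arrow_products_def)
    then have "b = d" using eq sub bisectionD(4)[OF B, of b d] by (auto simp: src_comp subset_iff)
    then have "a = c" using * bisectionD(4)[OF A, of a c] by simp
    then show "g = h" using * \<open>b = d\<close> by simp
  qed
  moreover have "inj_on r (arrow_products A B)"
  proof (rule inj_onI)
    fix g h assume "g \<in> arrow_products A B" "h \<in> arrow_products A B" and eq: "r g = r h"
    then obtain a b c d where *: "a \<in> A" "b \<in> B" "s a = r b" "g = a \<cdot> b" "c \<in> A" "d \<in> B" "s c = r d" "h = c \<cdot> d"
      by (auto simp: arrow_products_def)
    then have "a = c" using eq sub bisectionD(5)[OF A, of a c] by (auto simp: rng_comp subset_iff)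
    then have "b = d" using * bisectionD(5)[OF B, of b d] by simp
    then show "g = h" using * \<open>a = c\<close> by simp
  qed
  ultimately show ?thesis
    using arrow_products_open arrow_products_compact A B by (auto simp: bisection_def)
qed

lemma arrow_products_assoc:
  assumes "A \<subseteq> \<A>" "B \<subseteq> \<A>" "C \<subseteq> \<A>"
  shows "arrow_products (arrow_products A B) C = arrow_products A (arrow_products B C)"
proof (intro equalityI subsetI)
  fix g assume "g \<in> arrow_products (arrow_products A B) C"
  then obtain a b c where *: "a \<in> A" "b \<in> B" "s a = r b" "c \<in> C" "s (a \<cdot> b) = r c" "g = (a \<cdot> b) \<cdot> c"
    by (auto simp: arrow_products_def)
  then have "a \<in> \<A>" "b \<in> \<A>" "c \<in> \<A>" using assms by auto
  with * have "s b = r c" "g = a \<cdot> (b \<cdot> c)" "s a = r (b \<cdot> c)"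
    by (auto simp: src_comp rng_comp comp_assoc)
  then show "g \<in> arrow_products A (arrow_products B C)" using * by (auto simp: arrow_products_def)
next
  fix g assume "g \<in> arrow_products A (arrow_products B C)"
  then obtain a b c where *: "a \<in> A" "b \<in> B" "s b = r c" "c \<in> C" "s a = r (b \<cdot> c)" "g = a \<cdot> (b \<cdot> c)"
    by (auto simp: arrow_products_def)
  then have "a \<in> \<A>" "b \<in> \<A>" "c \<in> \<A>" using assms by auto
  with * have "s a = r b" "g = (a \<cdot> b) \<cdot> c" "s (a \<cdot> b) = r c"
    by (auto simp: src_comp rng_comp comp_assoc)
  then show "g \<in> arrow_products (arrow_products A B) C" using * by (auto simp: arrow_products_def)
qed

end

section \<open>Additive spans of integer functions\<close>

lemma group_int_fun_group: "group (int_fun_group :: ('a \<Rightarrow> int) monoid)"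
  by (rule groupI) (auto simp: int_fun_group_def fun_eq_iff add.assoc intro: exI[of _ "\<lambda>x. - f x" for f])

lemma int_fun_group_simps [simp]:
  "carrier int_fun_group = UNIV" "f \<otimes>\<^bsub>int_fun_group\<^esub> h = (\<lambda>x. f x + h x)" "\<one>\<^bsub>int_fun_group\<^esub> = (\<lambda>_. 0)"
  by (simp_all add: int_fun_group_def)

lemma inv_int_fun_group [simp]: "inv\<^bsub>int_fun_group\<^esub> f = (\<lambda>x. - f x)"
  by (rule group.inv_equality[OF group_int_fun_group]) auto

lemma span_subgroup: "subgroup (generate int_fun_group S) (int_fun_group :: ('a \<Rightarrow> int) monoid)"
  by (rule group.generate_is_subgroup[OF group_int_fun_group]) simp

lemma span_zero: "(\<lambda>_. 0) \<in> generate int_fun_group S"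
  using generate.one[of int_fun_group S] by simp

lemma span_add: "\<lbrakk>f \<in> generate int_fun_group S; h \<in> generate int_fun_group S\<rbrakk>
    \<Longrightarrow> (\<lambda>x. f x + h x) \<in> generate int_fun_group S"
  using generate.eng[of f int_fun_group S h] by simp

lemma span_uminus: "f \<in> generate int_fun_group S \<Longrightarrow> (\<lambda>x. - f x) \<in> generate int_fun_group S"
  using subgroup.m_inv_closed[OF span_subgroup, of f S] by simp

lemma span_diff: "\<lbrakk>f \<in> generate int_fun_group S; h \<in> generate int_fun_group S\<rbrakk>
    \<Longrightarrow> (\<lambda>x. f x - h x) \<in> generate int_fun_group S"
  using span_add[of f S "\<lambda>x. - h x"] span_uminus[of h S] by simp

lemma span_induct [consumes 1, case_names zero gen diff]:
  assumes "f \<in> generate int_fun_group S"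
    and zero: "P (\<lambda>_. 0)" and gen: "\<And>f. f \<in> S \<Longrightarrow> P f"
    and diff: "\<And>f h. \<lbrakk>f \<in> generate int_fun_group S; h \<in> generate int_fun_group S; P f; P h\<rbrakk>
      \<Longrightarrow> P (\<lambda>x. f x - h x)"
  shows "P f"
proof -
  have zero': "(\<lambda>_. 0) \<in> generate int_fun_group S" by (rule span_zero)
  have minus: "P (\<lambda>x. - f x)" if "f \<in> generate int_fun_group S" "P f" for f
    using diff[OF zero' that(1) zero that(2)] by simp
  have "f \<in> generate int_fun_group S \<and> P f"
    using assms(1)
  proof induction
    case (incl h)
    then show ?case using gen generate.incl[of h S] by auto
  next
    case (inv h)
    then show ?case using minus[OF generate.incl gen] generate.inv[of h S int_fun_group] by simp
  next
    case (eng f h)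
    have "P (\<lambda>x. f x - (- h x))"
      using eng.IH minus[of h] span_uminus[of h S] by (intro diff) auto
    then show ?case using eng.IH span_add[of f S h] by simp
  qed (use zero zero' in auto)
  then show ?thesis ..
qed

lemma span_mono: "S \<subseteq> S' \<Longrightarrow> generate int_fun_group S \<subseteq> generate int_fun_group S'"
  by (rule group.mono_generate[OF group_int_fun_group])

section \<open>The groupoid ring\<close>

context ample_groupoid begin

abbreviation "ZG \<equiv> compact_open_functions \<T>"
abbreviation "ZU \<equiv> compact_open_functions (unit_space G)"

text \<open>The functions that live on \<open>H\<close>. They are described by generators instead of their support, since
  linear identities can then be checked on indicators of bisections.\<close>

definition bisection_span :: "'g set \<Rightarrow> ('g \<Rightarrow> int) set" where
  "bisection_span H = generate int_fun_group {indicator B |B. bisection B \<and> B \<subseteq> H}"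

lemma indicator_in_span: "\<lbrakk>bisection B; B \<subseteq> H\<rbrakk> \<Longrightarrow> indicator B \<in> bisection_span H"
  unfolding bisection_span_def by (rule generate.incl) blast

text \<open>A compact open set \<open>U\<close> is a finite union of bisections. In the Hausdorff space \<open>U\<close> compact sets are
  closed, so the union can be made disjoint by removing from each bisection the previous ones.\<close>

lemma indicator_compact_open_in_span:
  assumes U: "compact_open \<T> U" and "U \<subseteq> H" shows "indicator U \<in> bisection_span H"
proof -
  have "\<exists>\<B>. finite \<B> \<and> (\<forall>B\<in>\<B>. (bisection B \<and> B \<subseteq> U) \<and> openin \<T> B) \<and> U \<subseteq> \<Union>\<B>"
  proof (rule compactin_finite_subcover_pointwise)
    show "compactin \<T> U" using U by (simp add: compact_open_def)
    fix x assume "x \<in> U"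
    then obtain B where "bisection B" "x \<in> B" "B \<subseteq> U"
      using exists_bisection[of U x] U unfolding compact_open_def by metis
    then show "\<exists>B. (bisection B \<and> B \<subseteq> U) \<and> openin \<T> B \<and> x \<in> B" using bisectionD(1)[of B] by metis
  qed
  then obtain \<B> where "finite \<B>" "\<forall>B\<in>\<B>. (bisection B \<and> B \<subseteq> U) \<and> openin \<T> B" "U \<subseteq> \<Union>\<B>"
    by (elim exE conjE)
  then have \<B>: "finite \<B>" "\<forall>B\<in>\<B>. bisection B \<and> B \<subseteq> U" "U \<subseteq> \<Union>\<B>" by simp_all
  have "compactin \<T> (\<Union>\<B>) \<and> indicator (\<Union>\<B>) \<in> bisection_span H" using \<B>(1,2)
  proof (induction \<B>)
    case empty
    have "(indicator {} :: 'g \<Rightarrow> int) = (\<lambda>_. 0)" by auto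
    then show ?case using span_zero by (simp add: bisection_span_def)
  next
    case (insert B \<B>)
    let ?V = "\<Union>\<B>"
    have B: "bisection B" "B \<subseteq> U" and V: "compactin \<T> ?V" "?V \<subseteq> U" "indicator ?V \<in> bisection_span H"
      using insert by auto
    have "openin \<T> ?V" using insert.prems bisectionD(1) by blast
    then have "compactin \<T> (B - ?V)" using compactin_Diff_open bisectionD(2)[OF B(1)] by blast
    moreover have "openin \<T> (B - ?V)"
    proof -
      have "compactin (subtopology \<T> U) ?V" using V by (simp add: compactin_subtopology)
      then have "closedin (subtopology \<T> U) ?V"
        using U compactin_imp_closedin unfolding compact_open_def by blast
      moreover have "openin (subtopology \<T> U) B"
        using B bisectionD(1)[OF B(1)] openin_subtopology_Int2[of \<T> B U] by (metis inf.absorb2 inf_commute openin_subtopology_Int)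
      ultimately have "openin (subtopology \<T> U) (B - ?V)" by (rule openin_diff[rotated])
      then show ?thesis using U openin_trans_full unfolding compact_open_def by blast
    qed
    ultimately have "bisection (B - ?V)" using bisection_subset[OF B(1)] by blast
    then have "indicator (B - ?V) \<in> bisection_span H"
      using B(2) assms(2) by (intro indicator_in_span) auto
    then have "(\<lambda>x. indicator ?V x + indicator (B - ?V) x) \<in> bisection_span H"
      using V(3) unfolding bisection_span_def by (intro span_add)
    moreover have "(\<lambda>x. indicator ?V x + indicator (B - ?V) x :: int) = indicator (\<Union>(insert B \<B>))"
      by (auto simp: indicator_def fun_eq_iff)
    moreover have "compactin \<T> (\<Union>(insert B \<B>))"
      using V(1) bisectionD(2)[OF B(1)] by (simp add: compactin_Un)
    ultimately show ?case by simp
  qed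
  moreover have "\<Union>\<B> = U" using \<B> by blast
  ultimately show ?thesis by simp
qed

lemma ZG_eq_span: "ZG = bisection_span UNIV"
proof
  show "ZG \<subseteq> bisection_span UNIV"
    unfolding compact_open_functions_def
    using indicator_compact_open_in_span[of _ UNIV]
    by (intro group.generate_subgroup_incl[OF group_int_fun_group])
      (auto simp: bisection_span_def intro: span_subgroup)
  show "bisection_span UNIV \<subseteq> ZG"
    unfolding compact_open_functions_def bisection_span_def
    using bisection_compact_open by (intro span_mono) auto
qed

lemma span_subset_ZG: "bisection_span H \<subseteq> ZG"
  unfolding ZG_eq_span bisection_span_def by (intro span_mono) auto

lemma ZU_eq_span: "ZU = bisection_span \<U>"
  unfolding compact_open_functions_def bisection_span_def compact_open_unit_space_iff
  using bisection_units bisectionD(1,2) by (intro arg_cong[where f = "generate _"]) blast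

lemma ZU_subset_ZG: "ZU \<subseteq> ZG"
  unfolding ZU_eq_span by (rule span_subset_ZG)

lemma bisection_span_induct [consumes 1, case_names zero bisection diff]:
  assumes "f \<in> bisection_span H" "P (\<lambda>_. 0)" "\<And>B. \<lbrakk>bisection B; B \<subseteq> H\<rbrakk> \<Longrightarrow> P (indicator B)"
    "\<And>f h. \<lbrakk>f \<in> bisection_span H; h \<in> bisection_span H; P f; P h\<rbrakk> \<Longrightarrow> P (\<lambda>x. f x - h x)"
  shows "P f"
  using assms(1) unfolding bisection_span_def
proof (induction rule: span_induct)
  case (diff f h)
  then show ?case using assms(4) by (simp add: bisection_span_def)
qed (use assms in auto)

lemma ZG_induct [consumes 1, case_names zero bisection diff]:
  assumes "f \<in> ZG" "P (\<lambda>_. 0)" "\<And>B. bisection B \<Longrightarrow> P (indicator B)"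
    "\<And>f h. \<lbrakk>f \<in> ZG; h \<in> ZG; P f; P h\<rbrakk> \<Longrightarrow> P (\<lambda>x. f x - h x)"
  shows "P f"
  using assms(1) unfolding ZG_eq_span
  by (induction rule: bisection_span_induct) (use assms in \<open>auto simp: ZG_eq_span\<close>)

lemma span_closed:
  "(\<lambda>_. 0) \<in> bisection_span H"
  "\<lbrakk>f \<in> bisection_span H; h \<in> bisection_span H\<rbrakk> \<Longrightarrow> (\<lambda>x. f x + h x) \<in> bisection_span H"
  "\<lbrakk>f \<in> bisection_span H; h \<in> bisection_span H\<rbrakk> \<Longrightarrow> (\<lambda>x. f x - h x) \<in> bisection_span H"
  "f \<in> bisection_span H \<Longrightarrow> (\<lambda>x. - f x) \<in> bisection_span H"
  unfolding bisection_span_def by (auto intro: span_zero span_add span_diff span_uminus)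

lemmas ZG_closed = span_closed[where H = UNIV, folded ZG_eq_span]
lemmas ZU_closed = span_closed[where H = \<U>, folded ZU_eq_span]

lemma ZG_indicator: "bisection B \<Longrightarrow> indicator B \<in> ZG"
  unfolding ZG_eq_span by (rule indicator_in_span) auto

lemma ZG_support: "f \<in> ZG \<Longrightarrow> f a \<noteq> 0 \<Longrightarrow> a \<in> \<A>"
proof (induction rule: ZG_induct)
  case (bisection B)
  then show ?case using bisectionD(3) by (auto simp: indicator_def split: if_splits)
next
  case (diff f h)
  then show ?case by (cases "f a = 0") auto
qed auto

lemma ZG_outside: "f \<in> ZG \<Longrightarrow> a \<notin> \<A> \<Longrightarrow> f a = 0"
  using ZG_support by blast

lemma ZU_support: "f \<in> ZU \<Longrightarrow> f a \<noteq> 0 \<Longrightarrow> a \<in> \<U>"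
  unfolding ZU_eq_span
proof (induction rule: bisection_span_induct)
  case (diff f h)
  then show ?case by (cases "f a = 0") auto
qed (auto simp: indicator_def split: if_splits)

text \<open>A bisection meets each fibre in at most one arrow. The uniform bound on the range fibres is what
  makes the subgroupoids constructed later compact.\<close>

lemma fibre_finite_bounded:
  assumes "f \<in> ZG"
  shows "\<exists>K. \<forall>x. finite {a. r a = x \<and> f a \<noteq> 0} \<and> card {a. r a = x \<and> f a \<noteq> 0} \<le> K
    \<and> finite {a. s a = x \<and> f a \<noteq> 0}"
  using assms
proof (induction rule: ZG_induct)
  case zero
  then show ?case by simp
next
  case (bisection B)
  have *: "finite {a. t a = x \<and> (indicator B a :: int) \<noteq> 0} \<and> card {a. t a = x \<and> (indicator B a :: int) \<noteq> 0} \<le> 1"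
    if "inj_on t B" for t :: "'g \<Rightarrow> 'g" and x
  proof -
    obtain b where b: "{a. t a = x \<and> (indicator B a :: int) \<noteq> 0} \<subseteq> {b}"
    proof (cases "x \<in> t ` B")
      case True
      then obtain b where "b \<in> B" "t b = x" by blast
      then show ?thesis using inj_onD[OF \<open>inj_on t B\<close>] by (intro that[of b]) (auto simp: indicator_def split: if_splits)
    next
      case False
      then show ?thesis by (intro that[of x]) (auto simp: indicator_def split: if_splits)
    qed
    show ?thesis using finite_subset[OF b] card_mono[OF _ b] by simp
  qed
  have "inj_on r B" "inj_on s B" using bisection by (auto simp: bisection_def)
  then show ?case using * by blast
next
  case (diff f h)
  then obtain K L where
    K: "\<And>x. finite {a. r a = x \<and> f a \<noteq> 0}" "\<And>x. card {a. r a = x \<and> f a \<noteq> 0} \<le> K" "\<And>x. finite {a. s a = x \<and> f a \<noteq> 0}" and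
    L: "\<And>x. finite {a. r a = x \<and> h a \<noteq> 0}" "\<And>x. card {a. r a = x \<and> h a \<noteq> 0} \<le> L" "\<And>x. finite {a. s a = x \<and> h a \<noteq> 0}"
    by blast
  have sub: "{a. t a = x \<and> f a - h a \<noteq> 0} \<subseteq> {a. t a = x \<and> f a \<noteq> 0} \<union> {a. t a = x \<and> h a \<noteq> 0}" for t :: "'g \<Rightarrow> 'g" and x
    by auto
  have "card {a. r a = x \<and> f a - h a \<noteq> 0} \<le> K + L" for x
  proof -
    have "card {a. r a = x \<and> f a - h a \<noteq> 0} \<le> card ({a. r a = x \<and> f a \<noteq> 0} \<union> {a. r a = x \<and> h a \<noteq> 0})"
      using K L sub by (intro card_mono) auto
    also have "\<dots> \<le> card {a. r a = x \<and> f a \<noteq> 0} + card {a. r a = x \<and> h a \<noteq> 0}" by (rule card_Un_le)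
    also have "\<dots> \<le> K + L" using K L by (intro add_mono)
    finally show ?thesis .
  qed
  then show ?case
    using K L finite_subset[OF sub[of r]] finite_subset[OF sub[of s]] by (intro exI[of _ "K + L"]) blast
qed

lemma finite_rng_fibre: "f \<in> ZG \<Longrightarrow> finite {a. r a = x \<and> f a \<noteq> 0}"
  and finite_src_fibre: "f \<in> ZG \<Longrightarrow> finite {a. s a = x \<and> f a \<noteq> 0}"
  using fibre_finite_bounded[of f] by blast+

abbreviation conv (infixl "\<star>" 70) where "f \<star> h \<equiv> convolution G f h"

lemma conv_outside: "g \<notin> \<A> \<Longrightarrow> (f \<star> h) g = 0"
  by (simp add: convolution_def)

lemma conv_sum:
  assumes "g \<in> \<A>" "finite S" "\<And>a. a \<in> S \<Longrightarrow> a \<in> \<A> \<and> r a = r g"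
    and "\<And>a. \<lbrakk>a \<in> \<A>; r a = r g; f a \<noteq> 0\<rbrakk> \<Longrightarrow> a \<in> S"
  shows "(f \<star> h) g = (\<Sum>a\<in>S. f a * h (iv a \<cdot> g))"
proof -
  have "(\<Sum>a | a \<in> \<A> \<and> r a = r g \<and> f a \<noteq> 0. f a * h (iv a \<cdot> g)) = (\<Sum>a\<in>S. f a * h (iv a \<cdot> g))"
    by (rule sum.mono_neutral_left[OF assms(2)]) (use assms(3,4) in blast, use assms(3) in fastforce)
  then show ?thesis using assms(1) by (simp add: convolution_def)
qed

lemma conv_diff_left:
  assumes "f \<in> ZG" "f' \<in> ZG"
  shows "((\<lambda>x. f x - f' x) \<star> h) = (\<lambda>g. (f \<star> h) g - (f' \<star> h) g)"
proof
  fix g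
  show "((\<lambda>x. f x - f' x) \<star> h) g = (f \<star> h) g - (f' \<star> h) g"
  proof (cases "g \<in> \<A>")
    case True
    let ?S = "{a. r a = r g \<and> f a \<noteq> 0} \<union> {a. r a = r g \<and> f' a \<noteq> 0}"
    have fin: "finite ?S" using assms finite_rng_fibre by simp
    have S: "a \<in> \<A> \<and> r a = r g" if "a \<in> ?S" for a using that assms ZG_support by blast
    have "((\<lambda>x. f x - f' x) \<star> h) g = (\<Sum>a\<in>?S. (f a - f' a) * h (iv a \<cdot> g))"
      "(f \<star> h) g = (\<Sum>a\<in>?S. f a * h (iv a \<cdot> g))" "(f' \<star> h) g = (\<Sum>a\<in>?S. f' a * h (iv a \<cdot> g))"
      by (rule conv_sum[OF True fin S]; auto)+
    then show ?thesis by (simp add: left_diff_distrib sum_subtractf)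
  qed (simp add: conv_outside)
qed

lemma conv_diff_right: "(f \<star> (\<lambda>x. h x - h' x)) = (\<lambda>g. (f \<star> h) g - (f \<star> h') g)"
  by (auto simp: convolution_def fun_eq_iff right_diff_distrib sum_subtractf)

lemma conv_add_right: "(f \<star> (\<lambda>x. h x + h' x)) = (\<lambda>g. (f \<star> h) g + (f \<star> h') g)"
  by (auto simp: convolution_def fun_eq_iff distrib_left sum.distrib)

lemma conv_zero_left [simp]: "((\<lambda>_. 0) \<star> h) = (\<lambda>_. 0)" and conv_zero_right [simp]: "(f \<star> (\<lambda>_. 0)) = (\<lambda>_. 0)"
  by (auto simp: convolution_def fun_eq_iff)

lemma conv_add_left:
  assumes "f \<in> ZG" "f' \<in> ZG"
  shows "((\<lambda>x. f x + f' x) \<star> h) = (\<lambda>g. (f \<star> h) g + (f' \<star> h) g)"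
proof -
  have "((\<lambda>x. f x - (0 - f' x)) \<star> h) = (\<lambda>g. (f \<star> h) g - ((\<lambda>_. 0) \<star> h) g + (f' \<star> h) g)"
    using conv_diff_left[OF assms(1), of "\<lambda>x. 0 - f' x" h] conv_diff_left[of "\<lambda>_. 0" f' h] assms ZG_closed
    by (simp add: fun_eq_iff)
  then show ?thesis by simp
qed

text \<open>Right multiplication by the indicator of a bisection is right translation of functions. All
  computations in the ring are based on this formula.\<close>

lemma conv_indicator:
  assumes f: "f \<in> ZG" and C: "bisection C" and c: "c \<in> C" and g: "g \<in> \<A>" "s g = s c"
  shows "(f \<star> indicator C) g = f (g \<cdot> iv c)"
proof -
  have cA: "c \<in> \<A>" using C c bisectionD(3) by blast
  let ?S = "{a. r a = r g \<and> f a \<noteq> 0}"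
  have p: "g \<cdot> iv c \<in> \<A>" "r (g \<cdot> iv c) = r g"
    using g cA by (simp_all add: comp_closed rng_comp ginv_closed rng_ginv)
  have mem: "iv a \<cdot> g \<in> C \<longleftrightarrow> a = g \<cdot> iv c" if a: "a \<in> \<A>" "r a = r g" for a
  proof
    assume "iv a \<cdot> g \<in> C"
    moreover have "s (iv a \<cdot> g) = s c" using a g by (simp add: src_comp ginv_closed src_ginv)
    ultimately have eq: "iv a \<cdot> g = c" using bisectionD(4)[OF C _ c] by blast
    have "a \<cdot> c = g" using comp_ginv_cancel[OF a(1) g(1) a(2)] eq by simp
    moreover have "s a = r c" using a g unfolding eq[symmetric] by (simp add: rng_comp ginv_closed src_ginv rng_ginv)
    ultimately show "a = g \<cdot> iv c" using comp_comp_ginv[OF a(1) cA] by simp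
  next
    assume a': "a = g \<cdot> iv c"
    have "a \<cdot> c = g" unfolding a' by (rule comp_ginv_comp[OF g(1) cA g(2)])
    moreover have "s a = r c" unfolding a' using g cA by (simp add: src_comp ginv_closed rng_ginv src_ginv)
    ultimately have "iv a \<cdot> g = c" using ginv_comp_cancel[OF a(1) cA] by simp
    then show "iv a \<cdot> g \<in> C" using c by simp
  qed
  have S: "a \<in> \<A> \<and> r a = r g" if "a \<in> insert (g \<cdot> iv c) ?S" for a using that f ZG_support p by blast
  have fin: "finite (insert (g \<cdot> iv c) ?S)" using finite_rng_fibre[OF f] by simp
  have "(f \<star> indicator C) g = (\<Sum>a\<in>insert (g \<cdot> iv c) ?S. f a * indicator C (iv a \<cdot> g))"
    by (rule conv_sum[OF g(1) fin S]) auto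
  also have "\<dots> = (\<Sum>a\<in>insert (g \<cdot> iv c) ?S. if a = g \<cdot> iv c then f a else 0)"
  proof (rule sum.cong[OF refl])
    fix a assume "a \<in> insert (g \<cdot> iv c) ?S"
    then have "iv a \<cdot> g \<in> C \<longleftrightarrow> a = g \<cdot> iv c" using mem S by blast
    then show "f a * indicator C (iv a \<cdot> g) = (if a = g \<cdot> iv c then f a else 0)"
      by (simp add: indicator_def)
  qed
  also have "\<dots> = f (g \<cdot> iv c)" using fin by simp
  finally show ?thesis .
qed

lemma conv_indicator_zero:
  assumes g: "s g \<notin> s ` C"
  shows "(f \<star> indicator C) g = 0"
proof -
  have "iv a \<cdot> g \<notin> C" if "a \<in> \<A>" "r a = r g" "g \<in> \<A>" for a
  proof
    assume "iv a \<cdot> g \<in> C"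
    moreover have "s (iv a \<cdot> g) = s g" using that by (simp add: src_comp ginv_closed src_ginv)
    ultimately show False using g by (metis imageI)
  qed
  then show ?thesis by (auto simp: convolution_def)
qed

lemma conv_indicators:
  assumes B: "bisection B" and C: "bisection C"
  shows "(indicator B \<star> indicator C) = indicator (arrow_products B C)"
proof
  fix g
  have sub: "arrow_products B C \<subseteq> \<A>" using bisectionD(3)[OF bisection_arrow_products[OF B C]] .
  show "(indicator B \<star> indicator C) g = indicator (arrow_products B C) g"
  proof (cases "g \<in> \<A> \<and> s g \<in> s ` C")
    case True
    then obtain c where c: "c \<in> C" "s g = s c" by auto
    have cA: "c \<in> \<A>" using C c bisectionD(3) by blast
    have "g \<cdot> iv c \<in> B \<longleftrightarrow> g \<in> arrow_products B C"
    proof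
      assume "g \<cdot> iv c \<in> B"
      moreover have "g = (g \<cdot> iv c) \<cdot> c" "s (g \<cdot> iv c) = r c"
        using True c cA by (simp_all add: comp_ginv_comp src_comp ginv_closed rng_ginv src_ginv)
      ultimately show "g \<in> arrow_products B C" using c by (auto simp: arrow_products_def)
    next
      assume "g \<in> arrow_products B C"
      then obtain b d where bd: "b \<in> B" "d \<in> C" "s b = r d" "g = b \<cdot> d" by (auto simp: arrow_products_def)
      then have A: "b \<in> \<A>" "d \<in> \<A>" using B C bisectionD(3) by blast+
      then have "d = c" using bisectionD(4)[OF C bd(2) c(1)] c(2) bd by (simp add: src_comp)
      then show "g \<cdot> iv c \<in> B" using bd A by (simp add: comp_comp_ginv)
    qed
    then show ?thesis
      using conv_indicator[OF ZG_indicator[OF B] C c(1) _ c(2)] True by (simp add: indicator_def)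
  next
    case False
    have "g \<notin> arrow_products B C"
    proof
      assume "g \<in> arrow_products B C"
      then obtain b d where bd: "b \<in> B" "d \<in> C" "s b = r d" "g = b \<cdot> d" by (auto simp: arrow_products_def)
      then have "b \<in> \<A>" "d \<in> \<A>" using B C bisectionD(3) by blast+
      then show False using False bd by (auto simp: src_comp comp_closed)
    qed
    then show ?thesis using False conv_indicator_zero[of g C] conv_outside[of g] by auto
  qed
qed

lemma conv_closed:
  assumes "f \<in> ZG" "h \<in> ZG" shows "f \<star> h \<in> ZG"
  using assms(1)
proof (induction rule: ZG_induct)
  case (bisection B)
  show ?case using assms(2)
  proof (induction rule: ZG_induct)
    case (bisection C)
    then show ?case using \<open>bisection B\<close> by (simp add: conv_indicators ZG_indicator bisection_arrow_products)
  qed (simp_all add: conv_diff_right ZG_closed)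
qed (simp_all add: conv_diff_left ZG_closed)

text \<open>By additivity in each argument this reduces to the associativity of products of bisections.\<close>

lemma conv_assoc:
  assumes "f \<in> ZG" "h \<in> ZG" "k \<in> ZG"
  shows "(f \<star> h) \<star> k = f \<star> (h \<star> k)"
  using assms(1)
proof (induction rule: ZG_induct)
  case (bisection B)
  note B = this
  show ?case using assms(2)
  proof (induction rule: ZG_induct)
    case (bisection C)
    note C = this
    show ?case using assms(3)
    proof (induction rule: ZG_induct)
      case (bisection D)
      then show ?case
        using B C arrow_products_assoc[of B C D] bisectionD(3)
        by (simp add: conv_indicators bisection_arrow_products)
    qed (simp_all add: conv_diff_right)
  next
    case (diff h h')
    then show ?case using B by (simp add: conv_diff_left conv_diff_right conv_closed ZG_indicator)
  qed simp
next
  case (diff f f')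
  then show ?case using assms by (simp add: conv_diff_left conv_closed)
qed simp

lemma conv_units_left:
  assumes "\<And>a. n a \<noteq> 0 \<Longrightarrow> a \<in> \<U>" "g \<in> \<A>"
  shows "(n \<star> f) g = n (r g) * f g"
proof -
  have "(n \<star> f) g = (\<Sum>a\<in>{r g}. n a * f (iv a \<cdot> g))"
    by (rule conv_sum) (use assms rng_rng rng_unit unit_arrow rng_of_unit in auto)
  then show ?thesis using assms(2) by (simp add: ginv_unit rng_unit comp_rng)
qed

text \<open>The indicator of a set of units that contains the ranges of the support of \<open>f\<close> is a left unit for \<open>f\<close>.\<close>

lemma rng_support_cover:
  assumes "f \<in> ZG"
  shows "\<exists>V. openin \<T> V \<and> compactin \<T> V \<and> V \<subseteq> \<U> \<and> (\<forall>a. f a \<noteq> 0 \<longrightarrow> r a \<in> V)"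
  using assms
proof (induction rule: ZG_induct)
  case zero
  then show ?case by (intro exI[of _ "{}"]) auto
next
  case (bisection B)
  then show ?case
    using bisection_rng[OF bisection] bisectionD(1,2) rng_subset[OF bisectionD(3)]
    by (intro exI[of _ "r ` B"]) (auto simp: indicator_def split: if_splits)
next
  case (diff f h)
  then obtain V W where
    "openin \<T> V" "compactin \<T> V" "V \<subseteq> \<U>" "\<And>a. f a \<noteq> 0 \<Longrightarrow> r a \<in> V"
    "openin \<T> W" "compactin \<T> W" "W \<subseteq> \<U>" "\<And>a. h a \<noteq> 0 \<Longrightarrow> r a \<in> W" by blast
  then show ?case
    by (intro exI[of _ "V \<union> W"]) (auto intro: compactin_Un, metis)
qed

lemma local_unit:
  assumes "finite S" "S \<subseteq> ZG"
  shows "\<exists>V. openin \<T> V \<and> compactin \<T> V \<and> V \<subseteq> \<U> \<and> (\<forall>f\<in>S. \<forall>a. f a \<noteq> 0 \<longrightarrow> r a \<in> V)"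
  using assms
proof (induction S)
  case empty
  then show ?case by (intro exI[of _ "{}"]) auto
next
  case (insert f S)
  then obtain V where V: "openin \<T> V" "compactin \<T> V" "V \<subseteq> \<U>" "\<forall>f\<in>S. \<forall>a. f a \<noteq> 0 \<longrightarrow> r a \<in> V" by auto
  obtain W where "openin \<T> W" "compactin \<T> W" "W \<subseteq> \<U>" "\<forall>a. f a \<noteq> 0 \<longrightarrow> r a \<in> W"
    using rng_support_cover insert.prems by blast
  with V show ?case
    by (intro exI[of _ "V \<union> W"]) (auto intro: compactin_Un)
qed

lemma conv_local_unit:
  assumes f: "f \<in> ZG" and V: "V \<subseteq> \<U>" "\<And>a. f a \<noteq> 0 \<Longrightarrow> r a \<in> V"
  shows "indicator V \<star> f = f"
proof
  fix g
  show "(indicator V \<star> f) g = f g"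
  proof (cases "g \<in> \<A>")
    case True
    have "(indicator V \<star> f) g = indicator V (r g) * f g"
      by (rule conv_units_left) (use V True in \<open>auto simp: indicator_def split: if_splits\<close>)
    then show ?thesis using V(2)[of g] by (auto simp: indicator_def)
  qed (use f ZG_outside in \<open>auto simp: conv_outside\<close>)
qed

lemma ring_simps:
  "carrier (groupoid_ring G) = ZG" "f \<otimes>\<^bsub>groupoid_ring G\<^esub> h = f \<star> h"
  "f \<oplus>\<^bsub>groupoid_ring G\<^esub> h = (\<lambda>x. f x + h x)" "\<zero>\<^bsub>groupoid_ring G\<^esub> = (\<lambda>_. 0)"
  by (simp_all add: groupoid_ring_def)

lemma local_unit_ring_groupoid_ring: "local_unit_ring (groupoid_ring G)"
proof (intro local_unit_ring.intro local_unit_ring_axioms.intro)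
  show "abelian_group (groupoid_ring G)"
  proof (rule abelian_groupI)
    fix f assume "f \<in> carrier (groupoid_ring G)"
    then show "\<exists>h\<in>carrier (groupoid_ring G). h \<oplus>\<^bsub>groupoid_ring G\<^esub> f = \<zero>\<^bsub>groupoid_ring G\<^esub>"
      by (intro bexI[of _ "\<lambda>x. - f x"]) (auto simp: ring_simps ZG_closed)
  qed (auto simp: ring_simps ZG_closed add.assoc add.commute)
  fix S assume "finite S" "S \<subseteq> carrier (groupoid_ring G)"
  then have "\<exists>V. openin \<T> V \<and> compactin \<T> V \<and> V \<subseteq> \<U> \<and> (\<forall>f\<in>S. \<forall>a. f a \<noteq> 0 \<longrightarrow> r a \<in> V)"
    by (intro local_unit) (simp_all add: ring_simps)
  then obtain V where V: "openin \<T> V" "compactin \<T> V" "V \<subseteq> \<U>" "\<forall>f\<in>S. \<forall>a. f a \<noteq> 0 \<longrightarrow> r a \<in> V"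
    by (elim exE conjE)
  have B: "bisection V" by (rule bisection_units[OF V(1-3)])
  have "indicator V \<star> f = f" if "f \<in> insert (indicator V) S" for f
  proof (rule conv_local_unit)
    show "f \<in> ZG" using that ZG_indicator[OF B] \<open>S \<subseteq> carrier (groupoid_ring G)\<close> by (auto simp: ring_simps)
    show "\<And>a. f a \<noteq> 0 \<Longrightarrow> r a \<in> V"
      using that V rng_of_unit by (auto simp: indicator_def subset_iff split: if_splits)
  qed (use V in auto)
  then show "\<exists>e\<in>carrier (groupoid_ring G). e \<otimes>\<^bsub>groupoid_ring G\<^esub> e = e \<and> (\<forall>a\<in>S. e \<otimes>\<^bsub>groupoid_ring G\<^esub> a = a)"
    using ZG_indicator[OF B] by (intro bexI[of _ "indicator V"]) (auto simp: ring_simps)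
qed (auto simp: ring_simps conv_closed conv_assoc conv_add_left conv_add_right)

section \<open>The trivial right module\<close>

text \<open>The analogue of the augmentation map of a group ring: the trivial right action of \<open>f\<close> on \<open>n\<close> is the augmentation of \<open>n \<star> f\<close>.\<close>

definition augmentation :: "('g \<Rightarrow> int) \<Rightarrow> 'g \<Rightarrow> int" where
  "augmentation f x = (if x \<in> \<U> then \<Sum>g | s g = x \<and> f g \<noteq> 0. f g else 0)"

lemma augmentation_sum:
  assumes "x \<in> \<U>" "finite S" "\<And>a. \<lbrakk>s a = x; f a \<noteq> 0\<rbrakk> \<Longrightarrow> a \<in> S" "\<And>a. a \<in> S \<Longrightarrow> s a = x"
  shows "augmentation f x = sum f S"
proof -
  have "(\<Sum>g | s g = x \<and> f g \<noteq> 0. f g) = sum f S"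
    by (rule sum.mono_neutral_left[OF assms(2)]) (use assms(3) in blast, use assms(4) in fastforce)
  then show ?thesis using assms(1) by (simp add: augmentation_def)
qed

lemma augmentation_diff:
  assumes "f \<in> ZG" "h \<in> ZG"
  shows "augmentation (\<lambda>x. f x - h x) = (\<lambda>x. augmentation f x - augmentation h x)"
proof
  fix x
  show "augmentation (\<lambda>x. f x - h x) x = augmentation f x - augmentation h x"
  proof (cases "x \<in> \<U>")
    case True
    let ?S = "{a. s a = x \<and> f a \<noteq> 0} \<union> {a. s a = x \<and> h a \<noteq> 0}"
    have fin: "finite ?S" using assms finite_src_fibre by simp
    have "augmentation (\<lambda>x. f x - h x) x = (\<Sum>a\<in>?S. f a - h a)"
      "augmentation f x = sum f ?S" "augmentation h x = sum h ?S"
      by (rule augmentation_sum[OF True fin]; auto)+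
    then show ?thesis by (simp add: sum_subtractf)
  qed (simp add: augmentation_def)
qed

lemma augmentation_zero [simp]: "augmentation (\<lambda>_. 0) = (\<lambda>_. 0)"
  by (auto simp: augmentation_def)

lemma augmentation_add:
  assumes "f \<in> ZG" "h \<in> ZG"
  shows "augmentation (\<lambda>x. f x + h x) = (\<lambda>x. augmentation f x + augmentation h x)"
  using augmentation_diff[OF assms(1), of "\<lambda>x. 0 - h x"] augmentation_diff[of "\<lambda>_. 0" h] assms ZG_closed
  by (simp add: fun_eq_iff)

lemma augmentation_indicator_inj:
  assumes "S \<subseteq> \<A>" "inj_on s S" shows "augmentation (indicator S) = indicator (s ` S)"
proof
  fix x
  show "augmentation (indicator S) x = indicator (s ` S) x"
  proof (cases "x \<in> s ` S")
    case True
    then obtain b where b: "b \<in> S" "x = s b" by auto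
    then have "x \<in> \<U>" using assms(1) src_unit by auto
    then have "augmentation (indicator S) x = sum (indicator S) {b}"
      by (rule augmentation_sum) (use b inj_onD[OF assms(2)] in \<open>auto simp: indicator_def split: if_splits\<close>)
    then show ?thesis using b True by simp
  next
    case False
    then have "{g. s g = x \<and> (indicator S g :: int) \<noteq> 0} = {}" by (auto simp: indicator_def split: if_splits)
    then show ?thesis using False by (simp add: augmentation_def)
  qed
qed

lemma augmentation_indicator: "bisection B \<Longrightarrow> augmentation (indicator B) = indicator (s ` B)"
  by (rule augmentation_indicator_inj[OF bisectionD(3)]) (simp_all add: bisection_def)

lemma augmentation_closed: "f \<in> ZG \<Longrightarrow> augmentation f \<in> ZU"
proof (induction rule: ZG_induct)
  case (bisection B)
  then show ?case
    unfolding ZU_eq_span using src_subset[OF bisectionD(3)]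
    by (simp add: augmentation_indicator bisection_src indicator_in_span)
qed (simp_all add: ZU_closed augmentation_diff)

text \<open>The augmentation is right linear; this is the associativity of the trivial action.\<close>

lemma augmentation_augmentation_conv:
  assumes "f \<in> ZG" "h \<in> ZG"
  shows "augmentation (augmentation f \<star> h) = augmentation (f \<star> h)"
proof -
  have aug: "augmentation f \<in> ZG" if "f \<in> ZG" for f using that augmentation_closed ZU_subset_ZG by blast
  show ?thesis using assms(1)
  proof (induction rule: ZG_induct)
    case (bisection C)
    note C = this
    show ?case using assms(2)
    proof (induction rule: ZG_induct)
      case (bisection B)
      have sub: "C \<subseteq> \<A>" "B \<subseteq> \<A>" using C bisection bisectionD(3) by auto
      have "s ` arrow_products (s ` C) B = s ` arrow_products C B"
      proof (intro equalityI subsetI)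
        fix x assume "x \<in> s ` arrow_products (s ` C) B"
        then obtain c b where "c \<in> C" "b \<in> B" "s (s c) = r b" "x = s (s c \<cdot> b)" by (auto simp: arrow_products_def)
        moreover from this have A: "c \<in> \<A>" "b \<in> \<A>" using sub by auto
        ultimately have "s c = r b" "x = s b" by (simp_all add: src_src comp_rng)
        then have "c \<cdot> b \<in> arrow_products C B" "x = s (c \<cdot> b)"
          using A \<open>c \<in> C\<close> \<open>b \<in> B\<close> by (auto simp: arrow_products_def src_comp)
        then show "x \<in> s ` arrow_products C B" by blast
      next
        fix x assume "x \<in> s ` arrow_products C B"
        then obtain c b where "c \<in> C" "b \<in> B" "s c = r b" "x = s (c \<cdot> b)" by (auto simp: arrow_products_def)
        moreover from this have A: "c \<in> \<A>" "b \<in> \<A>" using sub by auto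
        ultimately have "s (s c) = r b" "x = s (s c \<cdot> b)" by (simp_all add: src_src src_comp comp_rng src_rng)
        then have "s c \<cdot> b \<in> arrow_products (s ` C) B" "x = s (s c \<cdot> b)"
          using \<open>c \<in> C\<close> \<open>b \<in> B\<close> unfolding arrow_products_def by blast+
        then show "x \<in> s ` arrow_products (s ` C) B" by blast
      qed
      then show ?case
        using C bisection by (simp add: conv_indicators augmentation_indicator bisection_src bisection_arrow_products)
    next
      case (diff h h')
      then show ?case using C aug by (simp add: conv_diff_right augmentation_diff conv_closed ZG_indicator)
    qed simp
  next
    case (diff f f')
    then show ?case using assms aug by (simp add: augmentation_diff conv_diff_left conv_closed)
  qed simp
qed

lemma trivial_action_eq:
  assumes n: "n \<in> ZU" and f: "f \<in> ZG"
  shows "trivial_action G f n = augmentation (n \<star> f)"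
proof
  fix x
  show "trivial_action G f n x = augmentation (n \<star> f) x"
  proof (cases "x \<in> \<U>")
    case True
    let ?S = "{a \<in> \<A>. s a = x \<and> f a \<noteq> 0}"
    have fin: "finite ?S" by (rule finite_subset[OF _ finite_src_fibre[OF f, of x]]) auto
    have nf: "(n \<star> f) g = n (r g) * f g" if "g \<in> \<A>" for g
      using conv_units_left[of n g f] ZU_support[OF n] that by blast
    have "augmentation (n \<star> f) x = sum (n \<star> f) ?S"
    proof (rule augmentation_sum[OF True fin])
      fix a assume a: "s a = x" "(n \<star> f) a \<noteq> 0"
      then have "a \<in> \<A>" using conv_outside by blast
      then show "a \<in> ?S" using a nf by auto
    qed auto
    also have "\<dots> = (\<Sum>a\<in>?S. n (r a) * f a)" by (rule sum.cong) (auto simp: nf)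
    finally show ?thesis using True by (simp add: trivial_action_def)
  qed (simp add: trivial_action_def augmentation_def)
qed

lemma module_simps:
  "carrier (trivial_right_module G) = ZU" "f \<odot>\<^bsub>trivial_right_module G\<^esub> n = trivial_action G f n"
  "n \<oplus>\<^bsub>trivial_right_module G\<^esub> m = (\<lambda>x. n x + m x)" "\<zero>\<^bsub>trivial_right_module G\<^esub> = (\<lambda>_. 0)"
  by (simp_all add: trivial_right_module_def)

lemma right_module_trivial: "right_module (groupoid_ring G) (trivial_right_module G)"
proof (intro right_module.intro right_module_axioms.intro local_unit_ring_groupoid_ring)
  have sub: "n \<in> ZG" if "n \<in> ZU" for n using that ZU_subset_ZG by blast
  show "abelian_group (trivial_right_module G)"
  proof (rule abelian_groupI)
    fix f assume "f \<in> carrier (trivial_right_module G)"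
    then show "\<exists>h\<in>carrier (trivial_right_module G). h \<oplus>\<^bsub>trivial_right_module G\<^esub> f = \<zero>\<^bsub>trivial_right_module G\<^esub>"
      by (intro bexI[of _ "\<lambda>x. - f x"]) (auto simp: module_simps ZU_closed)
  qed (auto simp: module_simps ZU_closed add.assoc add.commute)
  fix f h n assume f: "f \<in> carrier (groupoid_ring G)" and h: "h \<in> carrier (groupoid_ring G)"
    and n: "n \<in> carrier (trivial_right_module G)"
  show "f \<odot>\<^bsub>trivial_right_module G\<^esub> n \<in> carrier (trivial_right_module G)"
    using f n by (simp add: ring_simps module_simps trivial_action_eq augmentation_closed conv_closed sub)
  show "(f \<oplus>\<^bsub>groupoid_ring G\<^esub> h) \<odot>\<^bsub>trivial_right_module G\<^esub> n =
      f \<odot>\<^bsub>trivial_right_module G\<^esub> n \<oplus>\<^bsub>trivial_right_module G\<^esub> h \<odot>\<^bsub>trivial_right_module G\<^esub> n"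
    using f h n by (simp add: ring_simps module_simps trivial_action_eq augmentation_add conv_closed sub conv_add_right ZG_closed)
  show "(f \<otimes>\<^bsub>groupoid_ring G\<^esub> h) \<odot>\<^bsub>trivial_right_module G\<^esub> n =
      h \<odot>\<^bsub>trivial_right_module G\<^esub> (f \<odot>\<^bsub>trivial_right_module G\<^esub> n)"
    using f h n by (simp add: ring_simps module_simps trivial_action_eq augmentation_closed conv_closed sub
        augmentation_augmentation_conv conv_assoc)
next
  have sub: "n \<in> ZG" if "n \<in> ZU" for n using that ZU_subset_ZG by blast
  fix f n m assume "f \<in> carrier (groupoid_ring G)" "n \<in> carrier (trivial_right_module G)" "m \<in> carrier (trivial_right_module G)"
  then show "f \<odot>\<^bsub>trivial_right_module G\<^esub> (n \<oplus>\<^bsub>trivial_right_module G\<^esub> m) =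
      f \<odot>\<^bsub>trivial_right_module G\<^esub> n \<oplus>\<^bsub>trivial_right_module G\<^esub> f \<odot>\<^bsub>trivial_right_module G\<^esub> m"
    by (simp add: ring_simps module_simps trivial_action_eq augmentation_add conv_closed sub conv_add_left ZU_closed)
qed

end

section \<open>From vanishing homology to an AF groupoid\<close>

text \<open>The maximum principle. On the connected component of \<open>g\<close> a positive value forces the maximum to
  be attained, because the support is finite, and the set where it is attained is closed under
  passing to neighbours. Negative values are treated through \<open>- \<phi>\<close>. In particular \<open>\<phi>\<close> vanishes on
  infinite components.\<close>

lemma constant_if_max_principle:
  fixes \<phi> :: "'a \<Rightarrow> int"
  assumes sym: "sym S" and fin: "finite {k. (g, k) \<in> S\<^sup>* \<and> \<phi> k \<noteq> 0}"
    and max: "\<And>k k'. \<lbrakk>(g, k) \<in> S\<^sup>*; \<And>l. (k, l) \<in> S \<Longrightarrow> \<phi> l \<le> \<phi> k; (k, k') \<in> S\<rbrakk> \<Longrightarrow> \<phi> k' = \<phi> k"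
    and min: "\<And>k k'. \<lbrakk>(g, k) \<in> S\<^sup>*; \<And>l. (k, l) \<in> S \<Longrightarrow> \<phi> k \<le> \<phi> l; (k, k') \<in> S\<rbrakk> \<Longrightarrow> \<phi> k' = \<phi> k"
    and k: "(g, k) \<in> S\<^sup>*"
  shows "\<phi> k = \<phi> g"
proof -
  have pos: "\<psi> k = \<psi> g"
    if fin: "finite {k. (g, k) \<in> S\<^sup>* \<and> \<psi> k \<noteq> 0}" and k1: "(g, k1) \<in> S\<^sup>*" "\<psi> k1 > 0"
      and max: "\<And>k k'. \<lbrakk>(g, k) \<in> S\<^sup>*; \<And>l. (k, l) \<in> S \<Longrightarrow> \<psi> l \<le> \<psi> k; (k, k') \<in> S\<rbrakk> \<Longrightarrow> \<psi> k' = \<psi> k"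
    for \<psi> :: "'a \<Rightarrow> int" and k1
  proof -
    let ?Z = "{k. (g, k) \<in> S\<^sup>* \<and> \<psi> k \<noteq> 0}"
    define M where "M = Max (\<psi> ` ?Z)"
    have "k1 \<in> ?Z" using k1 by simp
    then have "M \<in> \<psi> ` ?Z" "\<psi> k1 \<le> M" unfolding M_def using fin by (auto intro!: Max_in Max_ge)
    then obtain k0 where k0: "(g, k0) \<in> S\<^sup>*" "\<psi> k0 = M" "M > 0" using k1(2) by auto
    have le: "\<psi> l \<le> M" if "(g, l) \<in> S\<^sup>*" for l
      using that k0(3) fin unfolding M_def by (cases "\<psi> l = 0") (auto intro!: Max_ge)
    have eq: "\<psi> l = M" if "(k0, l) \<in> S\<^sup>*" for l
      using that
    proof (induction rule: rtrancl_induct)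
      case (step l l')
      have gl: "(g, l) \<in> S\<^sup>*" using k0(1) step.hyps(1) by (rule rtrancl_trans)
      have "\<psi> l' = \<psi> l"
      proof (rule max[OF gl _ step.hyps(2)])
        fix m assume "(l, m) \<in> S"
        then have "(g, m) \<in> S\<^sup>*" using gl by (rule rtrancl_into_rtrancl[rotated])
        then show "\<psi> m \<le> \<psi> l" using le step.IH by simp
      qed
      then show ?case using step.IH by simp
    qed (use k0 in simp)
    have to_g: "(k0, g) \<in> S\<^sup>*" using sym_rtrancl[OF sym] k0(1) by (meson symD)
    then show ?thesis using eq[OF to_g] eq[OF rtrancl_trans[OF to_g k]] by simp
  qed
  show ?thesis
  proof (cases "\<exists>k1. (g, k1) \<in> S\<^sup>* \<and> \<phi> k1 \<noteq> 0")
    case False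
    then have "\<phi> k = 0" "\<phi> g = 0" using k by auto
    then show ?thesis by simp
  next
    case True
    then obtain k1 where k1: "(g, k1) \<in> S\<^sup>*" "\<phi> k1 \<noteq> 0" by blast
    show ?thesis
    proof (cases "\<phi> k1 > 0")
      case True
      show ?thesis by (rule pos[OF fin k1(1) True max])
    next
      case False
      have "- \<phi> k = - \<phi> g"
      proof (rule pos[OF _ k1(1)])
        show "finite {k. (g, k) \<in> S\<^sup>* \<and> - \<phi> k \<noteq> 0}" using fin by simp
        show "0 < - \<phi> k1" using False k1(2) by simp
        show "- \<phi> k' = - \<phi> k" if "(g, k) \<in> S\<^sup>*" "\<And>l. (k, l) \<in> S \<Longrightarrow> - \<phi> l \<le> - \<phi> k" "(k, k') \<in> S" for k k'
          using min[OF that(1) _ that(3)] that(2) by simp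
      qed
      then show ?thesis by simp
    qed
  qed
qed

context ample_groupoid begin

text \<open>The edges of the graph on which the Laplacian lives. The subgroupoid generated by \<open>E\<close> consists of the
  end points of the paths that start at the source of an arrow of \<open>E\<close>.\<close>

definition step :: "'g set \<Rightarrow> ('g \<times> 'g) set" where
  "step E = {(k, k \<cdot> e) |k e. k \<in> \<A> \<and> e \<in> E \<and> s k = r e}"

definition generated :: "'g set \<Rightarrow> 'g set" where
  "generated E = {h. \<exists>u\<in>s ` E. (u, h) \<in> (step E)\<^sup>*}"

lemma step_mono: "E \<subseteq> E' \<Longrightarrow> step E \<subseteq> step E'"
  unfolding step_def by blast

lemma generated_mono: "E \<subseteq> E' \<Longrightarrow> generated E \<subseteq> generated E'"
  unfolding generated_def using rtrancl_mono[OF step_mono[of E E']] by blast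

lemma step_arrow:
  assumes "E \<subseteq> \<A>" "(k, k') \<in> (step E)\<^sup>*" "k \<in> \<A>" shows "k' \<in> \<A> \<and> r k' = r k"
  using assms(2,3)
proof (induction rule: rtrancl_induct)
  case (step l l')
  then obtain e where "l' = l \<cdot> e" "e \<in> E" "s l = r e" by (auto simp: step_def)
  then show ?case using step assms(1) by (auto simp: comp_closed rng_comp subset_iff)
qed auto

lemma step_sym:
  assumes E: "E \<subseteq> \<A>" "iv ` E \<subseteq> E" shows "sym (step E)"
proof (rule symI)
  fix k k' assume "(k, k') \<in> step E"
  then obtain e where e: "k' = k \<cdot> e" "e \<in> E" "s k = r e" "k \<in> \<A>" by (auto simp: step_def)
  then have "e \<in> \<A>" using E by auto
  then have "k' \<in> \<A>" "k = k' \<cdot> iv e" "s k' = r (iv e)"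
    using e by (simp_all add: comp_closed comp_comp_ginv src_comp rng_ginv)
  moreover have "iv e \<in> E" using e E by auto
  ultimately show "(k', k) \<in> step E" unfolding step_def by blast
qed

text \<open>Left translation maps paths to paths. This turns statements about paths from units into statements about all
  paths.\<close>

lemma step_translate:
  assumes E: "E \<subseteq> \<A>" and "(k, k') \<in> (step E)\<^sup>*" "k \<in> \<A>" "h \<in> \<A>" "s h = r k"
  shows "(h \<cdot> k, h \<cdot> k') \<in> (step E)\<^sup>*"
  using assms(2)
proof (induction rule: rtrancl_induct)
  case (step l l')
  then obtain e where e: "l' = l \<cdot> e" "e \<in> E" "s l = r e" "l \<in> \<A>" by (auto simp: step_def)
  have l: "r l = r k" using step_arrow[OF E step.hyps(1) assms(3)] by simp
  then have "h \<cdot> l' = (h \<cdot> l) \<cdot> e" "h \<cdot> l \<in> \<A>" "s (h \<cdot> l) = r e"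
    using e assms E by (auto simp: comp_assoc comp_closed src_comp subset_iff)
  then have "(h \<cdot> l, h \<cdot> l') \<in> step E" using e unfolding step_def by blast
  then show ?case using step.IH by (rule rtrancl_into_rtrancl[rotated])
qed simp

lemma src_generating:
  assumes "E \<subseteq> \<A>" "iv ` E \<subseteq> E" "e \<in> E" shows "r e \<in> s ` E"
proof -
  have "e \<in> \<A>" using assms by auto
  then have "r e = s (iv e)" "iv e \<in> E" using assms by (auto simp: src_ginv)
  then show ?thesis by blast
qed

lemma generated_path:
  assumes E: "E \<subseteq> \<A>" and h: "h \<in> generated E"
  shows "h \<in> \<A>" "r h \<in> s ` E" "(r h, h) \<in> (step E)\<^sup>*"
proof -
  obtain u where u: "u \<in> s ` E" "(u, h) \<in> (step E)\<^sup>*" using h by (auto simp: generated_def)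
  then have U: "u \<in> \<U>" using E src_unit by auto
  then show "h \<in> \<A>" "r h \<in> s ` E" "(r h, h) \<in> (step E)\<^sup>*"
    using step_arrow[OF E u(2)] u rng_of_unit unit_arrow by auto
qed

lemma src_generated:
  assumes E: "E \<subseteq> \<A>" "iv ` E \<subseteq> E" and h: "h \<in> generated E"
  shows "s h \<in> s ` E"
proof -
  have "s k' \<in> s ` E" if "(k, k') \<in> (step E)\<^sup>*" "k \<in> \<A>" "s k \<in> s ` E" for k k'
    using that
  proof (induction rule: rtrancl_induct)
    case (step l l')
    then obtain e where "l' = l \<cdot> e" "e \<in> E" "s l = r e" "l \<in> \<A>" by (auto simp: step_def)
    then show ?case using E by (auto simp: src_comp subset_iff)
  qed
  moreover obtain a where "a \<in> E" "r h = s a" using generated_path(2)[OF E(1) h] by auto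
  moreover from this have "s (r h) = r h" "r h \<in> \<A>" using E src_src src_unit unit_arrow by auto
  ultimately show ?thesis using generated_path(2,3)[OF E(1) h] by metis
qed

lemma generated_subgroupoid:
  assumes E: "E \<subseteq> \<A>" "iv ` E \<subseteq> E" shows "subgroupoid G (generated E)"
  unfolding subgroupoid_def
proof (intro conjI ballI impI)
  show "generated E \<subseteq> \<A>" using generated_path(1)[OF E(1)] by blast
next
  fix g assume g: "g \<in> generated E"
  note p = generated_path[OF E(1) g]
  have "(iv g \<cdot> r g, iv g \<cdot> g) \<in> (step E)\<^sup>*"
    by (rule step_translate[OF E(1) p(3)])
      (use p(1) in \<open>simp_all add: rng_unit unit_arrow ginv_closed src_ginv rng_rng\<close>)
  then have "(iv g, s g) \<in> (step E)\<^sup>*"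
    using p(1) comp_src[of "iv g"] by (simp add: ginv_closed src_ginv ginv_comp)
  then have "(s g, iv g) \<in> (step E)\<^sup>*" using sym_rtrancl[OF step_sym[OF E]] by (meson symD)
  then show "iv g \<in> generated E" using src_generated[OF E g] unfolding generated_def by blast
next
  fix g h assume g: "g \<in> generated E" and h: "h \<in> generated E" and eq: "s g = r h"
  note p = generated_path[OF E(1) g] and q = generated_path[OF E(1) h]
  have "(g \<cdot> r h, g \<cdot> h) \<in> (step E)\<^sup>*"
    by (rule step_translate[OF E(1) q(3)])
      (use p(1) q(1) eq in \<open>simp_all add: rng_unit unit_arrow rng_rng\<close>)
  then have "(g, g \<cdot> h) \<in> (step E)\<^sup>*" using p(1) eq comp_src[of g] by simp
  with p(3) have "(r g, g \<cdot> h) \<in> (step E)\<^sup>*" by (rule rtrancl_trans)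
  then show "g \<cdot> h \<in> generated E" using p(2) unfolding generated_def by blast
qed

lemma generating_subset:
  assumes E: "E \<subseteq> \<A>" "iv ` E \<subseteq> E" shows "E \<subseteq> generated E"
proof
  fix e assume e: "e \<in> E"
  then have "e \<in> \<A>" using E by auto
  then have "r e \<in> \<A>" "s (r e) = r e" "r e \<cdot> e = e" by (simp_all add: rng_unit unit_arrow src_rng comp_rng)
  moreover from this have "(r e, r e \<cdot> e) \<in> step E" using e unfolding step_def by blast
  ultimately have "(r e, e) \<in> step E" by simp
  then show "e \<in> generated E" using src_generating[OF E e] unfolding generated_def by blast
qed

definition finite_bisection_union :: "'g set \<Rightarrow> bool" where
  "finite_bisection_union W \<longleftrightarrow> (\<exists>\<C>. finite \<C> \<and> (\<forall>C\<in>\<C>. bisection C) \<and> W = \<Union>\<C>)"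

lemma finite_bisection_union_UN:
  assumes "finite I" "\<And>i. i \<in> I \<Longrightarrow> finite_bisection_union (W i)"
  shows "finite_bisection_union (\<Union>i\<in>I. W i)"
proof -
  obtain \<C> where "\<And>i. i \<in> I \<Longrightarrow> finite (\<C> i) \<and> (\<forall>C\<in>\<C> i. bisection C) \<and> W i = \<Union>(\<C> i)"
    using assms(2) unfolding finite_bisection_union_def by metis
  then show ?thesis
    unfolding finite_bisection_union_def using assms(1) by (intro exI[of _ "\<Union>i\<in>I. \<C> i"]) auto
qed

lemma finite_bisection_union_arrow_products:
  assumes "finite_bisection_union V" "finite_bisection_union W"
  shows "finite_bisection_union (arrow_products V W)"
proof -
  obtain \<C> \<D> where "finite \<C>" "\<forall>C\<in>\<C>. bisection C" "V = \<Union>\<C>" "finite \<D>" "\<forall>D\<in>\<D>. bisection D" "W = \<Union>\<D>"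
    using assms unfolding finite_bisection_union_def by blast
  moreover have "arrow_products (\<Union>\<C>) (\<Union>\<D>) = \<Union>((\<lambda>(C, D). arrow_products C D) ` (\<C> \<times> \<D>))"
    by (auto simp: arrow_products_def)
  ultimately show ?thesis
    unfolding finite_bisection_union_def using bisection_arrow_products
    by (intro exI[of _ "(\<lambda>(C, D). arrow_products C D) ` (\<C> \<times> \<D>)"]) auto
qed

lemma finite_bisection_union_open_compact:
  assumes "finite_bisection_union W" shows "openin \<T> W" "compactin \<T> W"
  using assms bisectionD(1,2) unfolding finite_bisection_union_def by (auto intro!: compactin_Union)

text \<open>Right multiplication by \<open>1\<^bsub>s(C)\<^esub> - 1\<^sub>C\<close> takes the difference of \<open>F\<close> along the edges of \<open>C\<close>, so a
  harmonic function attains a local maximum or minimum only if it is constant on the neighbours, and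
  the maximum principle makes \<open>F\<close> invariant under the generated subgroupoid.\<close>

lemma generated_AF:
  assumes fin: "finite \<C>" and bis: "\<And>C. C \<in> \<C> \<Longrightarrow> bisection C" and inv: "\<And>C. C \<in> \<C> \<Longrightarrow> iv ` C \<in> \<C>"
    and F: "F \<in> ZG" and harmonic: "F \<star> (\<lambda>x. \<Sum>C\<in>\<C>. indicator (s ` C) x - indicator C x) = (\<lambda>_. 0)"
    and aug: "augmentation F = indicator (s ` \<Union>\<C>)"
  shows "principal G (generated (\<Union>\<C>)) \<and> compact_open \<T> (generated (\<Union>\<C>))"
proof -
  define E where "E = \<Union>\<C>"
  let ?H = "generated E"
  have E: "E \<subseteq> \<A>" "iv ` E \<subseteq> E" using bis inv bisectionD(3) by (auto simp: E_def)
  have conv_L: "(F \<star> (\<lambda>x. \<Sum>C\<in>\<D>. indicator (s ` C) x - indicator C x)) g =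
      (\<Sum>C\<in>\<D>. (F \<star> indicator (s ` C)) g - (F \<star> indicator C) g)" if "finite \<D>" for \<D> g
    using that by (induction \<D>) (simp_all add: conv_add_right conv_diff_right)
  \<comment> \<open>The contribution of \<open>C\<close> to the Laplacian at \<open>g\<close>.\<close>
  define t where "t C g = (F \<star> indicator (s ` C)) g - (F \<star> indicator C) g" for C g
  have t_eq: "t C g = F g - F (g \<cdot> iv c)"
    if C: "C \<in> \<C>" and c: "c \<in> C" and g: "g \<in> \<A>" "s g = s c" for C c g
  proof -
    have cA: "c \<in> \<A>" using c bisectionD(3)[OF bis[OF C]] by auto
    have "(F \<star> indicator (s ` C)) g = F (g \<cdot> iv (s c))"
      by (rule conv_indicator[OF F bisection_src[OF bis[OF C]] _ g(1)])
        (use c cA g src_src in auto)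
    also have "g \<cdot> iv (s c) = g" using comp_src[OF g(1)] g cA by (simp add: ginv_unit src_unit)
    finally show ?thesis using conv_indicator[OF F bis[OF C] c g] by (simp add: t_def)
  qed
  have t_zero: "t C g = 0" if C: "C \<in> \<C>" and g: "s g \<notin> s ` C" for C g
  proof -
    have "s ` s ` C = s ` C" using bisectionD(3)[OF bis[OF C]] src_src by (force simp: image_image)
    then show ?thesis using conv_indicator_zero[of g C F] conv_indicator_zero[of g "s ` C" F] g by (simp add: t_def)
  qed
  have zero_sum: "(\<Sum>C\<in>\<C>. t C g) = 0" for g
    using conv_L[OF fin, of g] harmonic by (simp add: t_def)
  have stepD: "\<exists>C c. C \<in> \<C> \<and> c \<in> C \<and> s g = s c \<and> k = g \<cdot> iv c \<and> g \<in> \<A>" if gk: "(g, k) \<in> step E" for g k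
  proof -
    obtain e where e: "k = g \<cdot> e" "e \<in> E" "s g = r e" "g \<in> \<A>" using gk by (auto simp: step_def)
    then obtain C where C: "C \<in> \<C>" "e \<in> C" by (auto simp: E_def)
    have "e \<in> \<A>" using e E by auto
    then have "iv e \<in> iv ` C" "s g = s (iv e)" "k = g \<cdot> iv (iv e)" using C e by (auto simp: src_ginv ginv_ginv)
    then show ?thesis using inv[OF C(1)] e(4) by blast
  qed
  have stepI: "(g, g \<cdot> iv c) \<in> step E" if "C \<in> \<C>" "c \<in> C" "s g = s c" "g \<in> \<A>" for g C c
  proof -
    have "c \<in> E" using that by (auto simp: E_def)
    then have "c \<in> \<A>" "iv c \<in> E" using E by blast+
    then show ?thesis using that unfolding step_def by (auto simp: rng_ginv)
  qed
  have eq_if_t_zero: "F k = F g" if gk: "(g, k) \<in> step E" and "\<forall>C\<in>\<C>. t C g = 0" for g k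
  proof -
    obtain C c where "C \<in> \<C>" "c \<in> C" "s g = s c" "k = g \<cdot> iv c" "g \<in> \<A>" using stepD[OF gk] by blast
    then show ?thesis using t_eq[of C c g] that(2) by simp
  qed
  have max: "F k = F g" if le: "\<And>l. (g, l) \<in> step E \<Longrightarrow> F l \<le> F g" and k: "(g, k) \<in> step E" for g k
  proof (rule eq_if_t_zero[OF k])
    have gA: "g \<in> \<A>" using k by (auto simp: step_def)
    have "0 \<le> t C g" if C: "C \<in> \<C>" for C
    proof (cases "s g \<in> s ` C")
      case True
      then obtain c where c: "c \<in> C" "s g = s c" by blast
      then show ?thesis using t_eq[OF C c(1) gA c(2)] le[OF stepI[OF C c gA]] by simp
    qed (simp add: t_zero[OF C])
    then show "\<forall>C\<in>\<C>. t C g = 0"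
      using zero_sum[of g] sum_nonneg_eq_0_iff[OF fin, of "\<lambda>C. t C g"] by simp
  qed
  have min: "F k = F g" if ge: "\<And>l. (g, l) \<in> step E \<Longrightarrow> F g \<le> F l" and k: "(g, k) \<in> step E" for g k
  proof (rule eq_if_t_zero[OF k])
    have gA: "g \<in> \<A>" using k by (auto simp: step_def)
    have "t C g \<le> 0" if C: "C \<in> \<C>" for C
    proof (cases "s g \<in> s ` C")
      case True
      then obtain c where c: "c \<in> C" "s g = s c" by blast
      then show ?thesis using t_eq[OF C c(1) gA c(2)] ge[OF stepI[OF C c gA]] by simp
    qed (simp add: t_zero[OF C])
    then show "\<forall>C\<in>\<C>. t C g = 0"
      using zero_sum[of g] sum_nonneg_eq_0_iff[OF fin, of "\<lambda>C. - t C g"] by (simp add: sum_negf)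
  qed
  have inv_step: "F k = F g" if g: "g \<in> \<A>" and k: "(g, k) \<in> (step E)\<^sup>*" for g k
  proof (rule constant_if_max_principle[OF step_sym[OF E] _ _ _ k])
    have "{k. (g, k) \<in> (step E)\<^sup>* \<and> F k \<noteq> 0} \<subseteq> {k. r k = r g \<and> F k \<noteq> 0}"
    proof
      fix x assume "x \<in> {k. (g, k) \<in> (step E)\<^sup>* \<and> F k \<noteq> 0}"
      then show "x \<in> {k. r k = r g \<and> F k \<noteq> 0}" using step_arrow[OF E(1) _ g, of x] by simp
    qed
    then show "finite {k. (g, k) \<in> (step E)\<^sup>* \<and> F k \<noteq> 0}"
      using finite_rng_fibre[OF F] finite_subset by blast
  qed (use max min in blast)+
  have F_inv: "F (g \<cdot> h) = F g" if "g \<in> \<A>" "h \<in> ?H" "s g = r h" for g h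
  proof (rule inv_step[OF that(1)])
    note p = generated_path[OF E(1) that(2)]
    have "(g \<cdot> r h, g \<cdot> h) \<in> (step E)\<^sup>*"
      by (rule step_translate[OF E(1) p(3)])
        (use p(1) that in \<open>simp_all add: rng_unit unit_arrow rng_rng\<close>)
    then show "(g, g \<cdot> h) \<in> (step E)\<^sup>*" using that comp_src[of g] by simp
  qed
  have H_inv: "\<And>h. h \<in> ?H \<Longrightarrow> iv h \<in> ?H"
    and H_comp: "\<And>h k. \<lbrakk>h \<in> ?H; k \<in> ?H; s h = r k\<rbrakk> \<Longrightarrow> h \<cdot> k \<in> ?H"
    using generated_subgroupoid[OF E] by (simp_all add: subgroupoid_def)
  have HA: "?H \<subseteq> \<A>" using generated_subgroupoid[OF E] by (simp add: subgroupoid_def)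
  have UU: "s ` E \<subseteq> \<U>" by (rule src_subset[OF E(1)])
  have UH: "s ` E \<subseteq> ?H" unfolding generated_def by blast
  have sum1: "(\<Sum>g | s g = x \<and> F g \<noteq> 0. F g) = 1" if "x \<in> s ` E" for x
    using fun_cong[OF aug, of x] that UU by (auto simp: augmentation_def E_def[symmetric])
  have "principal G ?H"
    unfolding principal_def
  proof (intro ballI impI)
    fix h assume h: "h \<in> ?H" "s h = r h"
    define x where "x = r h"
    have x: "x \<in> s ` E" unfolding x_def by (rule generated_path(2)[OF E(1) h(1)])
    have xU: "x \<in> \<U>" using x UU by blast
    \<comment> \<open>The isotropy group at \<open>x\<close> acts freely on the support \<open>Z\<close> of \<open>F\<close> above \<open>x\<close>, and \<open>F\<close> is constant on
      the orbits. Hence the order of the group divides the sum 1 of the values of \<open>F\<close>.\<close>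
    define \<Gamma> where "\<Gamma> = {\<gamma> \<in> ?H. s \<gamma> = x \<and> r \<gamma> = x}"
    define Z where "Z = {g. s g = x \<and> F g \<noteq> 0}"
    have Z: "finite Z" "sum F Z = 1" "Z \<subseteq> \<A>"
      unfolding Z_def using finite_src_fibre[OF F] sum1[OF x] ZG_support[OF F] by auto
    have \<Gamma>A: "\<gamma> \<in> \<A>" if "\<gamma> \<in> \<Gamma>" for \<gamma> using that HA by (auto simp: \<Gamma>_def)
    have act: "g \<cdot> \<gamma> \<in> Z" "F (g \<cdot> \<gamma>) = F g" if "g \<in> Z" "\<gamma> \<in> \<Gamma>" for g \<gamma>
      using that F_inv[of g \<gamma>] Z(3) \<Gamma>A[of \<gamma>] by (auto simp: Z_def \<Gamma>_def src_comp)
    have inj: "inj_on (\<lambda>\<gamma>. g \<cdot> \<gamma>) \<Gamma>" if g: "g \<in> Z" for g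
    proof (rule inj_onI)
      fix a b assume ab: "a \<in> \<Gamma>" "b \<in> \<Gamma>" "g \<cdot> a = g \<cdot> b"
      have "g \<in> \<A>" "s g = r a" "s g = r b" using g Z(3) ab by (auto simp: Z_def \<Gamma>_def)
      then have "iv g \<cdot> (g \<cdot> a) = a" "iv g \<cdot> (g \<cdot> b) = b"
        using \<Gamma>A[OF ab(1)] \<Gamma>A[OF ab(2)] by (simp_all only: ginv_comp_cancel)
      then show "a = b" using ab(3) by metis
    qed
    obtain g0 where g0: "g0 \<in> Z" using Z(2) by fastforce
    have fin\<Gamma>: "finite \<Gamma>"
      using inj_on_finite[OF inj[OF g0], of Z] act(1)[OF g0] Z(1) by blast
    define P where "P = (\<lambda>g. (\<lambda>\<gamma>. g \<cdot> \<gamma>) ` \<Gamma>) ` Z"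
    have x\<Gamma>: "x \<in> \<Gamma>" using x xU UH by (auto simp: \<Gamma>_def src_of_unit rng_of_unit)
    have "\<Union>P = Z"
    proof (intro equalityI subsetI)
      fix g assume "g \<in> \<Union>P" then show "g \<in> Z" using act(1) by (auto simp: P_def)
    next
      fix g assume g: "g \<in> Z"
      then have "g \<cdot> x = g" using comp_src Z(3) by (auto simp: Z_def)
      then show "g \<in> \<Union>P" using g x\<Gamma> unfolding P_def by (metis UN_I imageI)
    qed
    have block: "(\<lambda>\<gamma>. g \<cdot> \<gamma>) ` \<Gamma> = (\<lambda>\<gamma>. k \<cdot> \<gamma>) ` \<Gamma>"
      if gk: "g \<in> Z" "k \<in> Z" and ab: "a \<in> \<Gamma>" "b \<in> \<Gamma>" "g \<cdot> a = k \<cdot> b" for g k a b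
    proof -
      have sub: "(\<lambda>\<gamma>. g \<cdot> \<gamma>) ` \<Gamma> \<subseteq> (\<lambda>\<gamma>. k \<cdot> \<gamma>) ` \<Gamma>"
        if gk: "g \<in> Z" "k \<in> Z" and ab: "a \<in> \<Gamma>" "b \<in> \<Gamma>" "g \<cdot> a = k \<cdot> b" for g k a b
      proof
        fix c assume "c \<in> (\<lambda>\<gamma>. g \<cdot> \<gamma>) ` \<Gamma>"
        then obtain \<gamma> where \<gamma>: "\<gamma> \<in> \<Gamma>" "c = g \<cdot> \<gamma>" by blast
        have A: "g \<in> \<A>" "k \<in> \<A>" "a \<in> \<A>" "b \<in> \<A>" "\<gamma> \<in> \<A>" using gk ab \<gamma> Z(3) \<Gamma>A by auto
        have sr: "s g = x" "s k = x" "s a = x" "r a = x" "s b = x" "r b = x" "s \<gamma> = x" "r \<gamma> = x"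
          using gk ab \<gamma> by (auto simp: Z_def \<Gamma>_def)
        have H: "a \<in> ?H" "b \<in> ?H" "\<gamma> \<in> ?H" using ab \<gamma> by (simp_all add: \<Gamma>_def)
        have ia: "iv a \<cdot> \<gamma> \<in> ?H" using H_comp[OF H_inv[OF H(1)] H(3)] A sr by (simp add: src_ginv)
        have sr': "s (iv a \<cdot> \<gamma>) = x" "r (iv a \<cdot> \<gamma>) = x" "iv a \<cdot> \<gamma> \<in> \<A>"
          using A sr by (simp_all add: src_comp rng_comp src_ginv rng_ginv ginv_closed comp_closed)
        have mem: "b \<cdot> (iv a \<cdot> \<gamma>) \<in> \<Gamma>"
          using H_comp[OF H(2) ia] A sr sr' by (simp add: \<Gamma>_def src_comp rng_comp)
        have "k \<cdot> (b \<cdot> (iv a \<cdot> \<gamma>)) = (k \<cdot> b) \<cdot> (iv a \<cdot> \<gamma>)"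
          using A sr by (simp add: comp_assoc comp_closed ginv_closed src_ginv rng_ginv rng_comp src_comp)
        also have "\<dots> = (g \<cdot> a) \<cdot> (iv a \<cdot> \<gamma>)" using ab(3) by simp
        also have "\<dots> = g \<cdot> (a \<cdot> (iv a \<cdot> \<gamma>))"
          using A sr by (simp add: comp_assoc comp_closed ginv_closed src_ginv rng_ginv rng_comp src_comp)
        also have "\<dots> = c" using A sr \<gamma>(2) by (simp add: comp_ginv_cancel)
        finally show "c \<in> (\<lambda>\<gamma>. k \<cdot> \<gamma>) ` \<Gamma>" using mem by (metis imageI)
      qed
      show ?thesis using sub[OF gk ab] sub[OF gk(2,1) ab(2,1) ab(3)[symmetric]] by blast
    qed
    have disj: "A \<inter> B = {}" if AB: "A \<in> P" "B \<in> P" "A \<noteq> B" for A B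
    proof (rule ccontr)
      assume "A \<inter> B \<noteq> {}"
      then obtain c where c: "c \<in> A" "c \<in> B" by blast
      obtain g k where gk: "g \<in> Z" "A = (\<lambda>\<gamma>. g \<cdot> \<gamma>) ` \<Gamma>" "k \<in> Z" "B = (\<lambda>\<gamma>. k \<cdot> \<gamma>) ` \<Gamma>"
        using AB(1,2) unfolding P_def by blast
      then obtain a b where "a \<in> \<Gamma>" "b \<in> \<Gamma>" "g \<cdot> a = k \<cdot> b" using c by auto
      then show False using block[OF gk(1,3)] gk(2,4) AB(3) by blast
    qed
    have "sum F (\<Union>P) = sum (sum F) P"
      using sum.Union_disjoint[of P F] fin\<Gamma> disj by (auto simp: P_def)
    moreover have "int (card \<Gamma>) dvd sum F A" if AP: "A \<in> P" for A
    proof -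
      obtain g where g: "g \<in> Z" "A = (\<lambda>\<gamma>. g \<cdot> \<gamma>) ` \<Gamma>" using AP unfolding P_def by blast
      have "sum F A = (\<Sum>\<gamma>\<in>\<Gamma>. F (g \<cdot> \<gamma>))" unfolding g(2) by (simp add: sum.reindex[OF inj[OF g(1)]])
      also have "\<dots> = int (card \<Gamma>) * F g" using act(2)[OF g(1)] by simp
      finally show ?thesis by simp
    qed
    ultimately have "int (card \<Gamma>) dvd 1"
      using Z(2) \<open>\<Union>P = Z\<close> dvd_sum[of P "int (card \<Gamma>)" "sum F"] by simp
    then have "card \<Gamma> = 1" by simp
    moreover have "h \<in> \<Gamma>" using h by (simp add: \<Gamma>_def x_def)
    ultimately have "h = x" using x\<Gamma> card_1_singletonE by (metis singletonD)
    then show "h \<in> \<U>" using xU by simp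
  qed
  moreover have "finite_bisection_union ?H"
  proof -
    obtain K where K: "\<And>x. finite {a. r a = x \<and> F a \<noteq> 0}" "\<And>x. card {a. r a = x \<and> F a \<noteq> 0} \<le> K"
      using fibre_finite_bounded[OF F] by blast
    \<comment> \<open>A path inside a set of \<open>K\<close> arrows can be shortened to use each of the at most \<open>K * K\<close> edges in this
      set once. So paths of length at most \<open>K * K\<close> reach all arrows of the generated subgroupoid.\<close>
    define ball where "ball n = {h. \<exists>u\<in>s ` E. (u, h) \<in> step E ^^ n}" for n
    have fbE: "finite_bisection_union E" unfolding finite_bisection_union_def E_def using fin bis by blast
    have fb: "finite_bisection_union (ball n)" for n
    proof (induction n)
      case 0
      have "ball 0 = (\<Union>C\<in>\<C>. s ` C)" by (auto simp: ball_def E_def)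
      moreover have "finite_bisection_union (s ` C)" if "C \<in> \<C>" for C
        unfolding finite_bisection_union_def using bisection_src[OF bis[OF that]] by (intro exI[of _ "{s ` C}"]) simp
      ultimately show ?case using finite_bisection_union_UN[OF fin] by simp
    next
      case (Suc n)
      have "ball n \<subseteq> \<A>"
      proof
        fix h assume "h \<in> ball n"
        then have "h \<in> ?H" unfolding ball_def generated_def by (auto dest: relpow_imp_rtrancl)
        then show "h \<in> \<A>" using HA by blast
      qed
      then have "ball (Suc n) = arrow_products (ball n) E"
        unfolding ball_def arrow_products_def by (fastforce simp: step_def)
      then show ?case using finite_bisection_union_arrow_products[OF Suc fbE] by simp
    qed
    have "?H = (\<Union>n\<le>K * K. ball n)"
    proof (intro equalityI subsetI)
      fix h assume "h \<in> (\<Union>n\<le>K * K. ball n)"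
      then show "h \<in> ?H" unfolding ball_def generated_def by (auto dest: relpow_imp_rtrancl)
    next
      fix h assume h: "h \<in> ?H"
      define v where "v = r h"
      note p = generated_path[OF E(1) h, folded v_def]
      have "(\<Sum>g | s g = v \<and> F g \<noteq> 0. F g) \<noteq> 0" using sum1[OF p(2)] by simp
      then obtain g where g: "s g = v" "F g \<noteq> 0"
        using sum.not_neutral_contains_not_neutral[of F "{g. s g = v \<and> F g \<noteq> 0}"] by blast
      have gA: "g \<in> \<A>" using g ZG_support[OF F] by blast
      \<comment> \<open>Left multiplication by an arrow \<open>g\<close> of the support embeds the fibre of the generated subgroupoid over
        \<open>v\<close> into a range fibre of the support.\<close>
      define fib where "fib = {k \<in> ?H. r k = v}"
      have inj: "inj_on (\<lambda>k. g \<cdot> k) fib"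
      proof (rule inj_onI)
        fix a b assume ab: "a \<in> fib" "b \<in> fib" "g \<cdot> a = g \<cdot> b"
        have "a \<in> \<A>" "b \<in> \<A>" "s g = r a" "s g = r b" using g HA ab(1,2) by (auto simp: fib_def)
        then have "iv g \<cdot> (g \<cdot> a) = a" "iv g \<cdot> (g \<cdot> b) = b"
          using gA by (simp_all only: ginv_comp_cancel)
        then show "a = b" using ab(3) by metis
      qed
      have into: "(\<lambda>k. g \<cdot> k) ` fib \<subseteq> {a. r a = r g \<and> F a \<noteq> 0}"
        using gA g F_inv[OF gA] HA by (auto simp: fib_def rng_comp subset_iff)
      have fin_fib: "finite fib" and card_fib: "card fib \<le> K"
        using inj_on_finite[OF inj into K(1)] card_inj_on_le[OF inj into K(1)] K(2)[of "r g"] by auto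
      define S where "S = step E \<inter> (fib \<times> fib)"
      have "finite S" "card S \<le> K * K"
      proof -
        show "finite S" unfolding S_def using fin_fib by blast
        have "card S \<le> card (fib \<times> fib)" unfolding S_def using fin_fib by (intro card_mono) auto
        also have "\<dots> \<le> K * K" using card_fib by (simp add: card_cartesian_product mult_le_mono)
        finally show "card S \<le> K * K" .
      qed
      have vfib: "v \<in> fib" using p(2) UU UH rng_of_unit by (auto simp: fib_def)
      have "(v, h) \<in> S\<^sup>* \<and> h \<in> fib" using p(3)
      proof (induction rule: rtrancl_induct)
        case base
        then show ?case using vfib by simp
      next
        case (step k l)
        have "(v, l) \<in> (step E)\<^sup>*" using step.hyps by (rule rtrancl_into_rtrancl)
        then have "l \<in> ?H" "r l = v"
          using p(2) step_arrow[OF E(1)] UU rng_of_unit unit_arrow unfolding generated_def by auto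
        then have "l \<in> fib" by (simp add: fib_def)
        then have "(k, l) \<in> S" using step by (simp add: S_def)
        then show ?case using step.IH \<open>l \<in> fib\<close> by (meson rtrancl_into_rtrancl)
      qed
      then obtain n where n: "n \<le> card S" "(v, h) \<in> S ^^ n"
        using rtrancl_finite_eq_relpow[OF \<open>finite S\<close>] by auto
      have "(v, h) \<in> step E ^^ n"
        using n(2)
      proof (induction n arbitrary: h)
        case (Suc n)
        then obtain k where "(v, k) \<in> S ^^ n" "(k, h) \<in> S" by auto
        then show ?case using Suc.IH by (auto simp: S_def)
      qed simp
      then have "h \<in> ball n" using p(2) by (auto simp: ball_def)
      then show "h \<in> (\<Union>n\<le>K * K. ball n)" using n(1) \<open>card S \<le> K * K\<close> by auto
    qed
    then show ?thesis using finite_bisection_union_UN[of "{..K * K}" ball] fb by simp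
  qed
  moreover have "Hausdorff_space (subtopology \<T> ?H)"
  proof (rule Hausdorff_if_inj[OF HA], rule inj_onI)
    fix g h assume gh: "g \<in> ?H" "h \<in> ?H" "(s g, r g) = (s h, r h)"
    then have A: "g \<in> \<A>" "h \<in> \<A>" "s g = s h" "r g = r h" using HA by auto
    have "iv g \<cdot> h \<in> ?H" using H_comp[OF H_inv[OF gh(1)] gh(2)] A by (simp add: src_ginv)
    moreover have "s (iv g \<cdot> h) = r (iv g \<cdot> h)" using A by (simp add: src_comp rng_comp ginv_closed src_ginv rng_ginv)
    ultimately have "iv g \<cdot> h \<in> \<U>" using \<open>principal G ?H\<close> by (auto simp: principal_def)
    then show "g = h" using eq_if_ginv_comp_unit A by blast
  qed
  ultimately show ?thesis
    using finite_bisection_union_open_compact unfolding compact_open_def E_def by blast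
qed

text \<open>In the trivial module \<open>1\<^sub>U L\<close> is the augmentation of \<open>L\<close>, which vanishes because \<open>C\<close> and its source
  \<open>s(C)\<close> have the same sources. The criterion for flatness writes \<open>1\<^sub>U\<close> as a sum of elements \<open>m k\<close> with
  \<open>k L = 0\<close>, and the sum of the convolutions \<open>m \<star> k\<close> is the required function.\<close>

lemma harmonic_function_if_Tor_trivial:
  assumes Tor: "\<And>M :: ('g \<Rightarrow> int, 'm) module. unitary_left_module (groupoid_ring G) M \<Longrightarrow>
      trivial_group (Tor (groupoid_ring G) (Suc 0) (trivial_right_module G) M)"
    and size: "ZG \<lesssim> (UNIV :: 'm set)" "infinite (UNIV :: 'm set) \<or> ZG = {\<lambda>_. 0}"
    and fin: "finite \<C>" and bis: "\<And>C. C \<in> \<C> \<Longrightarrow> bisection C" and inv: "\<And>C. C \<in> \<C> \<Longrightarrow> iv ` C \<in> \<C>"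
  shows "\<exists>F\<in>ZG. F \<star> (\<lambda>x. \<Sum>C\<in>\<C>. indicator (s ` C) x - indicator C x) = (\<lambda>_. 0) \<and>
    augmentation F = indicator (s ` \<Union>\<C>)"
proof -
  define L :: "'g \<Rightarrow> int" where "L = (\<lambda>x. \<Sum>C\<in>\<C>. indicator (s ` C) x - indicator C x)"
  define U where "U = s ` \<Union>\<C>"
  have "(\<lambda>x. \<Sum>C\<in>\<D>. indicator (s ` C) x - indicator C x :: int) \<in> ZG \<and>
      augmentation (\<lambda>x. \<Sum>C\<in>\<D>. indicator (s ` C) x - indicator C x) = (\<lambda>_. 0)"
    if "finite \<D>" "\<D> \<subseteq> \<C>" for \<D>
    using that
  proof (induction \<D>)
    case empty
    then show ?case by (simp add: ZG_closed)
  next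
    case (insert C \<D>)
    have C: "bisection C" "bisection (s ` C)" using insert.prems bis bisection_src by auto
    have "s ` s ` C = s ` C" using bisectionD(3)[OF C(1)] src_src by (force simp: image_image)
    then show ?case
      using insert C by (simp add: ZG_closed ZG_indicator augmentation_add augmentation_diff augmentation_indicator)
  qed
  from this[OF fin] have L: "L \<in> ZG" "augmentation L = (\<lambda>_. 0)" by (simp_all add: L_def)
  have sub: "\<Union>\<C> \<subseteq> \<A>" using bis bisectionD(3) by blast
  have UU: "U \<subseteq> \<U>" unfolding U_def by (rule src_subset[OF sub])
  have U_eq: "U = \<Union>((`) s ` \<C>)" by (auto simp: U_def)
  have "openin \<T> U" "compactin \<T> U"
    unfolding U_eq using bis bisection_src bisectionD(1,2) fin by (auto intro!: compactin_Union)
  then have U: "bisection U" using UU by (rule bisection_units)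
  have UZU: "indicator U \<in> ZU" unfolding ZU_eq_span using U UU by (rule indicator_in_span)
  have L_supp: "r a \<in> U \<and> s a \<in> U" if La: "L a \<noteq> 0" for a
  proof -
    have "(\<Sum>C\<in>\<C>. indicator (s ` C) a - indicator C a :: int) \<noteq> 0" using La by (simp add: L_def)
    then obtain C where C: "C \<in> \<C>" "(indicator (s ` C) a - indicator C a :: int) \<noteq> 0"
      by (rule sum.not_neutral_contains_not_neutral)
    then have "a \<in> s ` C \<or> a \<in> C" by (auto simp: indicator_def split: if_splits)
    then show ?thesis
    proof
      assume "a \<in> s ` C"
      then have "a \<in> U" using C(1) by (auto simp: U_eq)
      then show ?thesis using UU rng_of_unit src_of_unit by auto
    next
      assume a: "a \<in> C"
      then have "a \<in> \<A>" using bisectionD(3)[OF bis[OF C(1)]] by auto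
      then have "r a = s (iv a)" "iv a \<in> iv ` C" using a by (simp_all add: src_ginv)
      then show ?thesis using a C(1) inv[OF C(1)] unfolding U_eq by blast
    qed
  qed
  have UUs: "indicator U \<star> indicator U = (indicator U :: 'g \<Rightarrow> int)"
    by (rule conv_local_unit[OF ZG_indicator[OF U] UU]) (use UU rng_of_unit in \<open>auto simp: indicator_def split: if_splits\<close>)
  have UL: "indicator U \<star> L = L" by (rule conv_local_unit[OF L(1) UU]) (use L_supp in blast)
  have LU: "L \<star> indicator U = L"
  proof
    fix g
    have sU: "s ` U = U" using UU src_of_unit by force
    show "(L \<star> indicator U) g = L g"
    proof (cases "g \<in> \<A> \<and> s g \<in> U")
      case True
      then have "(L \<star> indicator U) g = L (g \<cdot> iv (s g))"
        by (intro conv_indicator[OF L(1) U]) (auto simp: src_src)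
      then show ?thesis using True by (simp add: ginv_unit src_unit comp_src)
    next
      case False
      then show ?thesis
        using conv_indicator_zero[of g U L] conv_outside[of g] sU L_supp[of g] ZG_outside[OF L(1)] by force
    qed
  qed
  interpret N: right_module "groupoid_ring G" "trivial_right_module G" by (rule right_module_trivial)
  define X where "X = {k \<odot>\<^bsub>trivial_right_module G\<^esub> m |k m. k \<in> carrier (groupoid_ring G) \<and>
      k \<otimes>\<^bsub>groupoid_ring G\<^esub> L = \<zero>\<^bsub>groupoid_ring G\<^esub> \<and> m \<in> carrier (trivial_right_module G)}"
  have X: "X \<subseteq> carrier (trivial_right_module G)" unfolding X_def using N.act_closed by blast
  have "indicator U \<in> generate (add_monoid (trivial_right_module G)) X"
    unfolding X_def
  proof (rule N.annihilated_mem_span_if_Tor_trivial[where 'm = 'm and e = "indicator U"])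
    show "trivial_group (Tor (groupoid_ring G) (Suc 0) (trivial_right_module G) M)"
      if "unitary_left_module (groupoid_ring G) M" for M :: "('g \<Rightarrow> int, 'm) module"
      using that by (rule Tor)
    show "indicator U \<odot>\<^bsub>trivial_right_module G\<^esub> indicator U = indicator U"
      using UZU ZG_indicator[OF U] UUs UU
      by (simp add: module_simps trivial_action_eq augmentation_indicator[OF U] src_of_unit subset_iff cong: image_cong_simp)
    show "L \<odot>\<^bsub>trivial_right_module G\<^esub> indicator U = \<zero>\<^bsub>trivial_right_module G\<^esub>"
      using UZU L UL by (simp add: module_simps trivial_action_eq)
  qed (use size L UL LU UUs UZU ZG_indicator[OF U] in \<open>simp_all add: ring_simps module_simps\<close>)
  moreover have "\<exists>F\<in>ZG. F \<star> L = (\<lambda>_. 0) \<and> augmentation F = n"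
    if "n \<in> generate (add_monoid (trivial_right_module G)) X" for n
    using that X
  proof (induction rule: N.generate_add_induct)
    case zero
    show ?case by (rule bexI[of _ "\<lambda>_. 0"]) (simp_all add: ZG_closed module_simps)
  next
    case (incl n)
    then obtain k m where km: "n = trivial_action G k m" "k \<in> ZG" "k \<star> L = (\<lambda>_. 0)" "m \<in> ZU"
      unfolding X_def by (auto simp: ring_simps module_simps)
    then have "m \<in> ZG" using ZU_subset_ZG by blast
    then show ?case
      using km L by (intro bexI[of _ "m \<star> k"]) (simp_all add: trivial_action_eq conv_assoc conv_closed)
  next
    case (minus n)
    then obtain F where F: "F \<in> ZG" "F \<star> L = (\<lambda>_. 0)" "augmentation F = n" by blast
    have "n \<in> ZU" using F augmentation_closed by blast
    have "\<ominus>\<^bsub>trivial_right_module G\<^esub> n = (\<lambda>x. - n x)"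
      by (rule N.minus_equality) (use \<open>n \<in> ZU\<close> in \<open>simp_all add: module_simps ZU_closed\<close>)
    then show ?case
      using F conv_diff_left[of "\<lambda>_. 0" F L] augmentation_diff[of "\<lambda>_. 0" F]
      by (intro bexI[of _ "\<lambda>x. - F x"]) (simp_all add: ZG_closed)
  next
    case (plus n m)
    then obtain F F' where "F \<in> ZG" "F \<star> L = (\<lambda>_. 0)" "augmentation F = n"
      "F' \<in> ZG" "F' \<star> L = (\<lambda>_. 0)" "augmentation F' = m" by blast
    then show ?case
      by (intro bexI[of _ "\<lambda>x. F x + F' x"]) (simp_all add: ZG_closed conv_add_left augmentation_add module_simps)
  qed
  ultimately have "\<exists>F\<in>ZG. F \<star> L = (\<lambda>_. 0) \<and> augmentation F = indicator U" by blast
  then show ?thesis by (simp add: L_def U_def)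
qed

lemma AF_if_Tor_trivial:
  assumes Tor: "\<And>M :: ('g \<Rightarrow> int, 'm) module. unitary_left_module (groupoid_ring G) M \<Longrightarrow>
      trivial_group (Tor (groupoid_ring G) (Suc 0) (trivial_right_module G) M)"
    and size: "ZG \<lesssim> (UNIV :: 'm set)" "infinite (UNIV :: 'm set) \<or> ZG = {\<lambda>_. 0}"
  shows "AF_groupoid G"
proof -
  define good where "good \<C> \<longleftrightarrow> finite \<C> \<and> (\<forall>C\<in>\<C>. bisection C) \<and> (\<forall>C\<in>\<C>. iv ` C \<in> \<C>)" for \<C>
  have E: "\<Union>\<C> \<subseteq> \<A>" "iv ` \<Union>\<C> \<subseteq> \<Union>\<C>" if "good \<C>" for \<C>
    using that bisectionD(3) unfolding good_def by blast+
  have fam: "subgroupoid G (generated (\<Union>\<C>)) \<and> principal G (generated (\<Union>\<C>)) \<and> compact_open \<T> (generated (\<Union>\<C>))"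
    if g: "good \<C>" for \<C>
  proof -
    have g': "finite \<C>" "\<And>C. C \<in> \<C> \<Longrightarrow> bisection C" "\<And>C. C \<in> \<C> \<Longrightarrow> iv ` C \<in> \<C>"
      using g by (auto simp: good_def)
    obtain F where "F \<in> ZG" "F \<star> (\<lambda>x. \<Sum>C\<in>\<C>. indicator (s ` C) x - indicator C x) = (\<lambda>_. 0)"
      "augmentation F = indicator (s ` \<Union>\<C>)"
      using harmonic_function_if_Tor_trivial[OF Tor size g'] by blast
    then show ?thesis using generated_AF[OF g'] generated_subgroupoid[OF E[OF g]] by blast
  qed
  have Un: "good (\<C> \<union> \<D>)" if "good \<C>" "good \<D>" for \<C> \<D>
    using that by (auto simp: good_def)
  have cover: "\<exists>\<C>. good \<C> \<and> g \<in> generated (\<Union>\<C>)" if g: "g \<in> \<A>" for g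
  proof -
    obtain B where B: "bisection B" "g \<in> B"
      using exists_bisection[of \<A> g] openin_topspace[of \<T>] g unfolding topspace_arr by blast
    have "iv ` iv ` B = B" using bisectionD(3)[OF B(1)] ginv_ginv by (force simp: image_image)
    then have "good {B, iv ` B}" using B bisection_ginv by (auto simp: good_def)
    moreover from this have "g \<in> generated (\<Union>{B, iv ` B})"
      using generating_subset[OF E] B by blast
    ultimately show ?thesis by blast
  qed
  show ?thesis
    unfolding AF_groupoid_def
  proof (intro exI conjI)
    let ?F = "{generated (\<Union>\<C>) |\<C>. good \<C>}"
    have "good {}" by (simp add: good_def)
    then show "?F \<noteq> {}" by blast
    show "\<forall>H\<in>?F. subgroupoid G H \<and> principal G H \<and> compact_open \<T> H" using fam by blast
    show "\<forall>H\<in>?F. \<forall>K\<in>?F. \<exists>L\<in>?F. H \<subseteq> L \<and> K \<subseteq> L"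
    proof (intro ballI)
      fix H K assume "H \<in> ?F" "K \<in> ?F"
      then obtain \<C> \<D> where CD: "good \<C>" "good \<D>" "H = generated (\<Union>\<C>)" "K = generated (\<Union>\<D>)" by blast
      have "H \<subseteq> generated (\<Union>(\<C> \<union> \<D>))" "K \<subseteq> generated (\<Union>(\<C> \<union> \<D>))"
        unfolding CD(3,4) by (rule generated_mono; blast)+
      then show "\<exists>L\<in>?F. H \<subseteq> L \<and> K \<subseteq> L" using Un[OF CD(1,2)] by blast
    qed
    have "generated (\<Union>\<C>) \<subseteq> \<A>" if "good \<C>" for \<C>
      using fam[OF that] by (simp add: subgroupoid_def)
    then show "\<Union>?F = \<A>" using cover by blast
  qed
qed

section \<open>From an AF groupoid to vanishing homology\<close>

lemma compact_open_rng_slice: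
  assumes H: "openin \<T> H" "compactin \<T> H" and V: "openin \<T> V" "compactin \<T> V" "V \<subseteq> \<U>"
  shows "openin \<T> {h \<in> H. r h \<in> V}" "compactin \<T> {h \<in> H. r h \<in> V}"
proof -
  have oV: "openin (unit_space G) V" and cV: "compactin (unit_space G) V"
    using V by (simp_all add: openin_unit_space_iff compactin_unit_space_iff)
  show "openin \<T> {h \<in> H. r h \<in> V}" by (rule openin_continuous_map_preimage_gen[OF continuous_rng H(1) oV])
  have "closedin (unit_space G) V" by (rule compactin_imp_closedin[OF Hausdorff_units cV])
  then have "closedin \<T> {h \<in> topspace \<T>. r h \<in> V}" by (rule closedin_continuous_map_preimage[OF continuous_rng])
  then have "compactin \<T> ({h \<in> topspace \<T>. r h \<in> V} \<inter> H)" using H(2) by (rule closed_Int_compactin)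
  moreover have "{h \<in> topspace \<T>. r h \<in> V} \<inter> H = {h \<in> H. r h \<in> V}" using openin_subset[OF H(1)] by blast
  ultimately show "compactin \<T> {h \<in> H. r h \<in> V}" by simp
qed

text \<open>Non-unit arrows of \<open>H\<close> have different source and range and form a compact set. So the pairs of their
  sources and ranges form a compact set that avoids the diagonal, and each unit has a neighbourhood
  that meets each orbit at most once. Finitely many of them cover the units of \<open>H\<close>. Going through them and
  adding each time the units whose orbits have not been met gives the transversal.\<close>

lemma exists_transversal:
  assumes sub: "subgroupoid G H" and pr: "principal G H" and co: "compact_open \<T> H"
  shows "\<exists>T. openin \<T> T \<and> compactin \<T> T \<and> T \<subseteq> H \<inter> \<U> \<and>
    (\<forall>h\<in>H. s h \<in> T \<longrightarrow> r h \<in> T \<longrightarrow> h \<in> \<U>) \<and> (\<forall>x\<in>H \<inter> \<U>. \<exists>h\<in>H. s h = x \<and> r h \<in> T)"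
proof -
  have H: "openin \<T> H" "compactin \<T> H" using co by (auto simp: compact_open_def)
  have HA: "H \<subseteq> \<A>" and H_inv: "\<And>h. h \<in> H \<Longrightarrow> iv h \<in> H"
    and H_comp: "\<And>h k. \<lbrakk>h \<in> H; k \<in> H; s h = r k\<rbrakk> \<Longrightarrow> h \<cdot> k \<in> H"
    using sub by (auto simp: subgroupoid_def)
  have sH: "s h \<in> H" if "h \<in> H" for h
    using H_comp[OF H_inv[OF that] that] that HA by (auto simp: src_ginv ginv_comp subset_iff)
  let ?H0 = "H \<inter> \<U>"
  have H0: "?H0 = s ` H" using sH HA src_unit src_of_unit by force
  have oH0: "openin \<T> ?H0" using H(1) open_units by blast
  have "compactin (unit_space G) (s ` H)" by (rule image_compactin[OF H(2) continuous_src])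
  then have cH0: "compactin \<T> ?H0" unfolding H0 by (simp add: compactin_unit_space_iff)
  let ?X = "prod_topology (unit_space G) (unit_space G)"
  have "continuous_map \<T> ?X (\<lambda>h. (s h, r h))"
    using continuous_src continuous_rng by (simp add: continuous_map_paired)
  from image_compactin[OF compactin_Diff_open[OF H(2) open_units] this]
  have cD: "compactin ?X ((\<lambda>h. (s h, r h)) ` (H - \<U>))" .
  have "Hausdorff_space ?X" using Hausdorff_units by (simp add: Hausdorff_space_prod_topology)
  from compactin_imp_closedin[OF this cD]
  have oD: "openin ?X (topspace ?X - (\<lambda>h. (s h, r h)) ` (H - \<U>))" by (simp add: closedin_def)
  define small where "small W \<longleftrightarrow> compactin \<T> W \<and> W \<subseteq> ?H0 \<and> (\<forall>h\<in>H. s h \<in> W \<longrightarrow> r h \<in> W \<longrightarrow> h \<in> \<U>)" for W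
  have ex_small: "\<exists>W. small W \<and> openin \<T> W \<and> x \<in> W" if x: "x \<in> ?H0" for x
  proof -
    have "(x, x) \<notin> (\<lambda>h. (s h, r h)) ` (H - \<U>)" using pr by (auto simp: principal_def)
    then have "(x, x) \<in> topspace ?X - (\<lambda>h. (s h, r h)) ` (H - \<U>)"
      using x by (simp add: topspace_unit_space)
    then obtain V1 V2 where V: "openin (unit_space G) V1" "openin (unit_space G) V2" "x \<in> V1" "x \<in> V2"
      "V1 \<times> V2 \<subseteq> topspace ?X - (\<lambda>h. (s h, r h)) ` (H - \<U>)"
      using oD[unfolded openin_prod_topology_alt, rule_format, of x x] by blast
    have "openin (unit_space G) ?H0" using oH0 by (simp add: openin_unit_space_iff)
    from openin_Int[OF openin_Int[OF V(1,2)] this] have "openin (unit_space G) (V1 \<inter> V2 \<inter> ?H0)" .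
    then obtain W where W: "openin (unit_space G) W" "compactin (unit_space G) W" "x \<in> W" "W \<subseteq> V1 \<inter> V2 \<inter> ?H0"
      using compact_open_neighbourhood[OF locally_compact_units Hausdorff_units totally_disconnected_units,
          of "V1 \<inter> V2 \<inter> ?H0" x] V(3,4) x by blast
    have "h \<in> \<U>" if h: "h \<in> H" "s h \<in> W" "r h \<in> W" for h
    proof (rule ccontr)
      assume "h \<notin> \<U>"
      then have "(s h, r h) \<in> (\<lambda>h. (s h, r h)) ` (H - \<U>)" using h(1) by blast
      moreover have "(s h, r h) \<in> V1 \<times> V2" using h W(4) by blast
      ultimately show False using V(5) by blast
    qed
    then show ?thesis
      using W by (intro exI[of _ W]) (auto simp: small_def openin_unit_space_iff compactin_unit_space_iff)
  qed
  have "\<exists>\<W>. finite \<W> \<and> (\<forall>W\<in>\<W>. small W \<and> openin \<T> W) \<and> ?H0 \<subseteq> \<Union>\<W>"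
    by (rule compactin_finite_subcover_pointwise[OF cH0]) (rule ex_small)
  then obtain \<W> where W: "finite \<W>" "\<forall>W\<in>\<W>. small W \<and> openin \<T> W" "?H0 \<subseteq> \<Union>\<W>" by (elim exE conjE)
  have "\<exists>T. openin \<T> T \<and> small T \<and> (\<forall>x\<in>\<Union>\<W>. \<exists>h\<in>H. s h = x \<and> r h \<in> T)"
    using W(1,2)
  proof (induction \<W>)
    case empty
    show ?case by (rule exI[of _ "{}"]) (simp add: small_def)
  next
    case (insert W \<W>)
    then obtain T where T: "openin \<T> T" "small T" "\<forall>x\<in>\<Union>\<W>. \<exists>h\<in>H. s h = x \<and> r h \<in> T" by auto
    have W: "openin \<T> W" "small W" using insert.prems by auto
    have TU: "T \<subseteq> \<U>" and cT: "compactin \<T> T" using T(2) by (auto simp: small_def)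
    \<comment> \<open>The units whose orbit meets \<open>T\<close>.\<close>
    define Z where "Z = s ` {h \<in> H. r h \<in> T}"
    note slice = compact_open_rng_slice[OF H T(1) cT TU]
    have oZ: "openin (unit_space G) Z" unfolding Z_def by (rule src_image_open[OF slice(1)])
    have cZ: "compactin (unit_space G) Z" unfolding Z_def by (rule image_compactin[OF slice(2) continuous_src])
    have "openin (unit_space G) (W - Z)"
      using W compactin_imp_closedin[OF Hausdorff_units cZ]
      by (intro openin_diff) (auto simp: small_def openin_unit_space_iff)
    then have o: "openin \<T> (T \<union> (W - Z))" using T(1) by (auto simp: openin_unit_space_iff)
    have c: "compactin \<T> (T \<union> (W - Z))"
      using cT W oZ compactin_Diff_open[of \<T> W Z]
      by (auto intro!: compactin_Un simp: small_def openin_unit_space_iff)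
    have Z_mem: "s h \<in> Z" if "h \<in> H" "r h \<in> T" for h using that by (auto simp: Z_def)
    have "h \<in> \<U>" if h: "h \<in> H" "s h \<in> T \<union> (W - Z)" "r h \<in> T \<union> (W - Z)" for h
    proof -
      have hA: "h \<in> \<A>" using h HA by blast
      consider "s h \<in> T" "r h \<in> T" | "s h \<in> W" "r h \<in> W" | "s h \<in> T" "r h \<in> W - Z" | "s h \<in> W - Z" "r h \<in> T"
        using h by blast
      then show ?thesis
      proof cases
        case 3
        then have "s (iv h) \<in> Z" using Z_mem[OF H_inv[OF h(1)]] hA by (simp add: rng_ginv)
        then show ?thesis using 3 hA by (simp add: src_ginv)
      qed (use T(2) W(2) h(1) Z_mem in \<open>auto simp: small_def\<close>)
    qed
    then have "small (T \<union> (W - Z))" using c T(2) W(2) by (auto simp: small_def)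
    moreover have "\<exists>h\<in>H. s h = x \<and> r h \<in> T \<union> (W - Z)" if x: "x \<in> \<Union>(insert W \<W>)" for x
    proof -
      consider "x \<in> \<Union>\<W>" | "x \<in> Z" | "x \<in> W" "x \<notin> Z" using x by blast
      then show ?thesis
      proof cases
        case 3
        then have "x \<in> H" "s x = x" "r x = x" using W(2) src_of_unit rng_of_unit by (auto simp: small_def)
        then show ?thesis using 3 by (intro bexI[of _ x]) auto
      qed (use T(3) in \<open>auto simp: Z_def\<close>)
    qed
    ultimately show ?case using o by (intro exI[of _ "T \<union> (W - Z)"] conjI ballI)
  qed
  then obtain T where "openin \<T> T" "small T" "\<forall>x\<in>\<Union>\<W>. \<exists>h\<in>H. s h = x \<and> r h \<in> T" by (elim exE conjE)
  then show ?thesis using W(3) by (intro exI[of _ T]) (auto simp: small_def)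
qed

lemma directed_family_finite:
  assumes "\<H> \<noteq> {}" "\<forall>H\<in>\<H>. \<forall>K\<in>\<H>. \<exists>L\<in>\<H>. H \<subseteq> L \<and> K \<subseteq> L" "finite \<F>" "\<F> \<subseteq> \<H>"
  shows "\<exists>L\<in>\<H>. \<Union>\<F> \<subseteq> L"
  using assms(3,4)
proof (induction \<F>)
  case empty
  then show ?case using assms(1) by auto
next
  case (insert H \<F>)
  then obtain L where "L \<in> \<H>" "\<Union>\<F> \<subseteq> L" by auto
  moreover obtain L' where "L' \<in> \<H>" "H \<subseteq> L'" "L \<subseteq> L'" using assms(2) insert.prems \<open>L \<in> \<H>\<close> by (metis insert_subset)
  ultimately show ?case by (intro bexI[of _ L']) auto
qed

lemma bisection_span_mono: "H \<subseteq> K \<Longrightarrow> bisection_span H \<subseteq> bisection_span K"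
  unfolding bisection_span_def by (intro span_mono) blast

text \<open>A bisection is compact, so it is contained in one member of a directed open cover.\<close>

lemma span_exhausted:
  assumes ne: "\<H> \<noteq> {}" and dir: "\<forall>H\<in>\<H>. \<forall>K\<in>\<H>. \<exists>L\<in>\<H>. H \<subseteq> L \<and> K \<subseteq> L"
    and op: "\<And>H. H \<in> \<H> \<Longrightarrow> openin \<T> H" and cov: "\<Union>\<H> = \<A>"
    and S: "finite S" "S \<subseteq> bisection_span Y"
  shows "\<exists>H\<in>\<H>. S \<subseteq> bisection_span (H \<inter> Y)"
  using S
proof (induction S)
  case empty
  then show ?case using ne by auto
next
  case (insert f S)
  have "\<exists>H\<in>\<H>. f \<in> bisection_span (H \<inter> Y)"
    using insert.prems(1)
  proof -
    assume "insert f S \<subseteq> bisection_span Y"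
    then have "f \<in> bisection_span Y" by simp
    then show ?thesis
    proof (induction rule: bisection_span_induct)
      case zero
      then show ?case using ne span_closed(1) by blast
    next
      case (bisection B)
      have "B \<subseteq> \<Union>\<H>" using cov bisectionD(3)[OF bisection(1)] by simp
      then have "\<exists>\<F>. finite \<F> \<and> \<F> \<subseteq> \<H> \<and> B \<subseteq> \<Union>\<F>"
        by (intro compactinD[OF bisectionD(2)[OF bisection(1)]]) (auto intro: op)
      then obtain \<F> where "finite \<F>" "\<F> \<subseteq> \<H>" "B \<subseteq> \<Union>\<F>" by (elim exE conjE)
      moreover from directed_family_finite[OF ne dir this(1,2)]
      obtain H where "H \<in> \<H>" "\<Union>\<F> \<subseteq> H" by (elim bexE)
      ultimately have "H \<in> \<H>" "B \<subseteq> H" by simp_all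
      then show ?case using bisection by (intro bexI[of _ H] indicator_in_span) auto
    next
      case (diff f h)
      then obtain H K where HK: "H \<in> \<H>" "f \<in> bisection_span (H \<inter> Y)" "K \<in> \<H>" "h \<in> bisection_span (K \<inter> Y)" by blast
      then obtain L where L: "L \<in> \<H>" "H \<subseteq> L" "K \<subseteq> L" using dir by blast
      have "f \<in> bisection_span (L \<inter> Y)" "h \<in> bisection_span (L \<inter> Y)"
        using HK L bisection_span_mono[of "H \<inter> Y" "L \<inter> Y"] bisection_span_mono[of "K \<inter> Y" "L \<inter> Y"] by auto
      then show ?case using L(1) span_closed(3) by blast
    qed
  qed
  then obtain H K where HK: "H \<in> \<H>" "f \<in> bisection_span (H \<inter> Y)" "K \<in> \<H>" "S \<subseteq> bisection_span (K \<inter> Y)"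
    using insert by auto
  then obtain L where L: "L \<in> \<H>" "H \<subseteq> L" "K \<subseteq> L" using dir by blast
  have "bisection_span (H \<inter> Y) \<subseteq> bisection_span (L \<inter> Y)" "bisection_span (K \<inter> Y) \<subseteq> bisection_span (L \<inter> Y)"
    by (rule bisection_span_mono; use L in blast)+
  then show ?case using HK L(1) by (intro bexI[of _ L]) auto
qed

text \<open>The set \<open>D\<close> of arrows of \<open>H\<close> with range in the transversal is invariant under right translation by
  \<open>H\<close>, so convolution with its indicator \<open>F\<close> does not distinguish a function on \<open>H\<close> from its
  augmentation; this gives linearity. Each unit of \<open>H\<close> is the source of exactly one arrow in
  \<open>D\<close>, which gives the retraction.\<close>

lemma local_retract_if_AF:
  assumes AF: "AF_groupoid G" and A: "finite A" "A \<subseteq> ZG" and B: "finite B" "B \<subseteq> ZU"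
  shows "\<exists>\<tau>\<in>ZU. \<exists>F\<in>ZG. (\<forall>n\<in>B. trivial_action G (F \<star> n) \<tau> = n) \<and>
    (\<forall>n\<in>B. \<forall>f\<in>A. F \<star> trivial_action G f n = (F \<star> n) \<star> f)"
proof -
  obtain \<H> where ne: "\<H> \<noteq> {}" and dir: "\<forall>H\<in>\<H>. \<forall>K\<in>\<H>. \<exists>L\<in>\<H>. H \<subseteq> L \<and> K \<subseteq> L"
    and mem: "\<And>H. H \<in> \<H> \<Longrightarrow> subgroupoid G H \<and> principal G H \<and> compact_open \<T> H" and cov: "\<Union>\<H> = \<A>"
    using AF unfolding AF_groupoid_def by metis
  have op: "openin \<T> H" if "H \<in> \<H>" for H using mem[OF that] by (simp add: compact_open_def)
  obtain H1 where H1: "H1 \<in> \<H>" "A \<subseteq> bisection_span (H1 \<inter> UNIV)"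
    using span_exhausted[OF ne dir op cov A(1), of UNIV] A(2) by (auto simp: ZG_eq_span)
  obtain H2 where H2: "H2 \<in> \<H>" "B \<subseteq> bisection_span (H2 \<inter> \<U>)"
    using span_exhausted[OF ne dir op cov B(1), of \<U>] B(2) by (auto simp: ZU_eq_span)
  obtain H where H: "H \<in> \<H>" "H1 \<subseteq> H" "H2 \<subseteq> H"
    using bspec[OF bspec[OF dir H1(1)] H2(1)] by (elim bexE conjE)
  have AH: "A \<subseteq> bisection_span H" and BH: "B \<subseteq> bisection_span (H \<inter> \<U>)"
    using H1(2) H2(2) H bisection_span_mono[of H1 H] bisection_span_mono[of "H2 \<inter> \<U>" "H \<inter> \<U>"] by auto
  have sub: "subgroupoid G H" "principal G H" "compact_open \<T> H" using mem[OF H(1)] by auto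
  have HA: "H \<subseteq> \<A>" and H_inv: "\<And>h. h \<in> H \<Longrightarrow> iv h \<in> H"
    and H_comp: "\<And>h k. \<lbrakk>h \<in> H; k \<in> H; s h = r k\<rbrakk> \<Longrightarrow> h \<cdot> k \<in> H"
    using sub by (auto simp: subgroupoid_def)
  have Hoc: "openin \<T> H" "compactin \<T> H" using sub by (auto simp: compact_open_def)
  obtain T where T: "openin \<T> T" "compactin \<T> T" "T \<subseteq> H \<inter> \<U>"
    "\<forall>h\<in>H. s h \<in> T \<longrightarrow> r h \<in> T \<longrightarrow> h \<in> \<U>" "\<forall>x\<in>H \<inter> \<U>. \<exists>h\<in>H. s h = x \<and> r h \<in> T"
    using exists_transversal[OF sub] by (elim exE conjE)
  have TU: "T \<subseteq> \<U>" using T(3) by blast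
  define D where "D = {h \<in> H. r h \<in> T}"
  have DA: "D \<subseteq> \<A>" using HA by (auto simp: D_def)
  have "Hausdorff_space (subtopology \<T> D)"
    using Hausdorff_space_subtopology[of "subtopology \<T> H" D] sub(3)
    by (simp add: compact_open_def subtopology_subtopology D_def Int_absorb1 Collect_conj_eq inf.absorb2 flip: Int_def)
  then have "compact_open \<T> D"
    using compact_open_rng_slice[OF Hoc T(1,2) TU] by (simp add: compact_open_def D_def)
  define F :: "'g \<Rightarrow> int" where "F = indicator D"
  have F: "F \<in> ZG"
    unfolding F_def compact_open_functions_def using \<open>compact_open \<T> D\<close> by (intro generate.incl) blast
  define \<tau> :: "'g \<Rightarrow> int" where "\<tau> = indicator T"
  have \<tau>: "\<tau> \<in> ZU"
    unfolding \<tau>_def ZU_eq_span by (rule indicator_in_span[OF bisection_units[OF T(1,2) TU] TU])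
  have ZU_ZG: "n \<in> ZG" if "n \<in> ZU" for n using that ZU_subset_ZG by blast
  have inj_D: "inj_on s D"
  proof (rule inj_onI)
    fix a b assume ab: "a \<in> D" "b \<in> D" "s a = s b"
    then have A: "a \<in> \<A>" "b \<in> \<A>" and H: "a \<in> H" "b \<in> H" and rT: "r a \<in> T" "r b \<in> T" using DA by (auto simp: D_def)
    have "a \<cdot> iv b \<in> H" using H_comp[OF H(1) H_inv[OF H(2)]] A ab(3) by (simp add: rng_ginv)
    moreover have "s (a \<cdot> iv b) = r b" "r (a \<cdot> iv b) = r a"
      using A ab(3) by (simp_all add: src_comp rng_comp ginv_closed rng_ginv src_ginv)
    ultimately have "a \<cdot> iv b \<in> \<U>" using T(4) rT by auto
    then show "a = b" using eq_if_comp_ginv_unit A ab(3) by blast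
  qed
  have F_units: "(F \<star> indicator V) = indicator {h \<in> D. s h \<in> V}" if V: "bisection V" "V \<subseteq> \<U>" for V
  proof
    fix g
    have sV: "s ` V = V" using V(2) src_of_unit by force
    show "(F \<star> indicator V) g = indicator {h \<in> D. s h \<in> V} g"
    proof (cases "g \<in> \<A> \<and> s g \<in> V")
      case True
      then have "(F \<star> indicator V) g = F (g \<cdot> iv (s g))"
        by (intro conv_indicator[OF F V(1)]) (auto simp: src_src)
      then show ?thesis using True by (simp add: ginv_unit src_unit comp_src F_def indicator_def)
    next
      case False
      then have "g \<notin> {h \<in> D. s h \<in> V}" using DA by blast
      moreover have "(F \<star> indicator V) g = 0"
        using False conv_indicator_zero[of g V F] conv_outside[of g] sV by metis
      ultimately show ?thesis by simp
    qed
  qed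
  have F_bisection: "F \<star> indicator (s ` C) = F \<star> indicator C" if C: "bisection C" "C \<subseteq> H" for C
  proof
    fix g
    have ssC: "s ` s ` C = s ` C" using bisectionD(3)[OF C(1)] src_src by (force simp: image_image)
    show "(F \<star> indicator (s ` C)) g = (F \<star> indicator C) g"
    proof (cases "g \<in> \<A> \<and> s g \<in> s ` C")
      case True
      then obtain c where c: "c \<in> C" "s g = s c" by auto
      have gA: "g \<in> \<A>" and cA: "c \<in> \<A>" and cH: "c \<in> H" using True c C bisectionD(3)[OF C(1)] by auto
      have "(F \<star> indicator (s ` C)) g = F (g \<cdot> iv (s g))"
        by (rule conv_indicator[OF F bisection_src[OF C(1)]]) (use True src_src in auto)
      also have "g \<cdot> iv (s g) = g" using gA by (simp add: ginv_unit src_unit comp_src)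
      also have "F g = F (g \<cdot> iv c)"
      proof -
        have "g \<cdot> iv c \<in> H" if "g \<in> H" using H_comp[OF that H_inv[OF cH]] c cA by (simp add: rng_ginv)
        moreover have "g \<in> H" if "g \<cdot> iv c \<in> H"
          using H_comp[OF that cH] comp_ginv_comp[OF gA cA c(2)] gA cA c(2)
          by (simp add: src_comp ginv_closed rng_ginv src_ginv)
        moreover have "r (g \<cdot> iv c) = r g" using gA cA c(2) by (simp add: rng_comp ginv_closed rng_ginv)
        ultimately show ?thesis unfolding F_def D_def indicator_def by auto
      qed
      also have "\<dots> = (F \<star> indicator C) g" using conv_indicator[OF F C(1) c(1) gA c(2)] by simp
      finally show ?thesis .
    next
      case False
      then show ?thesis
        using conv_indicator_zero[of g C F] conv_indicator_zero[of g "s ` C" F] conv_outside[of g] ssC by metis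
    qed
  qed
  have F_aug: "F \<star> augmentation f = F \<star> f" if "f \<in> bisection_span H" for f
    using that
  proof (induction rule: bisection_span_induct)
    case (bisection C)
    then show ?case by (simp add: augmentation_indicator F_bisection)
  next
    case (diff f h)
    then have "f \<in> ZG" "h \<in> ZG" using span_subset_ZG by blast+
    then show ?case using diff by (simp add: augmentation_diff conv_diff_right)
  qed simp
  have n_act: "n \<star> f \<in> bisection_span H" if n: "n \<in> ZU" and f: "f \<in> bisection_span H" for n f
    using n unfolding ZU_eq_span
  proof (induction rule: bisection_span_induct)
    case (bisection V)
    note V = this
    show ?case using f
    proof (induction rule: bisection_span_induct)
      case (bisection C)
      have "arrow_products V C \<subseteq> C"
      proof
        fix g assume "g \<in> arrow_products V C"
        then obtain v c where vc: "v \<in> V" "c \<in> C" "s v = r c" "g = v \<cdot> c" by (auto simp: arrow_products_def)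
        then have "v = r c" "c \<in> \<A>" using V src_of_unit bisectionD(3)[OF bisection(1)] by auto
        then show "g \<in> C" using vc comp_rng by simp
      qed
      then show ?case
        using V bisection by (simp add: conv_indicators indicator_in_span bisection_arrow_products)
    qed (simp_all add: span_closed conv_diff_right)
  next
    case (diff n m)
    then have "n \<in> ZG" "m \<in> ZG" using span_subset_ZG by blast+
    then show ?case using diff by (simp add: conv_diff_left span_closed)
  qed (simp add: span_closed)
  have retract: "trivial_action G (F \<star> n) \<tau> = n" if n: "n \<in> bisection_span (H \<inter> \<U>)" for n
  proof -
    have "augmentation (\<tau> \<star> (F \<star> n)) = n" using n
    proof (induction rule: bisection_span_induct)
      case (bisection V)
      then have VU: "V \<subseteq> \<U>" and VH: "V \<subseteq> H" by auto
      let ?DV = "{h \<in> D. s h \<in> V}"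
      have FV: "F \<star> indicator V = indicator ?DV" by (rule F_units[OF bisection(1) VU])
      then have "indicator ?DV \<in> ZG" using conv_closed[OF F ZG_indicator[OF bisection(1)]] by simp
      then have "\<tau> \<star> indicator ?DV = (indicator ?DV :: 'g \<Rightarrow> int)"
        unfolding \<tau>_def by (rule conv_local_unit[OF _ TU]) (auto simp: indicator_def D_def split: if_splits)
      moreover have "augmentation (indicator ?DV) = indicator (s ` ?DV)"
        by (rule augmentation_indicator_inj) (use DA inj_on_subset[OF inj_D] in auto)
      moreover have "s ` ?DV = V"
      proof (intro equalityI subsetI)
        fix x assume x: "x \<in> V"
        then obtain h where "h \<in> H" "s h = x" "r h \<in> T" using T(5) VU VH by blast
        then show "x \<in> s ` ?DV" using x by (force simp: D_def)
      qed auto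
      ultimately show ?case using FV by simp
    next
      case (diff n m)
      then have "n \<in> ZG" "m \<in> ZG" using span_subset_ZG by blast+
      then show ?case using diff F ZU_ZG[OF \<tau>] by (simp add: conv_diff_right augmentation_diff conv_closed)
    qed simp
    moreover have "n \<in> ZG" using n span_subset_ZG by blast
    ultimately show ?thesis using trivial_action_eq[OF \<tau> conv_closed[OF F]] by simp
  qed
  have linear: "F \<star> trivial_action G f n = (F \<star> n) \<star> f" if "n \<in> ZU" "f \<in> bisection_span H" for n f
  proof -
    have f: "f \<in> ZG" using that span_subset_ZG by blast
    show ?thesis
      using F_aug[OF n_act[OF that]] conv_assoc[OF F ZU_ZG[OF that(1)] f] trivial_action_eq[OF that(1) f] by simp
  qed
  have "\<forall>n\<in>B. trivial_action G (F \<star> n) \<tau> = n"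
    using retract subsetD[OF BH] by simp
  moreover have "\<forall>n\<in>B. \<forall>f\<in>A. F \<star> trivial_action G f n = (F \<star> n) \<star> f"
    using linear subsetD[OF AH] subsetD[OF B(2)] by simp
  ultimately show ?thesis using F \<tau> by (intro bexI[of _ \<tau>] bexI[of _ F] conjI)
qed

lemma Tor_trivial_if_AF:
  fixes M :: "('g \<Rightarrow> int, 'm) module"
  assumes AF: "AF_groupoid G" and M: "unitary_left_module (groupoid_ring G) M"
    and size: "ZG \<lesssim> (UNIV :: 'm set)" "infinite (UNIV :: 'm set) \<or> ZG = {\<lambda>_. 0}"
  shows "trivial_group (Tor (groupoid_ring G) (Suc n) (trivial_right_module G) M)"
proof -
  interpret N: right_module "groupoid_ring G" "trivial_right_module G" by (rule right_module_trivial)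
  have sub: "n \<in> ZG" if "n \<in> ZU" for n using that ZU_subset_ZG by blast
  show ?thesis
  proof (rule N.Tor_trivial_of_local_retract[OF _ M])
    fix A B assume "finite A" "A \<subseteq> carrier (groupoid_ring G)" "finite B" "B \<subseteq> carrier (trivial_right_module G)"
    then obtain \<tau> F where "\<tau> \<in> ZU" "F \<in> ZG" "\<forall>n\<in>B. trivial_action G (F \<star> n) \<tau> = n"
      "\<forall>n\<in>B. \<forall>f\<in>A. F \<star> trivial_action G f n = (F \<star> n) \<star> f"
      using local_retract_if_AF[OF AF, of A B] unfolding ring_simps module_simps by metis
    then show "\<exists>\<tau>\<in>carrier (trivial_right_module G). \<exists>\<Lambda>.
        (\<forall>x\<in>carrier (trivial_right_module G). \<Lambda> x \<in> carrier (groupoid_ring G)) \<and>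
        (\<forall>x\<in>carrier (trivial_right_module G). \<forall>y\<in>carrier (trivial_right_module G).
          \<Lambda> (x \<oplus>\<^bsub>trivial_right_module G\<^esub> y) = \<Lambda> x \<oplus>\<^bsub>groupoid_ring G\<^esub> \<Lambda> y) \<and>
        (\<forall>x\<in>B. \<Lambda> x \<odot>\<^bsub>trivial_right_module G\<^esub> \<tau> = x) \<and>
        (\<forall>x\<in>B. \<forall>f\<in>A. \<Lambda> (f \<odot>\<^bsub>trivial_right_module G\<^esub> x) = \<Lambda> x \<otimes>\<^bsub>groupoid_ring G\<^esub> f)"
      by (intro bexI[of _ \<tau>] exI[of _ "\<lambda>n. F \<star> n"])
        (simp_all add: ring_simps module_simps conv_closed sub conv_add_right)
  qed (use size in \<open>simp_all add: ring_simps\<close>)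
qed

text \<open>A nonzero function has infinitely many multiples. So a type that is at least as large as the ring is
  infinite unless the ring is zero, as the construction of projective covers requires.\<close>

lemma infinite_or_trivial_ring: "infinite ZG \<or> ZG = {\<lambda>_. 0}"
proof (rule disjCI)
  assume "ZG \<noteq> {\<lambda>_. 0}"
  then obtain f where f: "f \<in> ZG" "f \<noteq> (\<lambda>_. 0)" using ZG_closed(1) by blast
  then obtain a where a: "f a \<noteq> 0" by (auto simp: fun_eq_iff)
  have "(\<lambda>x. int k * f x) \<in> ZG" for k
  proof (induction k)
    case (Suc k)
    then show ?case using ZG_closed(2)[OF f(1) Suc] by (simp add: algebra_simps)
  qed (simp add: ZG_closed)
  then have "range (\<lambda>k x. int k * f x) \<subseteq> ZG" by blast
  moreover have "inj (\<lambda>k x. int k * f x)"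
  proof (rule injI)
    fix k l assume "(\<lambda>x. int k * f x) = (\<lambda>x. int l * f x)"
    then have "int k * f a = int l * f a" by (rule fun_cong)
    then show "k = l" using a by simp
  qed
  ultimately show "infinite ZG" using finite_subset range_inj_infinite by blast
qed

end

lemma Sup_enat_eq_0_iff: "Sup S = (0 :: enat) \<longleftrightarrow> (\<forall>x\<in>S. x = 0)"
  using Sup_bot_conv(1)[of S] by (simp add: bot_enat_def)

theorem theoremA:
  fixes G :: "'g groupoid"
  assumes "ample_groupoid G"
    and "carrier (groupoid_ring G) \<lesssim> (UNIV :: 'm set)"
  shows "AF_groupoid G \<longleftrightarrow> homological_dimension TYPE('m) G = 0"
proof -
  interpret ample_groupoid G by fact
  have size: "ZG \<lesssim> (UNIV :: 'm set)" using assms(2) by (simp add: ring_simps)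
  then have size': "infinite (UNIV :: 'm set) \<or> ZG = {\<lambda>_. 0}"
    using infinite_or_trivial_ring size inj_on_finite unfolding lepoll_def by blast
  have "homological_dimension TYPE('m) G = 0 \<longleftrightarrow>
    (\<forall>n (M :: ('g \<Rightarrow> int, 'm) module). unitary_left_module (groupoid_ring G) M \<longrightarrow>
      \<not> trivial_group (groupoid_homology G n M) \<longrightarrow> n = 0)"
    unfolding homological_dimension_def Sup_enat_eq_0_iff setcompr_eq_image by (auto simp: zero_enat_def)
  also have "\<dots> \<longleftrightarrow> (\<forall>n (M :: ('g \<Rightarrow> int, 'm) module). unitary_left_module (groupoid_ring G) M \<longrightarrow>
      trivial_group (Tor (groupoid_ring G) (Suc n) (trivial_right_module G) M))"
    unfolding groupoid_homology_def by (metis nat.distinct(1) not0_implies_Suc)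
  also have "\<dots> \<longleftrightarrow> AF_groupoid G"
    using AF_if_Tor_trivial[OF _ size size'] Tor_trivial_if_AF[OF _ _ size size'] by blast
  finally show ?thesis by simp
qed

end
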